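(* Let $(S,\mathcal B)$ be a measurable space and let $k:S\times S\to\mathbb C$ be jointly measurable and positive definite in the sense that for every signed measure $\xi$ on $\mathcal B$ the double integral $\langle\xi,\xi\rangle_k=\iint_{S\times S}\overline{d\xi(t)}\,k(t,s)\,d\xi(s)$ is nonnegative or $+\infty$. Let $\mathfrak M_1(k)$ be the space of equivalence classes of signed measures $\xi$ on $\mathcal B$ with $\langle\xi,\xi\rangle_k<\infty$, where $\langle\xi,\eta\rangle_k=\iint\overline{d\eta(t)}k(t,s)d\xi(s)$ and $\xi_1\sim\xi_2$ iff $\langle\xi_1-\xi_2,\xi_1-\xi_2\rangle_k=0$; let $(\mathfrak M_1(k))^*$ be the space of continuous anti-linear functionals on $\mathfrak M_1(k)$ with the dual norm. For $\xi\in\mathfrak M_1(k)$ let $T_k\xi\in(\mathfrak M_1(k))^*$ be given by $(T_k\xi)(t)=\int_Sk(t,s)d\xi(s)$, acting as $\mu\mapsto\langle\xi,\mu\rangle_k$. Then the space of functions on $\mathfrak M_1(k)$ of the form $\widetilde f(\xi)=\langle f,\xi\rangle$, $f\in(\mathfrak M_1(k))^*$, endowed with the norm $\|\widetilde f\|=\|f\|_{(\mathfrak M_1(k))^*}$ (the dual norm), is a Hilbert space of functions defined on $\mathfrak M_1(k)$ with reproducing kernel $(\mu,\nu)\mapsto\langle T_k\mu,T_k\nu\rangle$ and reproducing kernel property $\widetilde f(\xi)=\langle f,T_k\xi\rangle_{(\mathfrak M_1(k))^*}$.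
   Context: The dual norm $\sup_{\langle\xi,\xi\rangle_k\le1}|f(\xi)|$ on $(\mathfrak M_1(k))^*$ is induced by an inner product, denoted $\langle\cdot,\cdot\rangle_{(\mathfrak M_1(k))^*}$. *)

theory Defs
  imports "HOL-Analysis.Analysis"
begin

definition complex_measure :: "'a measure \<Rightarrow> ('a set \<Rightarrow> complex) \<Rightarrow> bool" where
  "complex_measure M \<xi> \<longleftrightarrow>
     (\<forall>A. A \<notin> sets M \<longrightarrow> \<xi> A = 0) \<and>
     (\<forall>A::nat \<Rightarrow> 'a set. range A \<subseteq> sets M \<longrightarrow> disjoint_family A \<longrightarrow>
        (\<lambda>i. \<xi> (A i)) sums \<xi> (\<Union>i. A i))"

definition cm_variation :: "'a measure \<Rightarrow> ('a set \<Rightarrow> complex) \<Rightarrow> 'a measure" where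
  "cm_variation M \<xi> = measure_of (space M) (sets M)
     (\<lambda>A. SUP P\<in>{P::nat \<Rightarrow> 'a set. range P \<subseteq> sets M \<and> disjoint_family P \<and> (\<Union>i. P i) = A}.
            (\<Sum>i. ennreal (cmod (\<xi> (P i)))))"

definition sm_pos :: "'a measure \<Rightarrow> ('a set \<Rightarrow> real) \<Rightarrow> 'a measure" where
  "sm_pos M \<rho> = measure_of (space M) (sets M)
     (\<lambda>A. SUP B\<in>{B\<in>sets M. B \<subseteq> A}. ennreal (\<rho> B))"

definition sm_neg :: "'a measure \<Rightarrow> ('a set \<Rightarrow> real) \<Rightarrow> 'a measure" where
  "sm_neg M \<rho> = sm_pos M (\<lambda>A. - \<rho> A)"

definition sm_integral :: "'a measure \<Rightarrow> ('a set \<Rightarrow> real) \<Rightarrow> ('a \<Rightarrow> complex) \<Rightarrow> complex" where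
  "sm_integral M \<rho> f = (\<integral>x. f x \<partial>sm_pos M \<rho>) - (\<integral>x. f x \<partial>sm_neg M \<rho>)"

definition cm_integral :: "'a measure \<Rightarrow> ('a set \<Rightarrow> complex) \<Rightarrow> ('a \<Rightarrow> complex) \<Rightarrow> complex" where
  "cm_integral M \<xi> f = sm_integral M (\<lambda>A. Re (\<xi> A)) f + \<i> * sm_integral M (\<lambda>A. Im (\<xi> A)) f"

definition kip :: "'a measure \<Rightarrow> ('a \<Rightarrow> 'a \<Rightarrow> complex) \<Rightarrow> ('a set \<Rightarrow> complex) \<Rightarrow> ('a set \<Rightarrow> complex) \<Rightarrow> complex" where
  "kip M k \<xi> \<eta> = cm_integral M (\<lambda>A. cnj (\<eta> A)) (\<lambda>t. cm_integral M \<xi> (\<lambda>s. k t s))"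

definition kfinite :: "'a measure \<Rightarrow> ('a \<Rightarrow> 'a \<Rightarrow> complex) \<Rightarrow> ('a set \<Rightarrow> complex) \<Rightarrow> bool" where
  "kfinite M k \<xi> \<longleftrightarrow> integrable (cm_variation M \<xi> \<Otimes>\<^sub>M cm_variation M \<xi>) (\<lambda>(t, s). k t s)"

definition kq :: "'a measure \<Rightarrow> ('a \<Rightarrow> 'a \<Rightarrow> complex) \<Rightarrow> ('a set \<Rightarrow> complex) \<Rightarrow> ereal" where
  "kq M k \<xi> = (if kfinite M k \<xi> then ereal (Re (kip M k \<xi> \<xi>)) else \<infinity>)"

definition kernel_pd :: "'a measure \<Rightarrow> ('a \<Rightarrow> 'a \<Rightarrow> complex) \<Rightarrow> bool" where
  "kernel_pd M k \<longleftrightarrow> (\<forall>\<xi>. complex_measure M \<xi> \<longrightarrow> kfinite M k \<xi> \<longrightarrow>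
      kip M k \<xi> \<xi> \<in> \<real> \<and> Re (kip M k \<xi> \<xi>) \<ge> 0)"

definition M1 :: "'a measure \<Rightarrow> ('a \<Rightarrow> 'a \<Rightarrow> complex) \<Rightarrow> ('a set \<Rightarrow> complex) set" where
  "M1 M k = {\<xi>. complex_measure M \<xi> \<and> kq M k \<xi> < \<infinity>}"

definition kcls :: "'a measure \<Rightarrow> ('a \<Rightarrow> 'a \<Rightarrow> complex) \<Rightarrow> ('a set \<Rightarrow> complex) \<Rightarrow> ('a set \<Rightarrow> complex) set" where
  "kcls M k \<xi> = {\<eta> \<in> M1 M k. kq M k (\<lambda>A. \<xi> A - \<eta> A) = 0}"

definition Mq :: "'a measure \<Rightarrow> ('a \<Rightarrow> 'a \<Rightarrow> complex) \<Rightarrow> ('a set \<Rightarrow> complex) set set" where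
  "Mq M k = kcls M k ` M1 M k"

definition kdual :: "'a measure \<Rightarrow> ('a \<Rightarrow> 'a \<Rightarrow> complex) \<Rightarrow> (('a set \<Rightarrow> complex) set \<Rightarrow> complex) set" where
  "kdual M k = {F. F \<in> extensional (Mq M k) \<and>
     (\<forall>\<xi>\<in>M1 M k. \<forall>\<eta>\<in>M1 M k. \<forall>a b. (\<lambda>A. a * \<xi> A + b * \<eta> A) \<in> M1 M k \<longrightarrow>
        F (kcls M k (\<lambda>A. a * \<xi> A + b * \<eta> A)) = cnj a * F (kcls M k \<xi>) + cnj b * F (kcls M k \<eta>)) \<and>
     (\<forall>\<xi>\<in>M1 M k. \<forall>e>0. \<exists>d>0. \<forall>\<eta>\<in>M1 M k.
        kq M k (\<lambda>A. \<eta> A - \<xi> A) < ereal d \<longrightarrow> cmod (F (kcls M k \<eta>) - F (kcls M k \<xi>)) < e)}"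

definition kdual_norm :: "'a measure \<Rightarrow> ('a \<Rightarrow> 'a \<Rightarrow> complex) \<Rightarrow> (('a set \<Rightarrow> complex) set \<Rightarrow> complex) \<Rightarrow> real" where
  "kdual_norm M k F = (SUP \<xi>\<in>{\<xi>\<in>M1 M k. kq M k \<xi> \<le> 1}. cmod (F (kcls M k \<xi>)))"

text \<open>The inner product inducing the dual norm (polarization identity; linear in the first argument).\<close>
definition kdual_ip :: "'a measure \<Rightarrow> ('a \<Rightarrow> 'a \<Rightarrow> complex) \<Rightarrow> (('a set \<Rightarrow> complex) set \<Rightarrow> complex) \<Rightarrow> (('a set \<Rightarrow> complex) set \<Rightarrow> complex) \<Rightarrow> complex" where
  "kdual_ip M k F G = (\<Sum>m<4::nat. \<i> ^ m * complex_of_real ((kdual_norm M k (restrict (\<lambda>c. F c + \<i> ^ m * G c) (Mq M k)))\<^sup>2)) / 4"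

definition Tk :: "'a measure \<Rightarrow> ('a \<Rightarrow> 'a \<Rightarrow> complex) \<Rightarrow> ('a set \<Rightarrow> complex) \<Rightarrow> (('a set \<Rightarrow> complex) set \<Rightarrow> complex)" where
  "Tk M k \<xi> = restrict (\<lambda>c. kip M k \<xi> (SOME \<mu>. \<mu> \<in> c)) (Mq M k)"

definition kK :: "'a measure \<Rightarrow> ('a \<Rightarrow> 'a \<Rightarrow> complex) \<Rightarrow> ('a set \<Rightarrow> complex) set \<Rightarrow> ('a set \<Rightarrow> complex) set \<Rightarrow> complex" where
  "kK M k c d = kdual_ip M k (Tk M k (SOME \<mu>. \<mu> \<in> c)) (Tk M k (SOME \<nu>. \<nu> \<in> d))"

definition hilbert_fun_space :: "'x set \<Rightarrow> ('x \<Rightarrow> complex) set \<Rightarrow> (('x \<Rightarrow> complex) \<Rightarrow> ('x \<Rightarrow> complex) \<Rightarrow> complex) \<Rightarrow> bool" where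
  "hilbert_fun_space X H ip \<longleftrightarrow>
     H \<subseteq> extensional X \<and>
     restrict (\<lambda>_. 0) X \<in> H \<and>
     (\<forall>f\<in>H. \<forall>g\<in>H. restrict (\<lambda>x. f x + g x) X \<in> H) \<and>
     (\<forall>c. \<forall>f\<in>H. restrict (\<lambda>x. c * f x) X \<in> H) \<and>
     (\<forall>f\<in>H. \<forall>g\<in>H. \<forall>h\<in>H. ip (restrict (\<lambda>x. f x + g x) X) h = ip f h + ip g h) \<and>
     (\<forall>c. \<forall>f\<in>H. \<forall>g\<in>H. ip (restrict (\<lambda>x. c * f x) X) g = c * ip f g) \<and>
     (\<forall>f\<in>H. \<forall>g\<in>H. ip g f = cnj (ip f g)) \<and>
     (\<forall>f\<in>H. Re (ip f f) \<ge> 0) \<and>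
     (\<forall>f\<in>H. ip f f = 0 \<longrightarrow> f = restrict (\<lambda>_. 0) X) \<and>
     (\<forall>u::nat \<Rightarrow> 'x \<Rightarrow> complex. (\<forall>n. u n \<in> H) \<longrightarrow>
        (\<forall>e>0. \<exists>N. \<forall>m\<ge>N. \<forall>n\<ge>N.
           sqrt (Re (ip (restrict (\<lambda>x. u m x - u n x) X) (restrict (\<lambda>x. u m x - u n x) X))) < e) \<longrightarrow>
        (\<exists>g\<in>H. (\<lambda>n. sqrt (Re (ip (restrict (\<lambda>x. u n x - g x) X) (restrict (\<lambda>x. u n x - g x) X))))
                  \<longlonglongrightarrow> 0))"

text \<open>K is a reproducing kernel for (H, ip) on X: for each y, the section K(y, .) lies in H
  and f(y) = <f, K(y, .)> for all f in H. (Sections are taken in the second variable since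
  the functions in H are anti-linear and ip is linear in its first argument.)\<close>
definition reproducing_kernel :: "'x set \<Rightarrow> ('x \<Rightarrow> complex) set \<Rightarrow> (('x \<Rightarrow> complex) \<Rightarrow> ('x \<Rightarrow> complex) \<Rightarrow> complex) \<Rightarrow> ('x \<Rightarrow> 'x \<Rightarrow> complex) \<Rightarrow> bool" where
  "reproducing_kernel X H ip K \<longleftrightarrow>
     (\<forall>y\<in>X. restrict (K y) X \<in> H \<and> (\<forall>f\<in>H. f y = ip f (restrict (K y) X)))"

end

theory Submission
  imports Defs
begin

text \<open>
  The space \<open>M1 M k\<close> need not be closed under addition, since \<open>k\<close> may fail to be absolutely integrable
  against \<open>|\<xi>| \<otimes> |\<eta>|\<close> even when it is so against \<open>|\<xi>| \<otimes> |\<xi>|\<close> and \<open>|\<eta>| \<otimes> |\<eta>|\<close>. The measures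
  concentrated on one of the level sets \<open>{t. k t t \<le> n}\<close>, however, form a genuine subspace, because
  Dirac measures give \<open>|k t s|\<^sup>2 \<le> k t t * k s s\<close>, and truncation to these level sets shows that this
  subspace is dense. Testing the Cauchy-Schwarz inequality against measures with unimodular density
  shows that the iterated integral \<open>\<langle>\<xi>, \<eta>\<rangle>\<close> converges for all \<open>\<xi>, \<eta> \<in> M1 M k\<close>, so that it is the continuous
  extension of the form on the subspace. A near-maximiser of a functional \<open>F\<close> on the unit ball
  yields \<open>x\<close> in the subspace with \<open>T x\<close> close to \<open>F\<close>; hence the range of \<open>T\<close> is dense in the
  dual, the inner product of the dual is \<open>\<langle>F, G\<rangle> = lim F (x\<^sub>n)\<close> whenever \<open>T x\<^sub>n\<close> tends to \<open>G\<close>, and the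
  Hilbert space axioms and the reproducing property pass to the limit.
\<close>

section \<open>Variation and Jordan decomposition\<close>

text \<open>An integral against a complex measure is assembled from four Jordan parts, which do not
  add up when measures are added, and a Bochner integral of a non-integrable function is 0. Hence
  linearity of \<open>kip\<close> is available only where absolute convergence is known. The device
  is to represent all measures at hand by densities with respect to one finite positive measure. The
  variation is compared with such a density only up to a factor 4, one unit per Jordan part; the
  constants 16 and 256 are powers of it and matter only for finiteness and for limits 0. Since sums
  can leave \<open>M1 M k\<close>, a functional is antilinear only where the combination is
  admissible, and the usual Riesz or parallelogram arguments do not apply on \<open>M1 M k\<close>
  itself. Dual norms are therefore computed on the linear subspace, and the polarised form is turned
  into a limit of evaluations, whose linearity is visible. The testing argument is run twice, first
  for the rows of the kernel and then for potentials: the second run needs the everywhere finite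
  potentials that the first one provides.\<close>

definition countable_partitions :: "'a measure \<Rightarrow> 'a set \<Rightarrow> (nat \<Rightarrow> 'a set) set" where
  "countable_partitions M A = {P. range P \<subseteq> sets M \<and> disjoint_family P \<and> (\<Union>i. P i) = A}"

text \<open>One construction serves two measures: with \<open>\<phi>\<close> the modulus of a
  complex set function it is the total variation, with \<open>\<phi>\<close> the positive part of a
  real one it is the upper variation.\<close>

definition partition_sup :: "'a measure \<Rightarrow> ('a set \<Rightarrow> ennreal) \<Rightarrow> 'a set \<Rightarrow> ennreal" where
  "partition_sup M \<phi> A = (SUP P\<in>countable_partitions M A. \<Sum>i. \<phi> (P i))"

lemma binaryset_partition:
  assumes "A \<in> sets M" "B \<in> sets M" "A \<inter> B = {}"
  shows "binaryset A B \<in> countable_partitions M (A \<union> B)"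
  using assms
  by (auto simp: countable_partitions_def range_binaryset_eq UN_binaryset_eq disjoint_family_on_def binaryset_def)

lemma suminf_ennreal_swap:
  fixes f :: "nat \<Rightarrow> nat \<Rightarrow> ennreal"
  shows "(\<Sum>j. \<Sum>i. f i j) = (\<Sum>i. \<Sum>j. f i j)"
proof -
  have "(\<Sum>j. \<Sum>i. f i j) = (\<integral>\<^sup>+j. (\<Sum>i. f i j) \<partial>count_space UNIV)"
    by (simp add: nn_integral_count_space_nat)
  also have "\<dots> = (\<Sum>i. \<integral>\<^sup>+j. f i j \<partial>count_space UNIV)"
    by (rule nn_integral_suminf) simp
  finally show ?thesis by (simp add: nn_integral_count_space_nat)
qed

context
  fixes M :: "'a measure" and \<phi> :: "'a set \<Rightarrow> ennreal"
  assumes zero: "\<phi> {} = 0"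
    and subadd: "\<And>A. range A \<subseteq> sets M \<Longrightarrow> disjoint_family A \<Longrightarrow> \<phi> (\<Union>i. A i) \<le> (\<Sum>i::nat. \<phi> (A i))"
begin

lemma partition_sup_upper:
  assumes "A \<in> sets M" shows "\<phi> A \<le> partition_sup M \<phi> A"
proof -
  have "\<phi> A = (\<Sum>i. \<phi> (binaryset A {} i))" using suminf_binaryset_eq[of \<phi> A "{}"] zero by simp
  also have "\<dots> \<le> partition_sup M \<phi> A"
    unfolding partition_sup_def using binaryset_partition[of A M "{}"] assms
    by (intro SUP_upper) simp
  finally show ?thesis .
qed

lemma partition_sup_Un:
  assumes AB: "A \<in> sets M" "B \<in> sets M" "A \<inter> B = {}"
  shows "partition_sup M \<phi> A + partition_sup M \<phi> B \<le> partition_sup M \<phi> (A \<union> B)"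
proof -
  have ne: "countable_partitions M C \<noteq> {}" if "C \<in> sets M" for C
    using binaryset_partition[of C M "{}"] that by auto
  have "(\<Sum>i. \<phi> (P i)) + (\<Sum>i. \<phi> (Q i)) \<le> partition_sup M \<phi> (A \<union> B)"
    if P: "P \<in> countable_partitions M A" and Q: "Q \<in> countable_partitions M B" for P Q
  proof -
    \<comment> \<open>Interleaving turns two sequences into one: even indices enumerate
      \<open>P\<close>, odd ones \<open>Q\<close>. Its first \<open>2 * n\<close> terms then contain
      exactly the first \<open>n\<close> terms of both.\<close>
    define S where "S n = (if even n then P (n div 2) else Q (n div 2))" for n
    have PQ: "P i \<inter> Q j = {}" for i j
      using P Q AB(3) by (auto simp: countable_partitions_def)
    have "S \<in> countable_partitions M (A \<union> B)"
      unfolding countable_partitions_def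
    proof (intro CollectI conjI)
      show "range S \<subseteq> sets M" using P Q by (auto simp: S_def countable_partitions_def)
      show "disjoint_family S"
      proof (unfold disjoint_family_on_def, intro ballI impI)
        fix m n :: nat assume "m \<noteq> n"
        have dP: "P i \<inter> P j = {}" if "i \<noteq> j" for i j
          using P that by (auto simp: countable_partitions_def disjoint_family_on_def)
        have dQ: "Q i \<inter> Q j = {}" if "i \<noteq> j" for i j
          using Q that by (auto simp: countable_partitions_def disjoint_family_on_def)
        have "m div 2 \<noteq> n div 2" if "even m = even n"
          using that \<open>m \<noteq> n\<close> by (metis bit_eq_rec)
        then show "S m \<inter> S n = {}" using dP dQ PQ by (auto simp: S_def) blast+
      qed
      have "P i \<subseteq> (\<Union>n. S n)" for i by (rule order_trans[OF _ UN_upper[of "2 * i"]]) (auto simp: S_def)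
      moreover have "Q i \<subseteq> (\<Union>n. S n)" for i by (rule order_trans[OF _ UN_upper[of "2 * i + 1"]]) (auto simp: S_def)
      moreover have "S n \<subseteq> A \<union> B" for n using P Q by (auto simp: S_def countable_partitions_def)
      moreover have "A = (\<Union>i. P i)" "B = (\<Union>i. Q i)" using P Q by (auto simp: countable_partitions_def)
      ultimately show "(\<Union>n. S n) = A \<union> B" by (metis UN_least Un_least equalityI)
    qed
    then have "(\<Sum>i. \<phi> (S i)) \<le> partition_sup M \<phi> (A \<union> B)"
      unfolding partition_sup_def by (rule SUP_upper)
    moreover have "(\<Sum>i. \<phi> (P i) + \<phi> (Q i)) \<le> (\<Sum>i. \<phi> (S i))"
    proof (rule suminf_le_const)
      fix n
      have "(\<Sum>i<n. \<phi> (P i) + \<phi> (Q i)) = (\<Sum>i<2*n. \<phi> (S i))"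
        by (induction n) (simp_all add: S_def)
      also have "\<dots> \<le> (\<Sum>i. \<phi> (S i))" by (rule sum_le_suminf) auto
      finally show "(\<Sum>i<n. \<phi> (P i) + \<phi> (Q i)) \<le> (\<Sum>i. \<phi> (S i))" .
    qed simp
    moreover have "(\<Sum>i. \<phi> (P i) + \<phi> (Q i)) = (\<Sum>i. \<phi> (P i)) + (\<Sum>i. \<phi> (Q i))"
      by (rule suminf_add[symmetric]) auto
    ultimately show ?thesis by simp
  qed
  then have "(SUP Q\<in>countable_partitions M B. SUP P\<in>countable_partitions M A. (\<Sum>i. \<phi> (P i)) + (\<Sum>i. \<phi> (Q i)))
      \<le> partition_sup M \<phi> (A \<union> B)"
    by (intro SUP_least)
  then show ?thesis
    unfolding partition_sup_def[of M \<phi> A] partition_sup_def[of M \<phi> B]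
    by (simp only: ennreal_SUP_add_left[OF ne[OF AB(1)], symmetric] ennreal_SUP_add_right[OF ne[OF AB(2)]])
qed

lemma partition_sup_mono:
  assumes "A \<in> sets M" "B \<in> sets M" "A \<subseteq> B"
  shows "partition_sup M \<phi> A \<le> partition_sup M \<phi> B"
proof -
  have "partition_sup M \<phi> A + 0 \<le> partition_sup M \<phi> A + partition_sup M \<phi> (B - A)"
    by (intro add_left_mono) simp
  also have "\<dots> \<le> partition_sup M \<phi> (A \<union> (B - A))" using assms by (intro partition_sup_Un) auto
  also have "A \<union> (B - A) = B" using assms by auto
  finally show ?thesis by simp
qed

lemma partition_sup_empty: "partition_sup M \<phi> {} = 0"
proof -
  have "(\<Sum>i. \<phi> (P i)) = 0" if "P \<in> countable_partitions M {}" for P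
    using that zero by (simp add: countable_partitions_def)
  then have "partition_sup M \<phi> {} \<le> 0"
    unfolding partition_sup_def by (intro SUP_least) simp
  then show ?thesis by simp
qed

text \<open>Gluing partitions of the pieces gives superadditivity. Conversely, a partition of the
  union is cut along the pieces: \<open>subadd\<close> bounds each \<open>\<phi> (P j)\<close> by
  the cut parts, and exchanging the two series regroups these into partitions of each
  \<open>A i\<close>.\<close>

lemma partition_sup_countably_additive: "countably_additive (sets M) (partition_sup M \<phi>)"
  unfolding countably_additive_def
proof (intro allI impI antisym)
  fix A :: "nat \<Rightarrow> 'a set"
  assume A: "range A \<subseteq> sets M" "disjoint_family A" "(\<Union>i. A i) \<in> sets M"
  show "(\<Sum>i. partition_sup M \<phi> (A i)) \<le> partition_sup M \<phi> (\<Union>i. A i)"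
  proof (rule suminf_le_const)
    fix n
    have "(\<Sum>i<n. partition_sup M \<phi> (A i)) \<le> partition_sup M \<phi> (\<Union>i<n. A i)"
    proof (induction n)
      case 0 then show ?case by simp
    next
      case (Suc n)
      have "(\<Sum>i<Suc n. partition_sup M \<phi> (A i)) \<le> partition_sup M \<phi> (\<Union>i<n. A i) + partition_sup M \<phi> (A n)"
        using Suc by (simp add: add_right_mono)
      also have "\<dots> \<le> partition_sup M \<phi> ((\<Union>i<n. A i) \<union> A n)"
      proof (rule partition_sup_Un)
        have "A i \<inter> A n = {}" if "i < n" for i
          using disjoint_family_onD[OF A(2), of i n] that by simp
        then show "(\<Union>i<n. A i) \<inter> A n = {}" by blast
      qed (use A in auto)
      also have "(\<Union>i<n. A i) \<union> A n = (\<Union>i<Suc n. A i)" by (auto simp: less_Suc_eq)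
      finally show ?case .
    qed
    also have "\<dots> \<le> partition_sup M \<phi> (\<Union>i. A i)"
      using A by (intro partition_sup_mono) auto
    finally show "(\<Sum>i<n. partition_sup M \<phi> (A i)) \<le> partition_sup M \<phi> (\<Union>i. A i)" .
  qed simp
  show "partition_sup M \<phi> (\<Union>i. A i) \<le> (\<Sum>i. partition_sup M \<phi> (A i))"
    unfolding partition_sup_def[of M \<phi> "\<Union>i. A i"]
  proof (rule SUP_least)
    fix P assume P: "P \<in> countable_partitions M (\<Union>i. A i)"
    have "\<phi> (P j) \<le> (\<Sum>i. \<phi> (P j \<inter> A i))" for j
    proof -
      have "P j = (\<Union>i. P j \<inter> A i)" using P by (auto simp: countable_partitions_def)
      moreover have "\<phi> (\<Union>i. P j \<inter> A i) \<le> (\<Sum>i. \<phi> (P j \<inter> A i))"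
        using P A by (intro subadd) (auto simp: countable_partitions_def disjoint_family_on_def)
      ultimately show ?thesis by simp
    qed
    then have "(\<Sum>j. \<phi> (P j)) \<le> (\<Sum>j. \<Sum>i. \<phi> (P j \<inter> A i))" by (intro suminf_le) auto
    also have "\<dots> = (\<Sum>i. \<Sum>j. \<phi> (P j \<inter> A i))" by (rule suminf_ennreal_swap)
    also have "\<dots> \<le> (\<Sum>i. partition_sup M \<phi> (A i))"
    proof (intro suminf_le)
      fix i
      have "(\<lambda>j. P j \<inter> A i) \<in> countable_partitions M (A i)"
        using P A by (auto simp: countable_partitions_def disjoint_family_on_def) blast
      then show "(\<Sum>j. \<phi> (P j \<inter> A i)) \<le> partition_sup M \<phi> (A i)"
        unfolding partition_sup_def by (rule SUP_upper2) simp
    qed auto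
    finally show "(\<Sum>j. \<phi> (P j)) \<le> (\<Sum>i. partition_sup M \<phi> (A i))" .
  qed
qed

lemma emeasure_partition_sup:
  assumes "A \<in> sets M"
  shows "emeasure (measure_of (space M) (sets M) (partition_sup M \<phi>)) A = partition_sup M \<phi> A"
  by (rule emeasure_measure_of_sigma)
     (use assms partition_sup_countably_additive partition_sup_empty sets.sigma_algebra_axioms
       in \<open>auto simp: positive_def\<close>)

end

section \<open>Countably additive set functions, real or vector valued\<close>

definition signed_additive :: "'a measure \<Rightarrow> ('a set \<Rightarrow> 'b::real_normed_vector) \<Rightarrow> bool" where
  "signed_additive M \<rho> \<longleftrightarrow> (\<forall>A::nat \<Rightarrow> 'a set. range A \<subseteq> sets M \<longrightarrow> disjoint_family A \<longrightarrow>
     (\<lambda>i. \<rho> (A i)) sums \<rho> (\<Union>i. A i))"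

lemma signed_additive_sums:
  "signed_additive M \<rho> \<Longrightarrow> range A \<subseteq> sets M \<Longrightarrow> disjoint_family A \<Longrightarrow> (\<lambda>i::nat. \<rho> (A i)) sums \<rho> (\<Union>i. A i)"
  by (simp add: signed_additive_def)

text \<open>The constant sequence of empty sets is disjoint, so the series with all terms
  \<open>\<rho> {}\<close> converges and its terms tend to 0.\<close>

lemma signed_additive_empty:
  assumes "signed_additive M \<rho>" shows "\<rho> {} = 0"
proof -
  have "(\<lambda>i::nat. \<rho> {}) sums \<rho> {}"
    using signed_additive_sums[OF assms, of "\<lambda>_. {}"] by (simp add: disjoint_family_on_def)
  then have "(\<lambda>i::nat. \<rho> {}) \<longlonglongrightarrow> 0" by (metis summable_LIMSEQ_zero sums_summable)
  then show ?thesis by (simp add: LIMSEQ_const_iff)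
qed

lemma signed_additive_Un:
  assumes \<rho>: "signed_additive M \<rho>" and AB: "A \<in> sets M" "B \<in> sets M" "A \<inter> B = {}"
  shows "\<rho> (A \<union> B) = \<rho> A + \<rho> B"
proof -
  have "(\<lambda>i. \<rho> (binaryset A B i)) sums \<rho> (A \<union> B)"
    using signed_additive_sums[OF \<rho>, of "binaryset A B"] binaryset_partition[OF AB]
    by (simp add: countable_partitions_def)
  moreover have "(\<lambda>i. \<rho> (binaryset A B i)) sums (\<rho> A + \<rho> B)"
    by (rule binaryset_sums) (rule signed_additive_empty[OF \<rho>])
  ultimately show ?thesis by (rule sums_unique2)
qed

lemma signed_additive_Diff:
  assumes "signed_additive M \<rho>" "A \<in> sets M" "B \<in> sets M" "B \<subseteq> A"
  shows "\<rho> (A - B) = \<rho> A - \<rho> B"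
proof -
  have "B \<union> (A - B) = A" using assms(4) by auto
  then show ?thesis using signed_additive_Un[OF assms(1,3), of "A - B"] assms(2,3) by auto
qed

lemma signed_additive_uminus: "signed_additive M \<rho> \<Longrightarrow> signed_additive M (\<lambda>A. - \<rho> A)"
  by (simp add: signed_additive_def sums_minus)

lemma norm_signed_additive_subadditive:
  assumes \<rho>: "signed_additive M \<rho>" and A: "range A \<subseteq> sets M" "disjoint_family A"
  shows "ennreal (norm (\<rho> (\<Union>i::nat. A i))) \<le> (\<Sum>i. ennreal (norm (\<rho> (A i))))"
proof (rule LIMSEQ_le_const2)
  show "(\<lambda>n. ennreal (norm (\<Sum>i<n. \<rho> (A i)))) \<longlonglongrightarrow> ennreal (norm (\<rho> (\<Union>i. A i)))"
    using signed_additive_sums[OF assms] by (intro tendsto_intros) (simp add: sums_def)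
  have "ennreal (norm (\<Sum>i<n. \<rho> (A i))) \<le> (\<Sum>i. ennreal (norm (\<rho> (A i))))" for n
  proof -
    have "ennreal (norm (\<Sum>i<n. \<rho> (A i))) \<le> ennreal (\<Sum>i<n. norm (\<rho> (A i)))"
      by (intro ennreal_leI norm_sum)
    also have "\<dots> = (\<Sum>i<n. ennreal (norm (\<rho> (A i))))" by simp
    also have "\<dots> \<le> (\<Sum>i. ennreal (norm (\<rho> (A i))))" by (rule sum_le_suminf) auto
    finally show ?thesis .
  qed
  then show "\<exists>N. \<forall>n\<ge>N. ennreal (norm (\<Sum>i<n. \<rho> (A i))) \<le> (\<Sum>i. ennreal (norm (\<rho> (A i))))" by blast
qed

text \<open>\<open>ennreal\<close> sends negative reals to 0, so this is countable subadditivity of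
  the positive part of \<open>\<rho>\<close>.\<close>

lemma ennreal_signed_additive_subadditive:
  fixes \<rho> :: "'a set \<Rightarrow> real"
  assumes \<rho>: "signed_additive M \<rho>" and A: "range A \<subseteq> sets M" "disjoint_family A"
  shows "ennreal (\<rho> (\<Union>i::nat. A i)) \<le> (\<Sum>i. ennreal (\<rho> (A i)))"
proof (rule LIMSEQ_le_const2)
  show "(\<lambda>n. ennreal (\<Sum>i<n. \<rho> (A i))) \<longlonglongrightarrow> ennreal (\<rho> (\<Union>i. A i))"
    using signed_additive_sums[OF assms] by (intro tendsto_intros) (simp add: sums_def)
  have "ennreal (\<Sum>i<n. \<rho> (A i)) \<le> (\<Sum>i. ennreal (\<rho> (A i)))" for n
  proof -
    have "ennreal (\<Sum>i<n. \<rho> (A i)) \<le> ennreal (\<Sum>i<n. max 0 (\<rho> (A i)))"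
      by (intro ennreal_leI sum_mono) simp
    also have "\<dots> = (\<Sum>i<n. ennreal (max 0 (\<rho> (A i))))" by (rule sum_ennreal[symmetric]) simp
    also have "\<dots> = (\<Sum>i<n. ennreal (\<rho> (A i)))"
      by (intro sum.cong refl) (simp add: max_def ennreal_neg)
    also have "\<dots> \<le> (\<Sum>i. ennreal (\<rho> (A i)))" by (rule sum_le_suminf) auto
    finally show ?thesis .
  qed
  then show "\<exists>N. \<forall>n\<ge>N. ennreal (\<Sum>i<n. \<rho> (A i)) \<le> (\<Sum>i. ennreal (\<rho> (A i)))" by blast
qed

text \<open>In a partition the sets of negative measure contribute nothing; the remaining ones unite
  to a single subset whose measure is the whole sum. Thus the supremum over subsets inherits
  countable additivity without recourse to a Hahn decomposition.\<close>

lemma sup_subsets_eq_partition_sup: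
  fixes \<rho> :: "'a set \<Rightarrow> real"
  assumes \<rho>: "signed_additive M \<rho>" and A: "A \<in> sets M"
  shows "(SUP B\<in>{B\<in>sets M. B \<subseteq> A}. ennreal (\<rho> B)) = partition_sup M (\<lambda>A. ennreal (\<rho> A)) A"
proof (rule antisym)
  have 0: "ennreal (\<rho> {}) = 0" using signed_additive_empty[OF \<rho>] by simp
  note sub = ennreal_signed_additive_subadditive[OF \<rho>]
  show "(SUP B\<in>{B\<in>sets M. B \<subseteq> A}. ennreal (\<rho> B)) \<le> partition_sup M (\<lambda>A. ennreal (\<rho> A)) A"
  proof (rule SUP_least)
    fix B assume B: "B \<in> {B\<in>sets M. B \<subseteq> A}"
    have "ennreal (\<rho> B) \<le> partition_sup M (\<lambda>A. ennreal (\<rho> A)) B"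
      using B by (intro partition_sup_upper[where \<phi> = "\<lambda>A. ennreal (\<rho> A)"] 0 sub) auto
    also have "\<dots> \<le> partition_sup M (\<lambda>A. ennreal (\<rho> A)) A"
      using B A by (intro partition_sup_mono[where \<phi> = "\<lambda>A. ennreal (\<rho> A)"] 0 sub) auto
    finally show "ennreal (\<rho> B) \<le> partition_sup M (\<lambda>A. ennreal (\<rho> A)) A" .
  qed
  show "partition_sup M (\<lambda>A. ennreal (\<rho> A)) A \<le> (SUP B\<in>{B\<in>sets M. B \<subseteq> A}. ennreal (\<rho> B))"
    unfolding partition_sup_def
  proof (rule SUP_least)
    fix P assume P: "P \<in> countable_partitions M A"
    define Q where "Q i = (if \<rho> (P i) > 0 then P i else {})" for i
    have Q: "range Q \<subseteq> sets M" "disjoint_family Q" "(\<Union>i. Q i) \<subseteq> A"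
      using P by (auto simp: Q_def countable_partitions_def disjoint_family_on_def split: if_splits)
    have s: "(\<lambda>i. \<rho> (Q i)) sums \<rho> (\<Union>i. Q i)" using signed_additive_sums[OF \<rho> Q(1,2)] .
    have nn: "\<rho> (Q i) \<ge> 0" for i using signed_additive_empty[OF \<rho>] by (simp add: Q_def)
    have "ennreal (\<rho> (P i)) = ennreal (\<rho> (Q i))" for i
      using signed_additive_empty[OF \<rho>] by (simp add: Q_def ennreal_neg)
    then have "(\<Sum>i. ennreal (\<rho> (P i))) = ennreal (\<rho> (\<Union>i. Q i))"
      using suminf_ennreal2[OF nn sums_summable[OF s]] sums_unique[OF s] by simp
    also have "\<dots> \<le> (SUP B\<in>{B\<in>sets M. B \<subseteq> A}. ennreal (\<rho> B))"
      using Q by (intro SUP_upper) auto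
    finally show "(\<Sum>i. ennreal (\<rho> (P i))) \<le> (SUP B\<in>{B\<in>sets M. B \<subseteq> A}. ennreal (\<rho> B))" .
  qed
qed

section \<open>Jordan decomposition into finite measures\<close>

lemma sets_sm_pos [simp]: "sets (sm_pos M \<rho>) = sets M" "space (sm_pos M \<rho>) = space M"
  by (simp_all add: sm_pos_def)

lemma sets_sm_neg [simp]: "sets (sm_neg M \<rho>) = sets M" "space (sm_neg M \<rho>) = space M"
  by (simp_all add: sm_neg_def)

text \<open>\<open>measure_of\<close> gives the zero measure unless its set function is a measure,
  so the defining formula holds only after countable additivity has been established.\<close>

lemma emeasure_sm_pos:
  fixes \<rho> :: "'a set \<Rightarrow> real"
  assumes \<rho>: "signed_additive M \<rho>" and A: "A \<in> sets M"
  shows "emeasure (sm_pos M \<rho>) A = (SUP B\<in>{B\<in>sets M. B \<subseteq> A}. ennreal (\<rho> B))"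
proof -
  have "sm_pos M \<rho> = measure_of (space M) (sets M) (partition_sup M (\<lambda>A. ennreal (\<rho> A)))"
    unfolding sm_pos_def
    by (rule measure_of_eq) (auto simp: sets.space_closed sets.sigma_sets_eq sup_subsets_eq_partition_sup[OF \<rho>])
  then have "emeasure (sm_pos M \<rho>) A = partition_sup M (\<lambda>A. ennreal (\<rho> A)) A"
    using emeasure_partition_sup[where \<phi> = "\<lambda>A. ennreal (\<rho> A)"] A
      signed_additive_empty[OF \<rho>] ennreal_signed_additive_subadditive[OF \<rho>] by simp
  then show ?thesis using sup_subsets_eq_partition_sup[OF \<rho> A] by simp
qed

text \<open>If the range were unbounded, one could split off disjoint sets of measure at least 1 forever.\<close>
lemma signed_additive_bounded:
  fixes \<rho> :: "'a set \<Rightarrow> 'b::real_normed_vector"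
  assumes \<rho>: "signed_additive M \<rho>"
  obtains C where "\<And>B. B \<in> sets M \<Longrightarrow> norm (\<rho> B) \<le> C"
proof (rule ccontr)
  assume no: "\<not> thesis"
  define unb where "unb E \<longleftrightarrow> (\<forall>C. \<exists>B\<in>sets M. B \<subseteq> E \<and> norm (\<rho> B) > C)" for E
  have "unb (space M)"
    unfolding unb_def using no that sets.sets_into_space by (metis linorder_not_less)
  have step: "\<exists>E'. (E' \<in> sets M \<and> unb E') \<and> E' \<subseteq> E \<and> norm (\<rho> (E - E')) > 1"
    if E: "E \<in> sets M \<and> unb E" for E
  proof -
    \<comment> \<open>The margin \<open>norm (\<rho> E) + 1\<close> makes both \<open>B\<close> and
      \<open>E - B\<close> exceed 1 in norm. Whichever half keeps an unbounded range, the discarded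
      one is large enough.\<close>
    obtain B where B: "B \<in> sets M" "B \<subseteq> E" "norm (\<rho> B) > norm (\<rho> E) + 1"
      using E unfolding unb_def by blast
    have d: "\<rho> (E - B) = \<rho> E - \<rho> B" using signed_additive_Diff[OF \<rho>] E B by blast
    have "norm (\<rho> B) \<le> norm (\<rho> (E - B)) + norm (\<rho> E)"
      unfolding d using norm_triangle_ineq4[of "\<rho> E" "\<rho> E - \<rho> B"] by simp
    then have big: "norm (\<rho> (E - B)) > 1" using B by linarith
    have "unb B \<or> unb (E - B)"
    proof (rule ccontr)
      assume "\<not> ?thesis"
      then obtain C1 C2 where C: "\<forall>B'\<in>sets M. B' \<subseteq> B \<longrightarrow> norm (\<rho> B') \<le> C1"
        "\<forall>B'\<in>sets M. B' \<subseteq> E - B \<longrightarrow> norm (\<rho> B') \<le> C2"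
        unfolding unb_def by (metis linorder_not_less)
      obtain B' where B': "B' \<in> sets M" "B' \<subseteq> E" "norm (\<rho> B') > C1 + C2"
        using E unfolding unb_def by blast
      have "\<rho> B' = \<rho> (B' \<inter> B \<union> (B' - B))" by (rule arg_cong[of _ _ \<rho>]) auto
      also have "\<dots> = \<rho> (B' \<inter> B) + \<rho> (B' - B)"
        using B B' by (intro signed_additive_Un[OF \<rho>]) auto
      finally have "norm (\<rho> B') \<le> norm (\<rho> (B' \<inter> B)) + norm (\<rho> (B' - B))"
        by (metis norm_triangle_ineq)
      moreover have "norm (\<rho> (B' \<inter> B)) \<le> C1"
        by (rule bspec[OF C(1), THEN mp]) (use B B' in auto)
      moreover have "norm (\<rho> (B' - B)) \<le> C2"
        by (rule bspec[OF C(2), THEN mp]) (use B B' in auto)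
      ultimately show False using B' by linarith
    qed
    then show ?thesis
    proof
      assume "unb B"
      then show ?thesis using B E big by (intro exI[of _ B]) auto
    next
      assume u: "unb (E - B)"
      have "E - (E - B) = B" using B by auto
      moreover have "norm (\<rho> B) > 1" using B(3) norm_ge_zero[of "\<rho> E"] by linarith
      ultimately show ?thesis using u B E by (intro exI[of _ "E - B"]) auto
    qed
  qed
  obtain E :: "nat \<Rightarrow> 'a set" where E: "\<And>n. E n \<in> sets M \<and> unb (E n)"
    "\<And>n. E (Suc n) \<subseteq> E n \<and> norm (\<rho> (E n - E (Suc n))) > 1"
    using dependent_nat_choice[where P = "\<lambda>_ E. E \<in> sets M \<and> unb E"
        and Q = "\<lambda>_ E E'. E' \<subseteq> E \<and> norm (\<rho> (E - E')) > 1"] step \<open>unb (space M)\<close>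
    by blast
  have dec: "decseq E" using E(2) by (simp add: decseq_Suc_iff)
  have "disjoint_family (\<lambda>n. E n - E (Suc n))"
  proof (unfold disjoint_family_on_def, intro ballI impI)
    have *: "(E m - E (Suc m)) \<inter> (E n - E (Suc n)) = {}" if "m < n" for m n
      using decseqD[OF dec, of "Suc m" n] that by auto
    fix m n :: nat assume "m \<noteq> n"
    then show "(E m - E (Suc m)) \<inter> (E n - E (Suc n)) = {}"
      using *[of m n] *[of n m] by (cases "m < n") auto
  qed
  then have "(\<lambda>n. \<rho> (E n - E (Suc n))) sums \<rho> (\<Union>n. E n - E (Suc n))"
    using E by (intro signed_additive_sums[OF \<rho>]) auto
  then have "(\<lambda>n. \<rho> (E n - E (Suc n))) \<longlonglongrightarrow> 0" by (metis summable_LIMSEQ_zero sums_summable)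
  then obtain n where "norm (\<rho> (E n - E (Suc n)) - 0) < 1"
    using LIMSEQ_D[of "\<lambda>n. \<rho> (E n - E (Suc n))" 0 1] by auto
  then show False using E(2)[of n] by simp
qed

lemma finite_measure_sm_pos:
  assumes \<rho>: "signed_additive M \<rho>"
  shows "finite_measure (sm_pos M \<rho>)"
proof
  obtain C where C: "\<And>B. B \<in> sets M \<Longrightarrow> norm (\<rho> B) \<le> C" using signed_additive_bounded[OF \<rho>] by blast
  have "emeasure (sm_pos M \<rho>) (space M) \<le> ennreal C"
    unfolding emeasure_sm_pos[OF \<rho> sets.top]
    by (intro SUP_least ennreal_leI) (use C in force)
  then show "emeasure (sm_pos M \<rho>) (space (sm_pos M \<rho>)) \<noteq> \<infinity>"
    by (metis ennreal_less_top infinity_ennreal_def leD sets_sm_pos(2))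
qed

lemma finite_measure_sm_neg: "signed_additive M \<rho> \<Longrightarrow> finite_measure (sm_neg M \<rho>)"
  unfolding sm_neg_def by (intro finite_measure_sm_pos signed_additive_uminus)

lemma jordan_decomposition:
  assumes \<rho>: "signed_additive M \<rho>" and A: "A \<in> sets M"
  shows "\<rho> A = measure (sm_pos M \<rho>) A - measure (sm_neg M \<rho>) A"
proof -
  have up: "\<sigma> B \<le> measure (sm_pos M \<sigma>) A" if "signed_additive M \<sigma>" "B \<in> sets M" "B \<subseteq> A" for \<sigma> B
  proof -
    interpret finite_measure "sm_pos M \<sigma>" using finite_measure_sm_pos that by blast
    have "ennreal (\<sigma> B) \<le> emeasure (sm_pos M \<sigma>) A"
      unfolding emeasure_sm_pos[OF that(1) A] using that by (intro SUP_upper) auto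
    then show ?thesis by (simp add: emeasure_eq_measure ennreal_le_iff)
  qed
  have le: "measure (sm_pos M \<sigma>) A \<le> \<sigma> A + measure (sm_pos M (\<lambda>A. - \<sigma> A)) A" if \<sigma>: "signed_additive M \<sigma>" for \<sigma>
  proof -
    interpret finite_measure "sm_pos M \<sigma>" using finite_measure_sm_pos[OF \<sigma>] .
    \<comment> \<open>Write \<open>\<sigma> B\<close> as
      \<open>\<sigma> A - \<sigma> (A - B)\<close> and bound the second term by the positive part of
      \<open>- \<sigma>\<close>. Used for \<open>\<rho>\<close> and for \<open>- \<rho>\<close>, the
      resulting estimate gives both halves of the identity.\<close>
    have B: "\<sigma> B \<le> \<sigma> A + measure (sm_pos M (\<lambda>A. - \<sigma> A)) A" if "B \<in> sets M" "B \<subseteq> A" for B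
      using up[OF signed_additive_uminus[OF \<sigma>], of "A - B"] signed_additive_Diff[OF \<sigma> A that] A that by simp
    have "emeasure (sm_pos M \<sigma>) A \<le> ennreal (\<sigma> A + measure (sm_pos M (\<lambda>A. - \<sigma> A)) A)"
      unfolding emeasure_sm_pos[OF \<sigma> A] by (intro SUP_least ennreal_leI) (use B in auto)
    moreover have "0 \<le> \<sigma> A + measure (sm_pos M (\<lambda>A. - \<sigma> A)) A"
      using B[of "{}"] signed_additive_empty[OF \<sigma>] by simp
    ultimately show ?thesis by (simp add: emeasure_eq_measure)
  qed
  show ?thesis using le[OF \<rho>] le[OF signed_additive_uminus[OF \<rho>]] by (simp add: sm_neg_def)
qed

section \<open>Complex measures and their total variation\<close>

lemma complex_measure_additive: "complex_measure M \<xi> \<Longrightarrow> signed_additive M \<xi>"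
  by (simp add: complex_measure_def signed_additive_def)

lemma complex_measure_Re: "complex_measure M \<xi> \<Longrightarrow> signed_additive M (\<lambda>A. Re (\<xi> A))"
  by (simp add: complex_measure_def signed_additive_def sums_Re)

lemma complex_measure_Im: "complex_measure M \<xi> \<Longrightarrow> signed_additive M (\<lambda>A. Im (\<xi> A))"
  by (simp add: complex_measure_def signed_additive_def sums_Im)

lemma sets_cm_variation [simp]: "sets (cm_variation M \<xi>) = sets M" "space (cm_variation M \<xi>) = space M"
  by (simp_all add: cm_variation_def)

lemma cm_variation_eq:
  "cm_variation M \<xi> = measure_of (space M) (sets M) (partition_sup M (\<lambda>A. ennreal (cmod (\<xi> A))))"
  by (simp add: cm_variation_def partition_sup_def[abs_def] countable_partitions_def)

lemma emeasure_cm_variation: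
  assumes \<xi>: "complex_measure M \<xi>" and A: "A \<in> sets M"
  shows "emeasure (cm_variation M \<xi>) A = partition_sup M (\<lambda>A. ennreal (cmod (\<xi> A))) A"
  unfolding cm_variation_eq
  using signed_additive_empty[OF complex_measure_additive[OF \<xi>]]
    norm_signed_additive_subadditive[OF complex_measure_additive[OF \<xi>]]
  by (intro emeasure_partition_sup A) auto

lemma cmod_le_cm_variation:
  assumes \<xi>: "complex_measure M \<xi>" and A: "A \<in> sets M"
  shows "ennreal (cmod (\<xi> A)) \<le> emeasure (cm_variation M \<xi>) A"
  unfolding emeasure_cm_variation[OF assms]
  using signed_additive_empty[OF complex_measure_additive[OF \<xi>]]
    norm_signed_additive_subadditive[OF complex_measure_additive[OF \<xi>]]
  by (intro partition_sup_upper[where \<phi> = "\<lambda>A. ennreal (cmod (\<xi> A))"] A) auto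

lemma cm_variation_least:
  assumes \<xi>: "complex_measure M \<xi>" and A: "A \<in> sets M" and N: "sets N = sets M"
    and le: "\<And>A. A \<in> sets M \<Longrightarrow> ennreal (cmod (\<xi> A)) \<le> emeasure N A"
  shows "emeasure (cm_variation M \<xi>) A \<le> emeasure N A"
  unfolding emeasure_cm_variation[OF \<xi> A] partition_sup_def
proof (rule SUP_least)
  fix P assume P: "P \<in> countable_partitions M A"
  have "(\<Sum>i. ennreal (cmod (\<xi> (P i)))) \<le> (\<Sum>i. emeasure N (P i))"
    using P by (intro suminf_le le) (auto simp: countable_partitions_def)
  also have "\<dots> = emeasure N A"
    using P N by (simp add: countable_partitions_def suminf_emeasure)
  finally show "(\<Sum>i. ennreal (cmod (\<xi> (P i)))) \<le> emeasure N A" .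
qed

text \<open>Supplies a common dominating measure, first for the four Jordan parts of one complex
  measure and later for the variations of two.\<close>

definition sum_measure :: "'a measure \<Rightarrow> 'a measure \<Rightarrow> 'a measure" where
  "sum_measure P Q = measure_of (space P) (sets P) (\<lambda>A. emeasure P A + emeasure Q A)"

lemma sets_sum_measure [simp]: "sets (sum_measure P Q) = sets P" "space (sum_measure P Q) = space P"
  by (simp_all add: sum_measure_def)

lemma emeasure_sum_measure:
  assumes "sets Q = sets P" "A \<in> sets P"
  shows "emeasure (sum_measure P Q) A = emeasure P A + emeasure Q A"
  unfolding sum_measure_def
proof (rule emeasure_measure_of_sigma)
  show "countably_additive (sets P) (\<lambda>A. emeasure P A + emeasure Q A)"
    unfolding countably_additive_def
    by (auto simp: suminf_add[symmetric] suminf_emeasure assms)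
qed (use assms sets.sigma_algebra_axioms in \<open>auto simp: positive_def\<close>)

lemma finite_sum_measure:
  assumes "finite_measure P" "finite_measure Q" "sets Q = sets P"
  shows "finite_measure (sum_measure P Q)"
proof
  have "space Q = space P" using assms(3) by (rule sets_eq_imp_space_eq)
  then show "emeasure (sum_measure P Q) (space (sum_measure P Q)) \<noteq> \<infinity>"
    using finite_measure.emeasure_finite[OF assms(1)] finite_measure.emeasure_finite[OF assms(2)]
    by (simp add: emeasure_sum_measure assms(3))
qed

text \<open>The modulus of \<open>\<xi> A\<close> is at most the sum of the four Jordan parts of
  \<open>\<xi>\<close> at \<open>A\<close>; this sum is a finite measure, and the variation is the
  least measure dominating the modulus.\<close>

lemma finite_measure_cm_variation:
  assumes \<xi>: "complex_measure M \<xi>"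
  shows "finite_measure (cm_variation M \<xi>)"
proof
  let ?r = "\<lambda>A. Re (\<xi> A)" and ?i = "\<lambda>A. Im (\<xi> A)"
  note r = complex_measure_Re[OF \<xi>] and i = complex_measure_Im[OF \<xi>]
  define N where "N = sum_measure (sum_measure (sm_pos M ?r) (sm_neg M ?r)) (sum_measure (sm_pos M ?i) (sm_neg M ?i))"
  have sets: "sets N = sets M" by (simp add: N_def)
  interpret N: finite_measure N
    unfolding N_def by (intro finite_sum_measure finite_measure_sm_pos finite_measure_sm_neg r i) auto
  have "ennreal (cmod (\<xi> A)) \<le> emeasure N A" if A: "A \<in> sets M" for A
  proof -
    interpret rp: finite_measure "sm_pos M ?r" by (rule finite_measure_sm_pos[OF r])
    interpret rn: finite_measure "sm_neg M ?r" by (rule finite_measure_sm_neg[OF r])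
    interpret ip: finite_measure "sm_pos M ?i" by (rule finite_measure_sm_pos[OF i])
    interpret im: finite_measure "sm_neg M ?i" by (rule finite_measure_sm_neg[OF i])
    have "cmod (\<xi> A) \<le> \<bar>Re (\<xi> A)\<bar> + \<bar>Im (\<xi> A)\<bar>" by (rule cmod_le)
    also have "\<dots> \<le> measure (sm_pos M ?r) A + measure (sm_neg M ?r) A + (measure (sm_pos M ?i) A + measure (sm_neg M ?i) A)"
      unfolding jordan_decomposition[OF r A] jordan_decomposition[OF i A]
      by (intro add_mono order_trans[OF abs_triangle_ineq4]) auto
    finally have "ennreal (cmod (\<xi> A)) \<le> ennreal (measure (sm_pos M ?r) A + measure (sm_neg M ?r) A + (measure (sm_pos M ?i) A + measure (sm_neg M ?i) A))"
      by (rule ennreal_leI)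
    then show ?thesis using A
      by (simp add: N_def emeasure_sum_measure rp.emeasure_eq_measure rn.emeasure_eq_measure
          ip.emeasure_eq_measure im.emeasure_eq_measure)
  qed
  then have "emeasure (cm_variation M \<xi>) (space M) \<le> emeasure N (space M)"
    by (intro cm_variation_least \<xi> sets) auto
  then show "emeasure (cm_variation M \<xi>) (space (cm_variation M \<xi>)) \<noteq> \<infinity>"
    using N.emeasure_finite[of "space M"] by (auto simp: top_unique)
qed

section \<open>Densities and integrals with respect to complex measures\<close>

text \<open>The reference measure \<open>w\<close> is left free so that several set functions can
  share it. Their Jordan integrals then become Bochner integrals against the same \<open>w\<close>,
  where linearity is immediate.\<close>

definition has_density :: "'a measure \<Rightarrow> ('a set \<Rightarrow> 'b::{banach,second_countable_topology}) \<Rightarrow> 'a measure \<Rightarrow> ('a \<Rightarrow> 'b) \<Rightarrow> bool" where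
  "has_density M \<rho> w h \<longleftrightarrow> sets w = sets M \<and> integrable w h \<and>
     (\<forall>A\<in>sets M. \<rho> A = (\<integral>x. indicator A x *\<^sub>R h x \<partial>w))"

lemma has_densityD:
  assumes "has_density M \<rho> w h"
  shows "sets w = sets M" "space w = space M" "integrable w h" "h \<in> borel_measurable w" "h \<in> borel_measurable M"
    "\<And>A. A \<in> sets M \<Longrightarrow> \<rho> A = (\<integral>x. indicator A x *\<^sub>R h x \<partial>w)"
proof -
  show 1: "sets w = sets M" and 2: "integrable w h" and "\<And>A. A \<in> sets M \<Longrightarrow> \<rho> A = (\<integral>x. indicator A x *\<^sub>R h x \<partial>w)"
    using assms by (auto simp: has_density_def)
  show "space w = space M" using 1 by (rule sets_eq_imp_space_eq)
  show "h \<in> borel_measurable w" using 2 by simp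
  then show "h \<in> borel_measurable M" using measurable_cong_sets[OF 1 refl] by blast
qed

lemma has_density_additive:
  assumes d: "has_density M \<rho> w h"
  shows "signed_additive M \<rho>"
  unfolding signed_additive_def
proof (intro allI impI)
  fix A :: "nat \<Rightarrow> 'a set" assume A: "range A \<subseteq> sets M" "disjoint_family A"
  note D = has_densityD[OF d]
  have Aw: "A i \<in> sets w" for i using A D by auto
  have [measurable]: "h \<in> borel_measurable w" by (rule D(4))
  have int: "integrable w (\<lambda>x. indicator (A i) x *\<^sub>R h x)" for i
    using Aw D(3) by (rule integrable_mult_indicator)
  have sum: "(\<Sum>i<n. \<rho> (A i)) = (\<integral>x. indicator (\<Union>i<n. A i) x *\<^sub>R h x \<partial>w)" for n
  proof -
    have "(\<Sum>i<n. \<rho> (A i)) = (\<Sum>i<n. \<integral>x. indicator (A i) x *\<^sub>R h x \<partial>w)"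
      using A D(6) by (intro sum.cong) auto
    also have "\<dots> = (\<integral>x. (\<Sum>i<n. indicator (A i) x *\<^sub>R h x) \<partial>w)"
      by (rule Bochner_Integration.integral_sum[symmetric]) (rule int)
    also have "\<dots> = (\<integral>x. indicator (\<Union>i<n. A i) x *\<^sub>R h x \<partial>w)"
    proof (intro Bochner_Integration.integral_cong refl)
      fix x
      have "disjoint_family_on A {..<n}" using A(2) by (auto simp: disjoint_family_on_def)
      then have "(indicator (\<Union>i<n. A i) x :: real) = (\<Sum>i<n. indicator (A i) x)"
        by (intro indicator_UN_disjoint) auto
      then show "(\<Sum>i<n. indicator (A i) x *\<^sub>R h x) = indicator (\<Union>i<n. A i) x *\<^sub>R h x"
        by (simp add: scaleR_sum_left[symmetric])
    qed
    finally show ?thesis .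
  qed
  have "(\<lambda>n. \<integral>x. indicator (\<Union>i<n. A i) x *\<^sub>R h x \<partial>w) \<longlonglongrightarrow> (\<integral>x. indicator (\<Union>i. A i) x *\<^sub>R h x \<partial>w)"
  proof (rule integral_dominated_convergence[where w = "\<lambda>x. norm (h x)"])
    show "integrable w (\<lambda>x. norm (h x))" using D(3) by simp
    show "AE x in w. (\<lambda>n. indicator (\<Union>i<n. A i) x *\<^sub>R h x) \<longlonglongrightarrow> indicator (\<Union>i. A i) x *\<^sub>R h x"
      by (intro AE_I2 tendsto_intros LIMSEQ_indicator_UN)
    show "AE x in w. norm (indicator (\<Union>i<n. A i) x *\<^sub>R h x) \<le> norm (h x)" for n
      by (auto split: split_indicator)
  qed (use Aw in measurable)
  then show "(\<lambda>i. \<rho> (A i)) sums \<rho> (\<Union>i. A i)"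
    using A D(6)[of "\<Union>i. A i"] by (auto simp: sums_def sum)
qed

text \<open>The supremum defining \<open>sm_pos\<close> is attained at the part of \<open>A\<close>
  where \<open>h\<close> is positive; \<open>ennreal (h x)\<close> is already the positive part of
  the density.\<close>

lemma sm_pos_has_density:
  fixes h :: "'a \<Rightarrow> real"
  assumes d: "has_density M \<rho> w h"
  shows "sm_pos M \<rho> = density w (\<lambda>x. ennreal (h x))"
proof (rule measure_eqI)
  note D = has_densityD[OF d]
  have [measurable]: "h \<in> borel_measurable w" by (rule D(4))
  show "sets (sm_pos M \<rho>) = sets (density w (\<lambda>x. ennreal (h x)))" using D by simp
  fix A assume "A \<in> sets (sm_pos M \<rho>)"
  then have A: "A \<in> sets M" by simp
  then have [measurable]: "A \<in> sets w" using D by simp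
  have dens: "emeasure (density w (\<lambda>x. ennreal (h x))) B = (\<integral>\<^sup>+x. ennreal (indicator B x * max 0 (h x)) \<partial>w)" if "B \<in> sets w" for B
    unfolding emeasure_density[OF measurable_compose[OF D(4) measurable_ennreal] that]
    by (intro nn_integral_cong) (auto split: split_indicator simp: max_def ennreal_neg)
  have le: "ennreal (\<rho> B) \<le> emeasure (density w (\<lambda>x. ennreal (h x))) A" if B: "B \<in> sets M" "B \<subseteq> A" for B
  proof -
    have Bw[measurable]: "B \<in> sets w" using B D by simp
    have i1: "integrable w (\<lambda>x. indicator B x * h x)" and i2: "integrable w (\<lambda>x. indicator A x * max 0 (h x))"
      using integrable_mult_indicator[OF Bw D(3)] integrable_mult_indicator[OF \<open>A \<in> sets w\<close> integrable_max[OF integrable_zero D(3)]]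
      by auto
    have "\<rho> B \<le> (\<integral>x. indicator A x * max 0 (h x) \<partial>w)"
      unfolding D(6)[OF B(1)] using i1 i2 B(2)
      by (intro integral_mono) (auto split: split_indicator)
    then have "ennreal (\<rho> B) \<le> ennreal (\<integral>x. indicator A x * max 0 (h x) \<partial>w)" by (rule ennreal_leI)
    also have "\<dots> = (\<integral>\<^sup>+x. ennreal (indicator A x * max 0 (h x)) \<partial>w)"
      by (rule nn_integral_eq_integral[symmetric, OF i2]) auto
    finally show ?thesis using dens by simp
  qed
  define B where "B = A \<inter> {x\<in>space w. h x > 0}"
  have Bw[measurable]: "B \<in> sets w" unfolding B_def by measurable
  have B: "B \<in> sets M" "B \<subseteq> A" using Bw D by (auto simp: B_def)
  have i1: "integrable w (\<lambda>x. indicator B x * h x)" using integrable_mult_indicator[OF Bw D(3)] by simp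
  have "emeasure (density w (\<lambda>x. ennreal (h x))) A = (\<integral>\<^sup>+x. ennreal (indicator B x * h x) \<partial>w)"
    unfolding dens[OF \<open>A \<in> sets w\<close>] by (intro nn_integral_cong) (auto simp: B_def max_def split: split_indicator)
  also have "\<dots> = ennreal (\<integral>x. indicator B x * h x \<partial>w)"
    by (rule nn_integral_eq_integral[OF i1]) (auto simp: B_def split: split_indicator)
  also have "\<dots> = ennreal (\<rho> B)" using D(6)[OF B(1)] by simp
  finally have eq: "emeasure (density w (\<lambda>x. ennreal (h x))) A = ennreal (\<rho> B)" .
  show "emeasure (sm_pos M \<rho>) A = emeasure (density w (\<lambda>x. ennreal (h x))) A"
    unfolding emeasure_sm_pos[OF has_density_additive[OF d] A]
    by (intro antisym SUP_least SUP_upper2[of B]) (use le B eq in auto)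
qed

lemma has_density_uminus: "has_density M \<rho> w h \<Longrightarrow> has_density M (\<lambda>A. - \<rho> A) w (\<lambda>x. - h x)"
  by (auto simp: has_density_def)

lemma sm_neg_has_density:
  fixes h :: "'a \<Rightarrow> real"
  assumes "has_density M \<rho> w h"
  shows "sm_neg M \<rho> = density w (\<lambda>x. ennreal (- h x))"
  unfolding sm_neg_def by (rule sm_pos_has_density[OF has_density_uminus[OF assms]])

lemma sm_integral_has_density:
  fixes h :: "'a \<Rightarrow> real" and f :: "'a \<Rightarrow> complex"
  assumes d: "has_density M \<rho> w h" and f: "f \<in> borel_measurable M"
    and int: "integrable w (\<lambda>x. h x *\<^sub>R f x)"
  shows "sm_integral M \<rho> f = (\<integral>x. h x *\<^sub>R f x \<partial>w)"
proof -
  note D = has_densityD[OF d]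
  have [measurable]: "h \<in> borel_measurable w" by (rule D(4))
  have [measurable]: "f \<in> borel_measurable w" using f measurable_cong_sets[OF D(1) refl] by blast
  have part: "(\<integral>x. f x \<partial>density w (\<lambda>x. ennreal (g x))) = (\<integral>x. max 0 (g x) *\<^sub>R f x \<partial>w)"
    if [measurable]: "g \<in> borel_measurable w" for g :: "'a \<Rightarrow> real"
  proof -
    have "density w (\<lambda>x. ennreal (g x)) = density w (\<lambda>x. ennreal (max 0 (g x)))"
      by (intro density_cong) (auto simp: max_def ennreal_neg)
    then show ?thesis by (simp add: integral_density)
  qed
  \<comment> \<open>Both halves must be integrable before the difference of integrals may be merged,
    since a divergent Bochner integral would silently count as 0.\<close>
  have i: "integrable w (\<lambda>x. max 0 (h x) *\<^sub>R f x)" "integrable w (\<lambda>x. max 0 (- h x) *\<^sub>R f x)"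
    by (rule Bochner_Integration.integrable_bound[OF int];
        auto simp: max_def abs_mult mult_right_mono mult_nonpos_nonneg)+
  have "sm_integral M \<rho> f = (\<integral>x. max 0 (h x) *\<^sub>R f x \<partial>w) - (\<integral>x. max 0 (- h x) *\<^sub>R f x \<partial>w)"
    unfolding sm_integral_def sm_pos_has_density[OF d] sm_neg_has_density[OF d] by (simp add: part)
  also have "\<dots> = (\<integral>x. max 0 (h x) *\<^sub>R f x - max 0 (- h x) *\<^sub>R f x \<partial>w)"
    using i by simp
  also have "\<dots> = (\<integral>x. h x *\<^sub>R f x \<partial>w)"
    by (intro Bochner_Integration.integral_cong refl) (auto simp: max_def)
  finally show ?thesis .
qed

lemma has_density_Re:
  assumes "has_density M \<xi> w h" shows "has_density M (\<lambda>A. Re (\<xi> A)) w (\<lambda>x. Re (h x))"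
  unfolding has_density_def
proof (intro conjI ballI)
  note D = has_densityD[OF assms]
  show "sets w = sets M" "integrable w (\<lambda>x. Re (h x))" using D by auto
  fix A assume A: "A \<in> sets M"
  then have "integrable w (\<lambda>x. indicator A x *\<^sub>R h x)" using D by (intro integrable_mult_indicator) auto
  from integral_Re[OF this] show "Re (\<xi> A) = (\<integral>x. indicator A x *\<^sub>R Re (h x) \<partial>w)"
    using D(6)[OF A] by simp
qed

lemma has_density_Im:
  assumes "has_density M \<xi> w h" shows "has_density M (\<lambda>A. Im (\<xi> A)) w (\<lambda>x. Im (h x))"
  unfolding has_density_def
proof (intro conjI ballI)
  note D = has_densityD[OF assms]
  show "sets w = sets M" "integrable w (\<lambda>x. Im (h x))" using D by auto
  fix A assume A: "A \<in> sets M"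
  then have "integrable w (\<lambda>x. indicator A x *\<^sub>R h x)" using D by (intro integrable_mult_indicator) auto
  from integral_Im[OF this] show "Im (\<xi> A) = (\<integral>x. indicator A x *\<^sub>R Im (h x) \<partial>w)"
    using D(6)[OF A] by simp
qed

lemma cm_integral_has_density:
  fixes h f :: "'a \<Rightarrow> complex"
  assumes d: "has_density M \<xi> w h" and f: "f \<in> borel_measurable M"
    and int: "integrable w (\<lambda>x. h x * f x)"
  shows "cm_integral M \<xi> f = (\<integral>x. h x * f x \<partial>w)"
proof -
  note D = has_densityD[OF d]
  have [measurable]: "h \<in> borel_measurable w" by (rule D(4))
  have [measurable]: "f \<in> borel_measurable w" using f measurable_cong_sets[OF D(1) refl] by blast
  have i: "integrable w (\<lambda>x. Re (h x) *\<^sub>R f x)" "integrable w (\<lambda>x. Im (h x) *\<^sub>R f x)"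
    by (rule Bochner_Integration.integrable_bound[OF int];
        auto simp: norm_mult intro!: mult_right_mono abs_Re_le_cmod abs_Im_le_cmod)+
  have "cm_integral M \<xi> f = (\<integral>x. Re (h x) *\<^sub>R f x \<partial>w) + \<i> * (\<integral>x. Im (h x) *\<^sub>R f x \<partial>w)"
    unfolding cm_integral_def sm_integral_has_density[OF has_density_Re[OF d] f i(1)]
      sm_integral_has_density[OF has_density_Im[OF d] f i(2)] ..
  also have "\<dots> = (\<integral>x. Re (h x) *\<^sub>R f x + \<i> * (Im (h x) *\<^sub>R f x) \<partial>w)"
    using Bochner_Integration.integral_add[OF i(1) integrable_mult_right[OF i(2)], of \<i>]
    by (simp only: integral_mult_right_zero)
  also have "\<dots> = (\<integral>x. h x * f x \<partial>w)"
    by (intro Bochner_Integration.integral_cong refl) (auto simp: complex_eq_iff)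
  finally show ?thesis .
qed

text \<open>Setwise domination passes to integrals by induction over nonnegative measurable
  functions. Two weighted measures stand on the right so that the variation of a linear combination
  is covered; for one dominating measure, \<open>d\<close> is set to 0.\<close>

lemma nn_integral_dominated_measure:
  assumes sets: "sets N = sets M" "sets P = sets M" "sets Q = sets M"
    and le: "\<And>A. A \<in> sets M \<Longrightarrow> emeasure N A \<le> c * emeasure P A + d * emeasure Q A"
    and f: "f \<in> borel_measurable M"
  shows "(\<integral>\<^sup>+x. f x \<partial>N) \<le> c * (\<integral>\<^sup>+x. f x \<partial>P) + d * (\<integral>\<^sup>+x. f x \<partial>Q)"
proof -
  have sp: "space N = space M" "space P = space M" "space Q = space M"
    using sets by (auto dest: sets_eq_imp_space_eq)
  have m: "g \<in> borel_measurable N" "g \<in> borel_measurable P" "g \<in> borel_measurable Q"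
    if "g \<in> borel_measurable M" for g :: "'a \<Rightarrow> ennreal"
    using that sets measurable_cong_sets by blast+
  show ?thesis using f
  proof (induction rule: borel_measurable_induct)
    case (cong f g)
    have "integral\<^sup>N R f = integral\<^sup>N R g" if "space R = space M" for R
      using cong(3) that by (intro nn_integral_cong) auto
    then show ?case using cong sp by simp
  next
    case (set A)
    then show ?case using le sets by simp
  next
    case (mult u e)
    have "e * integral\<^sup>N N u \<le> e * (c * integral\<^sup>N P u + d * integral\<^sup>N Q u)"
      using mult by (intro mult_left_mono) auto
    then show ?case using m[OF mult(2)] by (simp add: nn_integral_cmult algebra_simps)
  next
    case (add u v)
    have "integral\<^sup>N N v + integral\<^sup>N N u \<le> (c * integral\<^sup>N P v + d * integral\<^sup>N Q v) + (c * integral\<^sup>N P u + d * integral\<^sup>N Q u)"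
      using add by (intro add_mono) auto
    moreover have "integral\<^sup>N R (\<lambda>x. v x + u x) = integral\<^sup>N R v + integral\<^sup>N R u" if "R \<in> {N, P, Q}" for R
      using that m[OF add.hyps(1)] m[OF add.hyps(3)] by (intro nn_integral_add) auto
    ultimately show ?case by (simp add: algebra_simps)
  next
    case (seq U)
    have "integral\<^sup>N N (\<lambda>x. SUP i. U i x) = (SUP i. integral\<^sup>N N (U i))"
      by (rule nn_integral_monotone_convergence_SUP[OF seq.hyps(3) m(1)[OF seq.hyps(1)]])
    also have "\<dots> \<le> c * (\<integral>\<^sup>+x. (SUP i. U i x) \<partial>P) + d * (\<integral>\<^sup>+x. (SUP i. U i x) \<partial>Q)"
    proof (rule SUP_least)
      fix i
      have "integral\<^sup>N N (U i) \<le> c * integral\<^sup>N P (U i) + d * integral\<^sup>N Q (U i)" by (rule seq.IH)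
      also have "\<dots> \<le> c * (\<integral>\<^sup>+x. (SUP i. U i x) \<partial>P) + d * (\<integral>\<^sup>+x. (SUP i. U i x) \<partial>Q)"
        by (intro add_mono mult_left_mono nn_integral_mono SUP_upper) auto
      finally show "integral\<^sup>N N (U i) \<le> c * (\<integral>\<^sup>+x. (SUP i. U i x) \<partial>P) + d * (\<integral>\<^sup>+x. (SUP i. U i x) \<partial>Q)" .
    qed
    finally show ?case by (simp add: image_comp)
  qed
qed

section \<open>Total variation compared with the modulus of a density\<close>

lemma complex_measureI:
  assumes "signed_additive M \<xi>" "\<And>A. A \<notin> sets M \<Longrightarrow> \<xi> A = 0"
  shows "complex_measure M \<xi>"
  using assms by (simp add: complex_measure_def signed_additive_def)

context
  fixes M :: "'a measure" and \<xi> :: "'a set \<Rightarrow> complex" and w :: "'a measure" and h :: "'a \<Rightarrow> complex"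
  assumes \<xi>: "complex_measure M \<xi>" and d: "has_density M \<xi> w h"
begin

lemma cm_variation_le_density:
  assumes A: "A \<in> sets M"
  shows "emeasure (cm_variation M \<xi>) A \<le> emeasure (density w (\<lambda>x. ennreal (cmod (h x)))) A"
proof (rule cm_variation_least[OF \<xi> A])
  note D = has_densityD[OF d]
  have [measurable]: "h \<in> borel_measurable w" by (rule D(4))
  show "sets (density w (\<lambda>x. ennreal (cmod (h x)))) = sets M" using D by simp
  fix A assume A: "A \<in> sets M"
  then have [measurable]: "A \<in> sets w" using D by simp
  have "ennreal (cmod (\<xi> A)) \<le> (\<integral>\<^sup>+x. ennreal (norm (indicator A x *\<^sub>R h x)) \<partial>w)"
    unfolding D(6)[OF A] by (intro integral_norm_bound_ennreal integrable_mult_indicator D(3)) simp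
  also have "\<dots> = emeasure (density w (\<lambda>x. ennreal (cmod (h x)))) A"
    by (simp add: emeasure_density) (auto intro!: nn_integral_cong split: split_indicator)
  finally show "ennreal (cmod (\<xi> A)) \<le> emeasure (density w (\<lambda>x. ennreal (cmod (h x)))) A" .
qed

lemma sm_pos_le_cm_variation:
  fixes \<rho> :: "'a set \<Rightarrow> real"
  assumes \<rho>: "signed_additive M \<rho>" "\<And>A. \<rho> A \<le> cmod (\<xi> A)" and A: "A \<in> sets M"
  shows "emeasure (sm_pos M \<rho>) A \<le> emeasure (cm_variation M \<xi>) A"
  unfolding emeasure_sm_pos[OF \<rho>(1) A]
proof (rule SUP_least)
  fix B assume B: "B \<in> {B \<in> sets M. B \<subseteq> A}"
  have "ennreal (\<rho> B) \<le> ennreal (cmod (\<xi> B))" by (intro ennreal_leI \<rho>)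
  also have "\<dots> \<le> emeasure (cm_variation M \<xi>) B" using B by (intro cmod_le_cm_variation \<xi>) auto
  also have "\<dots> \<le> emeasure (cm_variation M \<xi>) A" using B A by (intro emeasure_mono) auto
  finally show "ennreal (\<rho> B) \<le> emeasure (cm_variation M \<xi>) A" .
qed

text \<open>The modulus of \<open>h\<close> is at most the sum of the positive and negative parts of
  its real and imaginary parts. Each of these is the density of a Jordan part and hence lies below
  the variation, which accounts for the 4. The sharp constant is 1, but only finiteness and limits 0
  depend on it.\<close>

lemma density_le_cm_variation:
  assumes A: "A \<in> sets M"
  shows "emeasure (density w (\<lambda>x. ennreal (cmod (h x)))) A \<le> 4 * emeasure (cm_variation M \<xi>) A"
proof -
  note D = has_densityD[OF d]
  have [measurable]: "h \<in> borel_measurable w" by (rule D(4))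
  have [measurable]: "A \<in> sets w" using D A by simp
  note r = has_density_Re[OF d] and i = has_density_Im[OF d]
  let ?e = "\<lambda>g. emeasure (density w (\<lambda>x. ennreal (g x))) A"
  have 1: "?e (\<lambda>x. Re (h x)) \<le> emeasure (cm_variation M \<xi>) A"
    using sm_pos_le_cm_variation[OF has_density_additive[OF r] _ A] sm_pos_has_density[OF r] complex_Re_le_cmod by simp
  have 2: "?e (\<lambda>x. - Re (h x)) \<le> emeasure (cm_variation M \<xi>) A"
    using sm_pos_le_cm_variation[OF has_density_additive[OF has_density_uminus[OF r]] _ A]
      sm_pos_has_density[OF has_density_uminus[OF r]] abs_Re_le_cmod by (simp add: abs_le_iff)
  have 3: "?e (\<lambda>x. Im (h x)) \<le> emeasure (cm_variation M \<xi>) A"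
    using sm_pos_le_cm_variation[OF has_density_additive[OF i] _ A] sm_pos_has_density[OF i] abs_Im_le_cmod by (simp add: abs_le_iff)
  have 4: "?e (\<lambda>x. - Im (h x)) \<le> emeasure (cm_variation M \<xi>) A"
    using sm_pos_le_cm_variation[OF has_density_additive[OF has_density_uminus[OF i]] _ A]
      sm_pos_has_density[OF has_density_uminus[OF i]] abs_Im_le_cmod by (simp add: abs_le_iff)
  have pt: "ennreal (cmod z) \<le> ennreal (Re z) + ennreal (- Re z) + (ennreal (Im z) + ennreal (- Im z))" for z
  proof -
    have "ennreal (cmod z) \<le> ennreal (\<bar>Re z\<bar> + \<bar>Im z\<bar>)" by (intro ennreal_leI cmod_le)
    also have "\<dots> = ennreal \<bar>Re z\<bar> + ennreal \<bar>Im z\<bar>" by simp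
    also have "\<dots> = ennreal (Re z) + ennreal (- Re z) + (ennreal (Im z) + ennreal (- Im z))"
      by (simp add: abs_if ennreal_neg)
    finally show ?thesis .
  qed
  have "?e (\<lambda>x. cmod (h x)) \<le> (\<integral>\<^sup>+x. (ennreal (Re (h x)) * indicator A x + ennreal (- Re (h x)) * indicator A x)
      + (ennreal (Im (h x)) * indicator A x + ennreal (- Im (h x)) * indicator A x) \<partial>w)"
    unfolding emeasure_density[OF measurable_compose[OF measurable_compose[OF D(4) borel_measurable_norm] measurable_ennreal] \<open>A \<in> sets w\<close>]
    by (intro nn_integral_mono) (auto split: split_indicator intro: pt)
  also have "\<dots> = ?e (\<lambda>x. Re (h x)) + ?e (\<lambda>x. - Re (h x)) + (?e (\<lambda>x. Im (h x)) + ?e (\<lambda>x. - Im (h x)))"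
    by (simp add: nn_integral_add emeasure_density)
  also have "\<dots> \<le> emeasure (cm_variation M \<xi>) A + emeasure (cm_variation M \<xi>) A
      + (emeasure (cm_variation M \<xi>) A + emeasure (cm_variation M \<xi>) A)"
    by (intro add_mono 1 2 3 4)
  also have "\<dots> = 4 * emeasure (cm_variation M \<xi>) A"
    by (metis (no_types, opaque_lifting) mult_2 mult.assoc numeral_Bit0_eq_double add.assoc numeral_Bit0 distrib_right)
  finally show ?thesis .
qed

lemma nn_integral_cm_variation_le:
  assumes f: "f \<in> borel_measurable M"
  shows "(\<integral>\<^sup>+x. f x \<partial>cm_variation M \<xi>) \<le> (\<integral>\<^sup>+x. ennreal (cmod (h x)) * f x \<partial>w)"
    and "(\<integral>\<^sup>+x. ennreal (cmod (h x)) * f x \<partial>w) \<le> 4 * (\<integral>\<^sup>+x. f x \<partial>cm_variation M \<xi>)"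
proof -
  note D = has_densityD[OF d]
  have [measurable]: "h \<in> borel_measurable w" by (rule D(4))
  have [measurable]: "f \<in> borel_measurable w" using f measurable_cong_sets[OF D(1) refl] by blast
  let ?N = "density w (\<lambda>x. ennreal (cmod (h x)))"
  have eq: "(\<integral>\<^sup>+x. ennreal (cmod (h x)) * f x \<partial>w) = (\<integral>\<^sup>+x. f x \<partial>?N)"
    by (rule nn_integral_density[symmetric]) measurable
  show "(\<integral>\<^sup>+x. f x \<partial>cm_variation M \<xi>) \<le> (\<integral>\<^sup>+x. ennreal (cmod (h x)) * f x \<partial>w)"
    unfolding eq
    using nn_integral_dominated_measure[of "cm_variation M \<xi>" M ?N ?N 1 0 f] cm_variation_le_density D f by simp
  show "(\<integral>\<^sup>+x. ennreal (cmod (h x)) * f x \<partial>w) \<le> 4 * (\<integral>\<^sup>+x. f x \<partial>cm_variation M \<xi>)"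
    unfolding eq
    using nn_integral_dominated_measure[of ?N M "cm_variation M \<xi>" "cm_variation M \<xi>" 4 0 f] density_le_cm_variation D f by simp
qed

lemma integrable_density_mult:
  fixes f :: "'a \<Rightarrow> complex"
  assumes f: "integrable (cm_variation M \<xi>) f"
  shows "integrable w (\<lambda>x. h x * f x)"
proof (rule integrableI_bounded)
  note D = has_densityD[OF d]
  have fM: "f \<in> borel_measurable M"
    using borel_measurable_integrable[OF f] measurable_cong_sets[OF sets_cm_variation(1) refl] by blast
  have [measurable]: "h \<in> borel_measurable w" by (rule D(4))
  have [measurable]: "f \<in> borel_measurable w" using fM measurable_cong_sets[OF D(1) refl] by blast
  show "(\<lambda>x. h x * f x) \<in> borel_measurable w" by measurable
  have "(\<integral>\<^sup>+x. ennreal (norm (h x * f x)) \<partial>w) = (\<integral>\<^sup>+x. ennreal (cmod (h x)) * ennreal (cmod (f x)) \<partial>w)"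
    by (simp add: norm_mult ennreal_mult)
  also have "\<dots> \<le> 4 * (\<integral>\<^sup>+x. ennreal (cmod (f x)) \<partial>cm_variation M \<xi>)"
    by (rule nn_integral_cm_variation_le(2)) (rule measurable_compose[OF measurable_compose[OF fM borel_measurable_norm] measurable_ennreal])
  also have "\<dots> < \<infinity>" using f by (auto simp: integrable_iff_bounded ennreal_mult_less_top)
  finally show "(\<integral>\<^sup>+x. ennreal (norm (h x * f x)) \<partial>w) < \<infinity>" .
qed

lemma cm_integral_eq:
  fixes f :: "'a \<Rightarrow> complex"
  assumes f: "integrable (cm_variation M \<xi>) f"
  shows "cm_integral M \<xi> f = (\<integral>x. h x * f x \<partial>w)"
proof (rule cm_integral_has_density[OF d _ integrable_density_mult[OF f]])
  show "f \<in> borel_measurable M"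
    using borel_measurable_integrable[OF f] measurable_cong_sets[OF sets_cm_variation(1) refl] by blast
qed

end

section \<open>Existence of densities by Radon-Nikodym\<close>

lemma has_density_real_exists:
  fixes \<rho> :: "'a set \<Rightarrow> real"
  assumes \<rho>: "signed_additive M \<rho>" and w: "finite_measure w" "sets w = sets M"
    and ac: "\<And>A. A \<in> sets M \<Longrightarrow> emeasure w A = 0 \<Longrightarrow> \<rho> A = 0"
  shows "\<exists>h. has_density M \<rho> w h"
proof -
  interpret finite_measure w by fact
  have part: "\<exists>g. integrable w g \<and> (\<forall>A\<in>sets M. measure (sm_pos M \<sigma>) A = (\<integral>x. indicator A x *\<^sub>R g x \<partial>w))"
    if \<sigma>: "signed_additive M \<sigma>" "\<And>A. A \<in> sets M \<Longrightarrow> emeasure w A = 0 \<Longrightarrow> \<sigma> A = 0" for \<sigma>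
  proof -
    interpret p: finite_measure "sm_pos M \<sigma>" by (rule finite_measure_sm_pos[OF \<sigma>(1)])
    \<comment> \<open>The positive part of a \<open>w\<close>-null set is a supremum over its
      subsets, which are themselves null and so have \<open>\<sigma>\<close>-value 0.\<close>
    have "absolutely_continuous w (sm_pos M \<sigma>)"
      unfolding absolutely_continuous_def
    proof
      fix A assume A: "A \<in> null_sets w"
      have "\<sigma> B = 0" if "B \<in> sets M" "B \<subseteq> A" for B
      proof (rule \<sigma>(2)[OF that(1)])
        show "emeasure w B = 0" using A that w(2) null_sets_subset[of A w B] by auto
      qed
      then have "emeasure (sm_pos M \<sigma>) A = 0"
        using A w(2) by (subst emeasure_sm_pos[OF \<sigma>(1)]) (auto intro!: antisym SUP_least)
      then show "A \<in> null_sets (sm_pos M \<sigma>)" using A w(2) by (auto simp: null_sets_def)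
    qed
    then obtain f where f: "f \<in> borel_measurable w" "density w f = sm_pos M \<sigma>"
      using Radon_Nikodym[of "sm_pos M \<sigma>"] w(2) by auto
    have [measurable]: "f \<in> borel_measurable w" by fact
    have em: "emeasure (sm_pos M \<sigma>) A = (\<integral>\<^sup>+x. f x * indicator A x \<partial>w)" if "A \<in> sets M" for A
      unfolding f(2)[symmetric] using that w(2) by (intro emeasure_density f) simp
    have sp: "space w = space M" using w(2) by (rule sets_eq_imp_space_eq)
    have fin: "(\<integral>\<^sup>+x. f x \<partial>w) < \<infinity>"
    proof -
      have "(\<integral>\<^sup>+x. f x \<partial>w) = (\<integral>\<^sup>+x. f x * indicator (space M) x \<partial>w)"
        by (intro nn_integral_cong) (simp add: sp)
      then show ?thesis
        using em[of "space M"] p.emeasure_finite[of "space M"] by (simp add: top.not_eq_extremum)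
    qed
    have "AE x in w. f x \<noteq> \<infinity>"
      by (rule nn_integral_PInf_AE) (use fin in auto)
    \<comment> \<open>The Radon-Nikodym derivative takes extended values, but it has finite total
      integral; passing to reals by \<open>enn2real\<close> therefore changes nothing almost
      everywhere.\<close>
    then have ae: "AE x in w. ennreal (enn2real (f x)) = f x" by eventually_elim (auto simp: less_top)
    have int: "integrable w (\<lambda>x. enn2real (f x))"
    proof (rule integrableI_bounded)
      have "(\<integral>\<^sup>+x. ennreal (norm (enn2real (f x))) \<partial>w) = (\<integral>\<^sup>+x. f x \<partial>w)"
        by (intro nn_integral_cong_AE) (use ae in \<open>auto elim: eventually_mono\<close>)
      then show "(\<integral>\<^sup>+x. ennreal (norm (enn2real (f x))) \<partial>w) < \<infinity>" using fin by simp
    qed measurable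
    moreover have "measure (sm_pos M \<sigma>) A = (\<integral>x. indicator A x *\<^sub>R enn2real (f x) \<partial>w)" if A: "A \<in> sets M" for A
    proof -
      have [measurable]: "A \<in> sets w" using A w by simp
      have "(\<integral>\<^sup>+x. f x * indicator A x \<partial>w) = (\<integral>\<^sup>+x. ennreal (indicator A x *\<^sub>R enn2real (f x)) \<partial>w)"
        by (intro nn_integral_cong_AE) (use ae in \<open>auto elim: eventually_mono split: split_indicator\<close>)
      also have "\<dots> = ennreal (\<integral>x. indicator A x *\<^sub>R enn2real (f x) \<partial>w)"
        by (intro nn_integral_eq_integral integrable_mult_indicator int) auto
      finally have "ennreal (measure (sm_pos M \<sigma>) A) = ennreal (\<integral>x. indicator A x *\<^sub>R enn2real (f x) \<partial>w)"
        using em[OF A] by (simp add: p.emeasure_eq_measure)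
      then show ?thesis by (simp add: integral_nonneg_AE)
    qed
    ultimately show ?thesis by blast
  qed
  obtain g1 where g1: "integrable w g1" "\<And>A. A \<in> sets M \<Longrightarrow> measure (sm_pos M \<rho>) A = (\<integral>x. indicator A x *\<^sub>R g1 x \<partial>w)"
    using part[OF \<rho> ac] by blast
  obtain g2 where g2: "integrable w g2" "\<And>A. A \<in> sets M \<Longrightarrow> measure (sm_neg M \<rho>) A = (\<integral>x. indicator A x *\<^sub>R g2 x \<partial>w)"
    using part[OF signed_additive_uminus[OF \<rho>]] ac unfolding sm_neg_def by (metis neg_equal_0_iff_equal)
  have "has_density M \<rho> w (\<lambda>x. g1 x - g2 x)"
    unfolding has_density_def
  proof (intro conjI ballI w)
    show "integrable w (\<lambda>x. g1 x - g2 x)" using g1 g2 by simp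
    fix A assume A: "A \<in> sets M"
    then have "A \<in> sets w" using w by simp
    then show "\<rho> A = (\<integral>x. indicator A x *\<^sub>R (g1 x - g2 x) \<partial>w)"
      using jordan_decomposition[OF \<rho> A] g1(2)[OF A] g2(2)[OF A]
        integrable_mult_indicator[OF _ g1(1), of A] integrable_mult_indicator[OF _ g2(1), of A]
      by (simp add: algebra_simps)
  qed
  then show ?thesis by blast
qed

lemma has_density_exists:
  assumes \<xi>: "complex_measure M \<xi>" and w: "finite_measure w" "sets w = sets M"
    and ac: "\<And>A. A \<in> sets M \<Longrightarrow> emeasure w A = 0 \<Longrightarrow> \<xi> A = 0"
  obtains h where "has_density M \<xi> w h"
proof -
  obtain a where a: "has_density M (\<lambda>A. Re (\<xi> A)) w a"
    using has_density_real_exists[OF complex_measure_Re[OF \<xi>] w] ac by auto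
  obtain b where b: "has_density M (\<lambda>A. Im (\<xi> A)) w b"
    using has_density_real_exists[OF complex_measure_Im[OF \<xi>] w] ac by auto
  have ab: "integrable w a" "integrable w b" using a b by (auto simp: has_density_def)
  have "has_density M \<xi> w (\<lambda>x. Complex (a x) (b x))"
    unfolding has_density_def
  proof (intro conjI ballI w)
    have C: "Complex (a x) (b x) = of_real (a x) + \<i> * of_real (b x)" for x by (simp add: complex_eq_iff)
    show int: "integrable w (\<lambda>x. Complex (a x) (b x))" unfolding C using ab by simp
    fix A assume A: "A \<in> sets M"
    then have Aw: "A \<in> sets w" using w by simp
    have i: "integrable w (\<lambda>x. indicator A x *\<^sub>R Complex (a x) (b x))" using integrable_mult_indicator[OF Aw int] .
    show "\<xi> A = (\<integral>x. indicator A x *\<^sub>R Complex (a x) (b x) \<partial>w)"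
      using has_densityD(6)[OF a A] has_densityD(6)[OF b A] integral_Re[OF i] integral_Im[OF i]
      by (simp add: complex_eq_iff)
  qed
  then show ?thesis using that by blast
qed

lemma has_density_cm_variation:
  assumes \<xi>: "complex_measure M \<xi>"
  obtains h where "has_density M \<xi> (cm_variation M \<xi>) h"
proof (rule has_density_exists[OF \<xi> finite_measure_cm_variation[OF \<xi>] sets_cm_variation(1)])
  fix A assume "A \<in> sets M" "emeasure (cm_variation M \<xi>) A = 0"
  then show "\<xi> A = 0" using cmod_le_cm_variation[OF \<xi>, of A] by simp
qed (rule that)

section \<open>Linearity and bounds for integrals against complex measures\<close>

lemma complex_measure_lin:
  assumes "complex_measure M \<xi>" "complex_measure M \<eta>"
  shows "complex_measure M (\<lambda>A. a * \<xi> A + b * \<eta> A)"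
  using assms by (auto simp: complex_measure_def intro!: sums_add sums_mult)

lemma complex_measure_cnj:
  "complex_measure M \<xi> \<Longrightarrow> complex_measure M (\<lambda>A. cnj (\<xi> A))"
  by (auto simp: complex_measure_def sums_cnj)

lemma cm_variation_cnj [simp]: "cm_variation M (\<lambda>A. cnj (\<xi> A)) = cm_variation M \<xi>"
  by (simp add: cm_variation_def)

lemma has_density_lin:
  fixes h g :: "'a \<Rightarrow> complex"
  assumes h: "has_density M \<xi> w h" and g: "has_density M \<eta> w g"
  shows "has_density M (\<lambda>A. a * \<xi> A + b * \<eta> A) w (\<lambda>x. a * h x + b * g x)"
  unfolding has_density_def
proof (intro conjI ballI)
  note H = has_densityD[OF h] and G = has_densityD[OF g]
  show "sets w = sets M" "integrable w (\<lambda>x. a * h x + b * g x)" using H G by auto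
  fix A assume A: "A \<in> sets M"
  then have "A \<in> sets w" using H by simp
  then have "integrable w (\<lambda>x. indicator A x *\<^sub>R h x)" "integrable w (\<lambda>x. indicator A x *\<^sub>R g x)"
    using integrable_mult_indicator H(3) G(3) by blast+
  then have "(\<integral>x. a * (indicator A x *\<^sub>R h x) + b * (indicator A x *\<^sub>R g x) \<partial>w) = a * \<xi> A + b * \<eta> A"
    unfolding H(6)[OF A] G(6)[OF A]
    by (subst Bochner_Integration.integral_add) (auto simp del: mult_scaleR_right)
  then show "a * \<xi> A + b * \<eta> A = (\<integral>x. indicator A x *\<^sub>R (a * h x + b * g x) \<partial>w)"
    by (simp add: scaleR_add_right)
qed

lemma borel_measurable_cm_variation:
  "f \<in> borel_measurable (cm_variation M \<xi>) \<longleftrightarrow> f \<in> borel_measurable M"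
  using measurable_cong_sets[OF sets_cm_variation(1) refl] by blast

lemma cm_integral_cong:
  assumes "\<And>x. x \<in> space M \<Longrightarrow> f x = g x"
  shows "cm_integral M \<xi> f = cm_integral M \<xi> g"
proof -
  have "integral\<^sup>L N f = integral\<^sup>L N g" if "space N = space M" for N
    using that assms by (intro Bochner_Integration.integral_cong) auto
  then show ?thesis by (simp add: cm_integral_def sm_integral_def)
qed

text \<open>The Jordan parts of a combination are not the combinations of the Jordan parts.
  Densities with respect to the sum of the two variations replace them by one integrand that is
  linear in the measures.\<close>

lemma cm_integral_lin_measure:
  assumes \<xi>: "complex_measure M \<xi>" and \<eta>: "complex_measure M \<eta>"
    and f: "integrable (cm_variation M \<xi>) f" "integrable (cm_variation M \<eta>) f"
  shows "cm_integral M (\<lambda>A. a * \<xi> A + b * \<eta> A) f = a * cm_integral M \<xi> f + b * cm_integral M \<eta> f"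
proof -
  define w where "w = sum_measure (cm_variation M \<xi>) (cm_variation M \<eta>)"
  have sw: "sets w = sets M" by (simp add: w_def)
  have fw: "finite_measure w"
    unfolding w_def by (intro finite_sum_measure finite_measure_cm_variation \<xi> \<eta>) simp
  have ew: "emeasure w A = emeasure (cm_variation M \<xi>) A + emeasure (cm_variation M \<eta>) A" if "A \<in> sets M" for A
    using that by (simp add: w_def emeasure_sum_measure)
  obtain h where h: "has_density M \<xi> w h"
    by (rule has_density_exists[OF \<xi> fw sw]) (use cmod_le_cm_variation[OF \<xi>] ew in fastforce)+
  obtain g where g: "has_density M \<eta> w g"
    by (rule has_density_exists[OF \<eta> fw sw]) (use cmod_le_cm_variation[OF \<eta>] ew in fastforce)+
  have i: "integrable w (\<lambda>x. h x * f x)" "integrable w (\<lambda>x. g x * f x)"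
    using integrable_density_mult[OF \<xi> h f(1)] integrable_density_mult[OF \<eta> g f(2)] .
  have fM: "f \<in> borel_measurable M" using borel_measurable_integrable[OF f(1)] borel_measurable_cm_variation by blast
  have eq: "(\<lambda>x. (a * h x + b * g x) * f x) = (\<lambda>x. a * (h x * f x) + b * (g x * f x))"
    by (simp add: algebra_simps)
  have "cm_integral M (\<lambda>A. a * \<xi> A + b * \<eta> A) f = (\<integral>x. (a * h x + b * g x) * f x \<partial>w)"
    by (rule cm_integral_has_density[OF has_density_lin[OF h g] fM]) (use i in \<open>simp add: eq\<close>)
  also have "\<dots> = a * (\<integral>x. h x * f x \<partial>w) + b * (\<integral>x. g x * f x \<partial>w)"
    unfolding eq using i by simp
  finally show ?thesis using cm_integral_eq[OF \<xi> h f(1)] cm_integral_eq[OF \<eta> g f(2)] by simp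
qed

lemma cm_integral_lin_fun:
  assumes \<xi>: "complex_measure M \<xi>"
    and f: "integrable (cm_variation M \<xi>) f" "integrable (cm_variation M \<xi>) g"
  shows "cm_integral M \<xi> (\<lambda>x. a * f x + b * g x) = a * cm_integral M \<xi> f + b * cm_integral M \<xi> g"
proof -
  obtain h where h: "has_density M \<xi> (cm_variation M \<xi>) h" using has_density_cm_variation[OF \<xi>] .
  have fg: "integrable (cm_variation M \<xi>) (\<lambda>x. a * f x + b * g x)" using f by simp
  have eq: "(\<lambda>x. h x * (a * f x + b * g x)) = (\<lambda>x. a * (h x * f x) + b * (h x * g x))" by (simp add: algebra_simps)
  show ?thesis
    unfolding cm_integral_eq[OF \<xi> h fg] cm_integral_eq[OF \<xi> h f(1)] cm_integral_eq[OF \<xi> h f(2)] eq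
    using integrable_density_mult[OF \<xi> h f(1)] integrable_density_mult[OF \<xi> h f(2)] by simp
qed

lemma cm_integral_bound:
  assumes \<xi>: "complex_measure M \<xi>" and f: "integrable (cm_variation M \<xi>) f"
  shows "ennreal (cmod (cm_integral M \<xi> f)) \<le> 4 * (\<integral>\<^sup>+x. ennreal (cmod (f x)) \<partial>cm_variation M \<xi>)"
proof -
  obtain h where h: "has_density M \<xi> (cm_variation M \<xi>) h" using has_density_cm_variation[OF \<xi>] .
  have [measurable]: "f \<in> borel_measurable M" using borel_measurable_integrable[OF f] borel_measurable_cm_variation by blast
  have "ennreal (cmod (cm_integral M \<xi> f)) \<le> (\<integral>\<^sup>+x. ennreal (cmod (h x * f x)) \<partial>cm_variation M \<xi>)"
    unfolding cm_integral_eq[OF \<xi> h f] by (intro integral_norm_bound_ennreal integrable_density_mult[OF \<xi> h f])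
  also have "\<dots> = (\<integral>\<^sup>+x. ennreal (cmod (h x)) * ennreal (cmod (f x)) \<partial>cm_variation M \<xi>)"
    by (simp add: norm_mult ennreal_mult)
  also have "\<dots> \<le> 4 * (\<integral>\<^sup>+x. ennreal (cmod (f x)) \<partial>cm_variation M \<xi>)"
    by (rule nn_integral_cm_variation_le(2)[OF \<xi> h]) measurable
  finally show ?thesis .
qed

text \<open>Setwise this is the triangle inequality summed over a partition; the domination
  principle lifts it to integrals.\<close>

lemma nn_integral_variation_lin:
  assumes \<xi>: "complex_measure M \<xi>" and \<eta>: "complex_measure M \<eta>" and f: "f \<in> borel_measurable M"
  shows "(\<integral>\<^sup>+x. f x \<partial>cm_variation M (\<lambda>A. a * \<xi> A + b * \<eta> A))
    \<le> ennreal (cmod a) * (\<integral>\<^sup>+x. f x \<partial>cm_variation M \<xi>) + ennreal (cmod b) * (\<integral>\<^sup>+x. f x \<partial>cm_variation M \<eta>)"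
proof (rule nn_integral_dominated_measure[OF _ _ _ _ f])
  fix A assume A: "A \<in> sets M"
  show "emeasure (cm_variation M (\<lambda>A. a * \<xi> A + b * \<eta> A)) A
    \<le> ennreal (cmod a) * emeasure (cm_variation M \<xi>) A + ennreal (cmod b) * emeasure (cm_variation M \<eta>) A"
    unfolding emeasure_cm_variation[OF complex_measure_lin[OF \<xi> \<eta>] A] emeasure_cm_variation[OF \<xi> A] emeasure_cm_variation[OF \<eta> A]
    unfolding partition_sup_def[of M "\<lambda>A. ennreal (cmod (a * \<xi> A + b * \<eta> A))"]
  proof (rule SUP_least)
    fix P assume P: "P \<in> countable_partitions M A"
    have "(\<Sum>i. ennreal (cmod (a * \<xi> (P i) + b * \<eta> (P i))))
        \<le> (\<Sum>i. ennreal (cmod a) * ennreal (cmod (\<xi> (P i))) + ennreal (cmod b) * ennreal (cmod (\<eta> (P i))))"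
    proof (intro suminf_le)
      fix i
      have "ennreal (cmod (a * \<xi> (P i) + b * \<eta> (P i))) \<le> ennreal (cmod a * cmod (\<xi> (P i)) + cmod b * cmod (\<eta> (P i)))"
        by (intro ennreal_leI) (metis norm_mult norm_triangle_ineq)
      then show "ennreal (cmod (a * \<xi> (P i) + b * \<eta> (P i)))
          \<le> ennreal (cmod a) * ennreal (cmod (\<xi> (P i))) + ennreal (cmod b) * ennreal (cmod (\<eta> (P i)))"
        by (simp add: ennreal_mult)
    qed auto
    also have "\<dots> = ennreal (cmod a) * (\<Sum>i. ennreal (cmod (\<xi> (P i)))) + ennreal (cmod b) * (\<Sum>i. ennreal (cmod (\<eta> (P i))))"
      by (subst suminf_add[symmetric]) auto
    also have "\<dots> \<le> ennreal (cmod a) * partition_sup M (\<lambda>A. ennreal (cmod (\<xi> A))) A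
        + ennreal (cmod b) * partition_sup M (\<lambda>A. ennreal (cmod (\<eta> A))) A"
      unfolding partition_sup_def by (intro add_mono mult_left_mono SUP_upper P) auto
    finally show "(\<Sum>i. ennreal (cmod (a * \<xi> (P i) + b * \<eta> (P i)))) \<le> \<dots>" .
  qed
qed auto

section \<open>Measures given by a density, truncations and Dirac measures\<close>

definition density_measure :: "'a measure \<Rightarrow> ('a \<Rightarrow> complex) \<Rightarrow> 'a set \<Rightarrow> complex" where
  "density_measure w u A = (if A \<in> sets w then \<integral>x. indicator A x *\<^sub>R u x \<partial>w else 0)"

lemma has_density_density_measure:
  "sets w = sets M \<Longrightarrow> integrable w u \<Longrightarrow> has_density M (density_measure w u) w u"
  by (simp add: has_density_def density_measure_def)

lemma complex_measure_density_measure: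
  assumes "sets w = sets M" "integrable w u"
  shows "complex_measure M (density_measure w u)"
  by (rule complex_measureI[OF has_density_additive[OF has_density_density_measure[OF assms]]])
     (use assms in \<open>simp add: density_measure_def\<close>)

text \<open>The value 0 off \<open>sets M\<close> is forced by \<open>complex_measure\<close>;
  without the case distinction \<open>A \<inter> E\<close> could be measurable although
  \<open>A\<close> is not.\<close>

definition restrict_cm :: "'a measure \<Rightarrow> 'a set \<Rightarrow> ('a set \<Rightarrow> complex) \<Rightarrow> 'a set \<Rightarrow> complex" where
  "restrict_cm M E \<xi> A = (if A \<in> sets M then \<xi> (A \<inter> E) else 0)"

context
  fixes M :: "'a measure" and E :: "'a set" and \<xi> :: "'a set \<Rightarrow> complex"
  assumes E: "E \<in> sets M" and \<xi>: "complex_measure M \<xi>"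
begin

lemma has_density_restrict_cm:
  assumes h: "has_density M \<xi> w h"
  shows "has_density M (restrict_cm M E \<xi>) w (\<lambda>x. indicator E x *\<^sub>R h x)"
  unfolding has_density_def
proof (intro conjI ballI)
  note H = has_densityD[OF h]
  have Ew: "E \<in> sets w" using E H by simp
  show "sets w = sets M" by (rule H(1))
  show "integrable w (\<lambda>x. indicator E x *\<^sub>R h x)" using H(3) Ew by (intro integrable_mult_indicator)
  fix A assume A: "A \<in> sets M"
  then have "A \<inter> E \<in> sets M" using E by auto
  then show "restrict_cm M E \<xi> A = (\<integral>x. indicator A x *\<^sub>R indicator E x *\<^sub>R h x \<partial>w)"
    using H(6)[of "A \<inter> E"] A by (simp add: restrict_cm_def indicator_inter_arith)
qed

lemma complex_measure_restrict_cm: "complex_measure M (restrict_cm M E \<xi>)"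
proof -
  obtain h where h: "has_density M \<xi> (cm_variation M \<xi>) h" using has_density_cm_variation[OF \<xi>] .
  show ?thesis
    by (rule complex_measureI[OF has_density_additive[OF has_density_restrict_cm[OF h]]]) (simp add: restrict_cm_def)
qed

lemma nn_integral_restrict_cm:
  assumes [measurable]: "f \<in> borel_measurable M"
  shows "(\<integral>\<^sup>+x. f x \<partial>cm_variation M (restrict_cm M E \<xi>)) \<le> 4 * (\<integral>\<^sup>+x. f x * indicator E x \<partial>cm_variation M \<xi>)"
proof -
  have [measurable]: "E \<in> sets M" by (rule E)
  obtain h where h: "has_density M \<xi> (cm_variation M \<xi>) h" using has_density_cm_variation[OF \<xi>] .
  have "(\<integral>\<^sup>+x. f x \<partial>cm_variation M (restrict_cm M E \<xi>))
      \<le> (\<integral>\<^sup>+x. ennreal (cmod (indicator E x *\<^sub>R h x)) * f x \<partial>cm_variation M \<xi>)"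
    by (rule nn_integral_cm_variation_le(1)[OF complex_measure_restrict_cm has_density_restrict_cm[OF h] assms])
  also have "\<dots> = (\<integral>\<^sup>+x. ennreal (cmod (h x)) * (f x * indicator E x) \<partial>cm_variation M \<xi>)"
    by (intro nn_integral_cong) (auto split: split_indicator)
  also have "\<dots> \<le> 4 * (\<integral>\<^sup>+x. f x * indicator E x \<partial>cm_variation M \<xi>)"
    by (rule nn_integral_cm_variation_le(2)[OF \<xi> h]) measurable
  finally show ?thesis .
qed

lemma cm_integral_restrict_cm:
  assumes f: "f \<in> borel_measurable M" and i: "integrable (cm_variation M \<xi>) (\<lambda>x. indicator E x *\<^sub>R f x)"
  shows "cm_integral M (restrict_cm M E \<xi>) f = cm_integral M \<xi> (\<lambda>x. indicator E x *\<^sub>R f x)"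
proof -
  obtain h where h: "has_density M \<xi> (cm_variation M \<xi>) h" using has_density_cm_variation[OF \<xi>] .
  have eq: "(\<lambda>x. (indicator E x *\<^sub>R h x) * f x) = (\<lambda>x. h x * (indicator E x *\<^sub>R f x))" by auto
  show ?thesis
    unfolding cm_integral_eq[OF \<xi> h i] eq[symmetric]
    by (rule cm_integral_has_density[OF has_density_restrict_cm[OF h] f])
       (use integrable_density_mult[OF \<xi> h i] in \<open>simp add: eq\<close>)
qed

end

definition dirac :: "'a measure \<Rightarrow> 'a \<Rightarrow> 'a set \<Rightarrow> complex" where
  "dirac M t A = (if A \<in> sets M \<and> t \<in> A then 1 else 0)"

context
  fixes M :: "'a measure" and t :: 'a
  assumes t: "t \<in> space M"
begin

text \<open>Taking the image of a one-point counting measure puts unit mass at \<open>t\<close> on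
  the sigma-algebra of \<open>M\<close> itself, where the singleton of \<open>t\<close> need not be
  measurable.\<close>

private definition point :: "'a measure" where
  "point = distr (count_space {()}) M (\<lambda>_. t)"

private lemma point_measurable: "(\<lambda>_. t) \<in> measurable (count_space {()}) M"
  using t by simp

private lemma has_density_dirac: "has_density M (dirac M t) point (\<lambda>_. 1)"
  unfolding has_density_def
proof (intro conjI ballI)
  show "sets point = sets M" by (simp add: point_def)
  have "finite_measure point"
    unfolding point_def using point_measurable by (intro finite_measure.finite_measure_distr finite_measure_count_space) auto
  then show "integrable point (\<lambda>_. 1 :: complex)" by (rule finite_measure.integrable_const)
  fix A assume A: "A \<in> sets M"
  then have "(\<lambda>x. indicator A x *\<^sub>R (1 :: complex)) \<in> borel_measurable M" by simp
  then show "dirac M t A = (\<integral>x. indicator A x *\<^sub>R 1 \<partial>point)"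
    unfolding point_def using A
    by (subst integral_distr[OF point_measurable]) (auto simp: dirac_def lebesgue_integral_count_space_finite)
qed

lemma complex_measure_dirac: "complex_measure M (dirac M t)"
  by (rule complex_measureI[OF has_density_additive[OF has_density_dirac]]) (simp add: dirac_def)

lemma cm_integral_dirac:
  assumes f: "f \<in> borel_measurable M"
  shows "cm_integral M (dirac M t) f = f t"
proof -
  have i: "integrable point (\<lambda>x. 1 * f x)"
    unfolding point_def using f by (subst integrable_distr_eq[OF point_measurable]) (auto intro: integrable_count_space)
  have "cm_integral M (dirac M t) f = (\<integral>x. 1 * f x \<partial>point)"
    by (rule cm_integral_has_density[OF has_density_dirac f i])
  also have "\<dots> = f t"
    unfolding point_def using f
    by (subst integral_distr[OF point_measurable]) (auto simp: lebesgue_integral_count_space_finite)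
  finally show ?thesis .
qed

lemma nn_integral_dirac:
  assumes f: "f \<in> borel_measurable M"
  shows "(\<integral>\<^sup>+x. f x \<partial>cm_variation M (dirac M t)) \<le> f t"
proof -
  have "(\<integral>\<^sup>+x. f x \<partial>cm_variation M (dirac M t)) \<le> (\<integral>\<^sup>+x. ennreal (cmod 1) * f x \<partial>point)"
    by (rule nn_integral_cm_variation_le(1)[OF complex_measure_dirac has_density_dirac f])
  also have "\<dots> = f t"
    unfolding point_def using f
    by (subst nn_integral_distr[OF point_measurable]) (auto simp: nn_integral_count_space_finite)
  finally show ?thesis .
qed

end

section \<open>The dual of a semi-inner product space given on a dense subspace\<close>

text \<open>The form lives on \<open>M1 M k\<close>, which is closed under scaling but under
  differences only when their \<open>kq\<close> is finite. Hermitian symmetry and Cauchy-Schwarz are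
  required only with one argument in the linear part \<open>V0\<close>; \<open>V0_dense\<close> asks
  for norm approximation and for convergence of the form in its second slot, which together extend
  both properties.\<close>

locale dense_subspace_kernel =
  fixes M :: "'a measure" and k :: "'a \<Rightarrow> 'a \<Rightarrow> complex" and V0 :: "('a set \<Rightarrow> complex) set"
  assumes V_scale: "x \<in> M1 M k \<Longrightarrow> (\<lambda>A. c * x A) \<in> M1 M k"
    and V_diff: "x \<in> M1 M k \<Longrightarrow> y \<in> M1 M k \<Longrightarrow> kq M k (\<lambda>A. x A - y A) < \<infinity> \<Longrightarrow> (\<lambda>A. x A - y A) \<in> M1 M k"
    and V0_V: "x \<in> V0 \<Longrightarrow> x \<in> M1 M k"
    and V0_zero: "(\<lambda>A. 0) \<in> V0"
    and V0_lin: "x \<in> V0 \<Longrightarrow> y \<in> V0 \<Longrightarrow> (\<lambda>A. a * x A + b * y A) \<in> V0"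
    and B_left: "x \<in> M1 M k \<Longrightarrow> y \<in> M1 M k \<Longrightarrow> z \<in> M1 M k \<Longrightarrow> (\<lambda>A. a * x A + b * y A) \<in> M1 M k \<Longrightarrow>
        kip M k (\<lambda>A. a * x A + b * y A) z = a * kip M k x z + b * kip M k y z"
    and B_herm0: "x \<in> M1 M k \<Longrightarrow> y \<in> V0 \<Longrightarrow> kip M k y x = cnj (kip M k x y)"
    and B_CS0: "x \<in> M1 M k \<Longrightarrow> y \<in> V0 \<Longrightarrow>
        cmod (kip M k x y) \<le> sqrt (Re (kip M k x x)) * sqrt (Re (kip M k y y))"
    and B_nonneg: "x \<in> M1 M k \<Longrightarrow> kip M k x x \<in> \<real> \<and> Re (kip M k x x) \<ge> 0"
    and V0_dense: "x \<in> M1 M k \<Longrightarrow> \<exists>s::nat \<Rightarrow> _. (\<forall>n. s n \<in> V0 \<and> (\<lambda>A. x A - s n A) \<in> M1 M k)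
        \<and> (\<lambda>n. sqrt (Re (kip M k (\<lambda>A. x A - s n A) (\<lambda>A. x A - s n A)))) \<longlonglongrightarrow> 0
        \<and> (\<forall>y\<in>M1 M k. (\<lambda>n. kip M k y (s n)) \<longlonglongrightarrow> kip M k y x)"
begin

section \<open>The semi-inner product, extended from the dense subspace\<close>

abbreviation "V \<equiv> M1 M k"
abbreviation "B \<equiv> kip M k"
abbreviation "cls \<equiv> kcls M k"
abbreviation "X \<equiv> Mq M k"
abbreviation "D \<equiv> kdual M k"
abbreviation "N \<equiv> kdual_norm M k"
abbreviation "T \<equiv> Tk M k"

definition nrm :: "('a set \<Rightarrow> complex) \<Rightarrow> real" where
  "nrm x = sqrt (Re (B x x))"

lemma nrm_nonneg [simp]: "x \<in> V \<Longrightarrow> nrm x \<ge> 0"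
  using B_nonneg by (simp add: nrm_def)

lemma B_self: "x \<in> V \<Longrightarrow> B x x = of_real ((nrm x)\<^sup>2)"
  using B_nonneg[of x] by (simp add: nrm_def complex_is_Real_iff complex_eq_iff)

lemma kq_V: "x \<in> V \<Longrightarrow> kq M k x = ereal ((nrm x)\<^sup>2)"
  using B_self[of x] by (auto simp: M1_def kq_def split: if_splits)

lemma V_zero [simp]: "(\<lambda>A. 0) \<in> V" using V0_V V0_zero by blast

lemma B_CS0': "x \<in> V \<Longrightarrow> y \<in> V0 \<Longrightarrow> cmod (B x y) \<le> nrm x * nrm y"
  using B_CS0 by (simp add: nrm_def)

lemma B_diff_left:
  assumes "x \<in> V" "y \<in> V" "z \<in> V" "(\<lambda>A. x A - y A) \<in> V"
  shows "B (\<lambda>A. x A - y A) z = B x z - B y z"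
  using B_left[of x y z 1 "-1"] assms by simp

text \<open>The final bound is a triangle inequality obtained before Cauchy-Schwarz is known on all
  of \<open>V\<close>: \<open>B (s n) (s n)\<close> is the difference of \<open>B x (s n)\<close>
  and \<open>B (\<lambda>A. x A - s n A) (s n)\<close>, whose second arguments lie in
  \<open>V0\<close>. It remains to divide by \<open>nrm (s n)\<close>.\<close>

lemma approx:
  assumes "x \<in> V"
  obtains s :: "nat \<Rightarrow> 'a set \<Rightarrow> complex" where "\<And>n. s n \<in> V0" "\<And>n. s n \<in> V" "\<And>n. (\<lambda>A. x A - s n A) \<in> V"
    "(\<lambda>n. nrm (\<lambda>A. x A - s n A)) \<longlonglongrightarrow> 0"
    "\<And>y. y \<in> V \<Longrightarrow> (\<lambda>n. B y (s n)) \<longlonglongrightarrow> B y x"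
    "\<And>n. nrm (s n) \<le> nrm x + nrm (\<lambda>A. x A - s n A)"
proof -
  obtain s :: "nat \<Rightarrow> 'a set \<Rightarrow> complex" where s: "\<And>n. s n \<in> V0" "\<And>n. (\<lambda>A. x A - s n A) \<in> V"
    "(\<lambda>n. nrm (\<lambda>A. x A - s n A)) \<longlonglongrightarrow> 0"
    "\<And>y. y \<in> V \<Longrightarrow> (\<lambda>n. B y (s n)) \<longlonglongrightarrow> B y x"
    using V0_dense[OF assms] unfolding nrm_def by blast
  have sV: "s n \<in> V" for n using s(1) V0_V by blast
  have "nrm (s n) \<le> nrm x + nrm (\<lambda>A. x A - s n A)" for n
  proof -
    let ?d = "\<lambda>A. x A - s n A"
    have "B ?d (s n) = B x (s n) - B (s n) (s n)"
      using B_diff_left[OF assms sV sV s(2)] .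
    then have "of_real ((nrm (s n))\<^sup>2) = B x (s n) - B ?d (s n)"
      using B_self[OF sV, of n] by simp
    then have "(nrm (s n))\<^sup>2 = cmod (B x (s n) - B ?d (s n))"
      by (metis norm_of_real abs_of_nonneg zero_le_power2)
    also have "\<dots> \<le> cmod (B x (s n)) + cmod (B ?d (s n))" by (rule norm_triangle_ineq4)
    also have "\<dots> \<le> nrm x * nrm (s n) + nrm ?d * nrm (s n)"
      by (intro add_mono B_CS0' assms s)
    finally have *: "nrm (s n) * nrm (s n) \<le> (nrm x + nrm ?d) * nrm (s n)"
      by (simp add: power2_eq_square algebra_simps)
    show ?thesis
    proof (cases "nrm (s n) = 0")
      case True then show ?thesis using assms s by simp
    next
      case False
      then have "nrm (s n) > 0" using sV[of n] by (simp add: less_le)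
      then show ?thesis using * by simp
    qed
  qed
  then show ?thesis using that s sV by blast
qed

lemma B_CS:
  assumes "x \<in> V" "y \<in> V"
  shows "cmod (B x y) \<le> nrm x * nrm y"
proof -
  obtain s where s: "\<And>n. s n \<in> V0" "\<And>n. s n \<in> V" "\<And>n. (\<lambda>A. y A - s n A) \<in> V"
    "(\<lambda>n. nrm (\<lambda>A. y A - s n A)) \<longlonglongrightarrow> 0"
    "\<And>z. z \<in> V \<Longrightarrow> (\<lambda>n. B z (s n)) \<longlonglongrightarrow> B z y"
    "\<And>n. nrm (s n) \<le> nrm y + nrm (\<lambda>A. y A - s n A)"
    by (rule approx[OF assms(2)], rule that)
  have "cmod (B x (s n)) \<le> nrm x * (nrm y + nrm (\<lambda>A. y A - s n A))" for n
    using B_CS0'[OF assms(1) s(1)[of n]] mult_left_mono[OF s(6)[of n] nrm_nonneg[OF assms(1)]] by linarith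
  moreover have "(\<lambda>n. cmod (B x (s n))) \<longlonglongrightarrow> cmod (B x y)"
    by (intro tendsto_norm s assms)
  moreover have "(\<lambda>n. nrm x * (nrm y + nrm (\<lambda>A. y A - s n A))) \<longlonglongrightarrow> nrm x * (nrm y + 0)"
    by (intro tendsto_intros s)
  ultimately show ?thesis by (metis (no_types, lifting) LIMSEQ_le add_0_right)
qed

text \<open>Symmetry is available against the approximants \<open>s n\<close> of \<open>y\<close>.
  Replacing \<open>y\<close> by \<open>s n\<close> in the first slot costs
  \<open>B (\<lambda>A. y A - s n A) x\<close>, which Cauchy-Schwarz sends to 0; in the second slot
  convergence is part of the approximation.\<close>

lemma B_herm:
  assumes "x \<in> V" "y \<in> V"
  shows "B y x = cnj (B x y)"
proof -
  obtain s where s: "\<And>n. s n \<in> V0" "\<And>n. s n \<in> V" "\<And>n. (\<lambda>A. y A - s n A) \<in> V"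
    "(\<lambda>n. nrm (\<lambda>A. y A - s n A)) \<longlonglongrightarrow> 0"
    "\<And>z. z \<in> V \<Longrightarrow> (\<lambda>n. B z (s n)) \<longlonglongrightarrow> B z y"
    "\<And>n. nrm (s n) \<le> nrm y + nrm (\<lambda>A. y A - s n A)"
    by (rule approx[OF assms(2)], rule that)
  have "(\<lambda>n. B (\<lambda>A. y A - s n A) x) \<longlonglongrightarrow> 0"
  proof (rule Lim_null_comparison)
    show "\<forall>\<^sub>F n in sequentially. cmod (B (\<lambda>A. y A - s n A) x) \<le> nrm (\<lambda>A. y A - s n A) * nrm x"
      using B_CS[OF s(3) assms(1)] by simp
    show "(\<lambda>n. nrm (\<lambda>A. y A - s n A) * nrm x) \<longlonglongrightarrow> 0"
      using tendsto_mult_right[OF s(4), of "nrm x"] by simp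
  qed
  then have "(\<lambda>n. B y x - B (\<lambda>A. y A - s n A) x) \<longlonglongrightarrow> B y x - 0"
    by (intro tendsto_intros)
  moreover have "B y x - B (\<lambda>A. y A - s n A) x = cnj (B x (s n))" for n
    using B_diff_left[OF assms(2) s(2) assms(1) s(3), of n] B_herm0[OF assms(1) s(1), of n] by simp
  ultimately have "(\<lambda>n. cnj (B x (s n))) \<longlonglongrightarrow> B y x" by simp
  moreover have "(\<lambda>n. cnj (B x (s n))) \<longlonglongrightarrow> cnj (B x y)"
    by (intro tendsto_intros s assms)
  ultimately show ?thesis by (rule LIMSEQ_unique)
qed

lemma B_right:
  assumes "x \<in> V" "y \<in> V" "z \<in> V" "(\<lambda>A. a * x A + b * y A) \<in> V"
  shows "B z (\<lambda>A. a * x A + b * y A) = cnj a * B z x + cnj b * B z y"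
  using B_herm[OF assms(4,3)] B_left[OF assms(1-4)] B_herm[OF assms(1,3)] B_herm[OF assms(2,3)] by simp

lemma nrm_scale:
  assumes "x \<in> V"
  shows "nrm (\<lambda>A. c * x A) = cmod c * nrm x"
proof -
  have cx: "(\<lambda>A. c * x A) \<in> V" using V_scale assms by blast
  have "B (\<lambda>A. c * x A) (\<lambda>A. c * x A) = c * B x (\<lambda>A. c * x A)"
    using B_left[of x x "\<lambda>A. c * x A" c 0] cx assms by simp
  also have "B x (\<lambda>A. c * x A) = cnj c * B x x"
    using B_right[of x x x c 0] cx assms by simp
  finally have "B (\<lambda>A. c * x A) (\<lambda>A. c * x A) = of_real ((cmod c * nrm x)\<^sup>2)"
    using B_self[OF assms] complex_norm_square[of c] by (simp add: power_mult_distrib)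
  then show ?thesis using nrm_nonneg[OF assms] unfolding nrm_def[of "\<lambda>A. c * x A"] by simp
qed

section \<open>Functionals of the dual and the dual norm\<close>

lemma ev_lin:
  assumes "F \<in> D" "x \<in> V" "y \<in> V" "(\<lambda>A. a * x A + b * y A) \<in> V"
  shows "F (cls (\<lambda>A. a * x A + b * y A)) = cnj a * F (cls x) + cnj b * F (cls y)"
  using assms unfolding kdual_def by blast

lemma ev_scale: "F \<in> D \<Longrightarrow> x \<in> V \<Longrightarrow> F (cls (\<lambda>A. a * x A)) = cnj a * F (cls x)"
  using ev_lin[of F x x a 0] V_scale by simp

lemma ev_zero: "F \<in> D \<Longrightarrow> F (cls (\<lambda>A. 0)) = 0"
  using ev_scale[of F "\<lambda>A. 0" 0] by simp

lemma ev_diff: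
  assumes "F \<in> D" "x \<in> V" "y \<in> V" "(\<lambda>A. x A - y A) \<in> V"
  shows "F (cls (\<lambda>A. x A - y A)) = F (cls x) - F (cls y)"
  using ev_lin[of F x y 1 "-1"] assms by simp

lemma ev_bounded:
  assumes F: "F \<in> D"
  obtains C where "C \<ge> 0" "\<And>x. x \<in> V \<Longrightarrow> cmod (F (cls x)) \<le> C * nrm x"
proof -
  have "\<forall>x\<in>V. \<forall>e>0. \<exists>d>0. \<forall>y\<in>V.
      kq M k (\<lambda>A. y A - x A) < ereal d \<longrightarrow> cmod (F (cls y) - F (cls x)) < e"
    using F unfolding kdual_def by simp
  from bspec[OF this V_zero, THEN spec, of 1]
  obtain d where d: "d > 0" "\<And>y. y \<in> V \<Longrightarrow> kq M k (\<lambda>A. y A - 0) < ereal d \<Longrightarrow>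
      cmod (F (cls y) - F (cls (\<lambda>A. 0))) < 1"
    by auto
  \<comment> \<open>\<open>kq\<close> is the square of \<open>nrm\<close>, so \<open>d\<close>
    bounds a square; halving the root makes \<open>r\<close> squared strictly less than
    \<open>d\<close>.\<close>
  define r where "r = sqrt d / 2"
  have r: "r > 0" "r\<^sup>2 < d" using d(1) by (auto simp: r_def power_divide)
  have "cmod (F (cls x)) \<le> (1/r) * nrm x" if x: "x \<in> V" for x
  proof (rule field_le_epsilon)
    fix e :: real assume e: "e > 0"
    \<comment> \<open>The summand \<open>r * e\<close> keeps the denominator positive when
      \<open>nrm x\<close> is 0, so null vectors need no separate case; \<open>e\<close> disappears
      at the end.\<close>
    define c where "c = r / (nrm x + r * e)"
    have pos: "nrm x + r * e > 0" using e r x by (simp add: add_nonneg_pos)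
    have c: "c > 0" using pos r by (simp add: c_def)
    have cx: "(\<lambda>A. of_real c * x A) \<in> V" using V_scale x by blast
    have "c * nrm x \<le> r" using pos e r x by (simp add: c_def field_simps)
    then have "(c * nrm x)\<^sup>2 < d" using r(2) power_mono[of "c * nrm x" r 2] c x by fastforce
    then have "kq M k (\<lambda>A. of_real c * x A) < ereal d"
      using kq_V[OF cx] nrm_scale[OF x, of c] c by simp
    then have "cmod (F (cls (\<lambda>A. of_real c * x A))) < 1"
      using d(2)[OF cx] ev_zero[OF F] by simp
    then have "c * cmod (F (cls x)) < 1"
      using ev_scale[OF F x, of c] c by (simp add: norm_mult)
    then have "cmod (F (cls x)) \<le> (nrm x + r * e) / r"
      using pos r by (simp add: c_def field_simps)
    then show "cmod (F (cls x)) \<le> (1/r) * nrm x + e" using r by (simp add: field_simps)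
  qed
  then show ?thesis using that[of "1/r"] r by simp
qed

lemma ball_eq: "{x\<in>V. kq M k x \<le> 1} = {x\<in>V. nrm x \<le> 1}"
  using kq_V nrm_nonneg by (auto simp: one_ereal_def power_le_one_iff)

text \<open>The supremum is taken in the reals and says nothing before the values are known to be
  bounded; continuity at 0 together with scaling provides that bound.\<close>

lemma N_upper:
  assumes F: "F \<in> D" and y: "y \<in> V" "nrm y \<le> 1"
  shows "cmod (F (cls y)) \<le> N F"
proof -
  obtain C where C: "C \<ge> 0" "\<And>x. x \<in> V \<Longrightarrow> cmod (F (cls x)) \<le> C * nrm x" by (rule ev_bounded[OF F], rule that)
  have bdd: "bdd_above ((\<lambda>x. cmod (F (cls x))) ` {x\<in>V. nrm x \<le> 1})"
  proof (rule bdd_aboveI2)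
    fix x assume "x \<in> {x\<in>V. nrm x \<le> 1}"
    then show "cmod (F (cls x)) \<le> C" using C(2)[of x] mult_left_mono[OF _ C(1), of "nrm x" 1] by simp
  qed
  show ?thesis
    unfolding kdual_norm_def ball_eq using y by (intro cSUP_upper[OF _ bdd]) auto
qed

lemma nrm_zero: "nrm (\<lambda>A. 0) = 0" using nrm_scale[OF V_zero, of 0] by simp

lemma N_bound:
  assumes F: "F \<in> D" and x: "x \<in> V"
  shows "cmod (F (cls x)) \<le> N F * nrm x"
proof (cases "nrm x = 0")
  case True
  obtain C where "\<And>x. x \<in> V \<Longrightarrow> cmod (F (cls x)) \<le> C * nrm x" by (rule ev_bounded[OF F], rule that)
  then show ?thesis using True x by fastforce
next
  case False
  then have p: "nrm x > 0" using x by (simp add: less_le)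
  have "cmod (F (cls (\<lambda>A. of_real (1 / nrm x) * x A))) \<le> N F"
    using x p by (intro N_upper[OF F] V_scale) (simp_all only: nrm_scale, simp add: norm_divide)
  then have "cmod (F (cls x)) / nrm x \<le> N F"
    unfolding ev_scale[OF F x] using p by (simp add: norm_mult norm_divide)
  then show ?thesis using p by (simp add: field_simps)
qed

lemma N_least:
  assumes "C \<ge> 0" "\<And>x. x \<in> V \<Longrightarrow> cmod (F (cls x)) \<le> C * nrm x"
  shows "N F \<le> C"
  unfolding kdual_norm_def ball_eq
proof (rule cSUP_least)
  show "{x \<in> V. nrm x \<le> 1} \<noteq> {}" using V_zero nrm_zero by fastforce
  fix x assume "x \<in> {x \<in> V. nrm x \<le> 1}"
  then show "cmod (F (cls x)) \<le> C" using assms(2)[of x] mult_left_mono[OF _ assms(1), of "nrm x" 1] by simp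
qed

lemma N_nonneg: "F \<in> D \<Longrightarrow> N F \<ge> 0"
  using N_upper[of F "\<lambda>A. 0"] nrm_zero ev_zero[of F] by simp

lemma cls_X: "x \<in> V \<Longrightarrow> cls x \<in> X" by (simp add: Mq_def)

text \<open>Continuity compares two points whose difference need not lie in \<open>V\<close> a
  priori. A finite bound on \<open>kq\<close> puts it there, since inadmissible differences have
  \<open>kq\<close> equal to \<infinity>. The quotient by \<open>C + 1\<close> instead of
  \<open>C\<close> allows \<open>C\<close> to be 0.\<close>

lemma D_I:
  assumes ext: "F \<in> extensional X"
    and lin: "\<And>x y a b. x \<in> V \<Longrightarrow> y \<in> V \<Longrightarrow> (\<lambda>A. a * x A + b * y A) \<in> V \<Longrightarrow>
      F (cls (\<lambda>A. a * x A + b * y A)) = cnj a * F (cls x) + cnj b * F (cls y)"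
    and bd: "\<And>x. x \<in> V \<Longrightarrow> cmod (F (cls x)) \<le> C * nrm x" and C: "C \<ge> 0"
  shows "F \<in> D"
proof -
  have "\<exists>d>0. \<forall>y\<in>V. kq M k (\<lambda>A. y A - x A) < ereal d \<longrightarrow> cmod (F (cls y) - F (cls x)) < e"
    if x: "x \<in> V" and e: "e > 0" for x e
  proof (intro exI[of _ "(e / (C + 1))\<^sup>2"] conjI ballI impI)
    have p: "e / (C+1) > 0" using C e by simp
    then show "(e / (C + 1))\<^sup>2 > 0" by (rule zero_less_power)
    fix y assume y: "y \<in> V" and lt: "kq M k (\<lambda>A. y A - x A) < ereal ((e / (C + 1))\<^sup>2)"
    let ?d = "\<lambda>A. y A - x A"
    have "kq M k ?d < \<infinity>" using lt by (rule less_trans) simp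
    then have d: "?d \<in> V" using V_diff x y by blast
    have "(nrm ?d)\<^sup>2 < (e / (C+1))\<^sup>2" using lt kq_V[OF d] by simp
    then have "nrm ?d < e / (C+1)" using p by (meson less_imp_le power2_less_imp_less)
    then have n: "(C+1) * nrm ?d < e" using C by (simp add: field_simps)
    have "cmod (F (cls y) - F (cls x)) = cmod (F (cls ?d))" using lin[of y x 1 "-1"] x y d by simp
    also have "\<dots> \<le> C * nrm ?d" by (rule bd[OF d])
    also have "\<dots> \<le> (C+1) * nrm ?d" using nrm_nonneg[OF d] by (simp add: mult_right_mono)
    finally show "cmod (F (cls y) - F (cls x)) < e" using n by simp
  qed
  then show ?thesis unfolding kdual_def using ext lin by blast
qed

abbreviation R :: "(('a set \<Rightarrow> complex) set \<Rightarrow> complex) \<Rightarrow> ('a set \<Rightarrow> complex) set \<Rightarrow> complex" where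
  "R g \<equiv> restrict g X"

lemma comb_bound:
  assumes "F \<in> D" "G \<in> D" "x \<in> V"
  shows "cmod (a * F (cls x) + b * G (cls x)) \<le> (cmod a * N F + cmod b * N G) * nrm x"
proof -
  have "cmod (a * F (cls x) + b * G (cls x)) \<le> cmod a * cmod (F (cls x)) + cmod b * cmod (G (cls x))"
    by (metis norm_mult norm_triangle_ineq)
  also have "\<dots> \<le> cmod a * (N F * nrm x) + cmod b * (N G * nrm x)"
    by (intro add_mono mult_left_mono N_bound assms norm_ge_zero)
  finally show ?thesis by (simp add: algebra_simps)
qed

lemma D_comb:
  assumes "F \<in> D" "G \<in> D"
  shows "R (\<lambda>c. a * F c + b * G c) \<in> D"
proof (rule D_I[where C = "cmod a * N F + cmod b * N G"])
  show "R (\<lambda>c. a * F c + b * G c) \<in> extensional X" by simp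
  show "cmod a * N F + cmod b * N G \<ge> 0" using N_nonneg assms by simp
qed (use comb_bound assms in \<open>auto simp: cls_X ev_lin algebra_simps\<close>)

lemma N_comb:
  assumes "F \<in> D" "G \<in> D"
  shows "N (R (\<lambda>c. a * F c + b * G c)) \<le> cmod a * N F + cmod b * N G"
  by (rule N_least) (use comb_bound N_nonneg assms in \<open>auto simp: cls_X\<close>)

lemma D_add: "F \<in> D \<Longrightarrow> G \<in> D \<Longrightarrow> R (\<lambda>c. F c + a * G c) \<in> D"
  using D_comb[of F G 1 a] by simp

lemma D_diff: "F \<in> D \<Longrightarrow> G \<in> D \<Longrightarrow> R (\<lambda>c. F c - G c) \<in> D"
  using D_comb[of F G 1 "-1"] by simp

lemma D_scale: "F \<in> D \<Longrightarrow> R (\<lambda>c. a * F c) \<in> D"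
  using D_comb[of F F a 0] by simp

lemma N_scale:
  assumes "F \<in> D"
  shows "N (R (\<lambda>c. a * F c)) = cmod a * N F"
proof (rule antisym)
  show "N (R (\<lambda>c. a * F c)) \<le> cmod a * N F"
    using N_comb[of F F a 0] assms by simp
  show "cmod a * N F \<le> N (R (\<lambda>c. a * F c))"
  proof (cases "a = 0")
    case True then show ?thesis using N_nonneg[OF D_scale[OF assms, of a]] by simp
  next
    case False
    have "N F \<le> N (R (\<lambda>c. a * F c)) / cmod a"
    proof (rule N_least)
      show "0 \<le> N (R (\<lambda>c. a * F c)) / cmod a" using N_nonneg[OF D_scale[OF assms]] by simp
      fix x assume x: "x \<in> V"
      show "cmod (F (cls x)) \<le> N (R (\<lambda>c. a * F c)) / cmod a * nrm x"
        using N_bound[OF D_scale[OF assms, of a] x] False cls_X[OF x] by (simp add: norm_mult field_simps)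
    qed
    then show ?thesis using False by (simp add: field_simps)
  qed
qed

section \<open>The map from measures to functionals is isometric\<close>

lemma cls_rep:
  assumes "x \<in> V"
  shows "(SOME y. y \<in> cls x) \<in> V" "(\<lambda>A. x A - (SOME y. y \<in> cls x) A) \<in> V"
    "nrm (\<lambda>A. x A - (SOME y. y \<in> cls x) A) = 0"
proof -
  let ?y = "SOME y. y \<in> cls x"
  have "x \<in> cls x" using assms kq_V[OF V_zero] nrm_zero by (simp add: kcls_def zero_ereal_def)
  then have "?y \<in> cls x" by (rule someI[of "\<lambda>y. y \<in> cls x"])
  then have *: "?y \<in> V" "kq M k (\<lambda>A. x A - ?y A) = 0" by (auto simp: kcls_def)
  then show "?y \<in> V" by simp
  show d: "(\<lambda>A. x A - ?y A) \<in> V" using V_diff assms * by simp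
  show "nrm (\<lambda>A. x A - ?y A) = 0" using kq_V[OF d] * by simp
qed

text \<open>\<open>Tk\<close> evaluates at a chosen representative of the class. The choice is
  harmless because it differs from \<open>y\<close> by a vector of norm 0, on which
  \<open>B x\<close> vanishes by Cauchy-Schwarz.\<close>

lemma T_ev:
  assumes "x \<in> V" "y \<in> V"
  shows "T x (cls y) = B x y"
proof -
  let ?y = "SOME z. z \<in> cls y"
  have "B x (\<lambda>A. y A - ?y A) = B x y - B x ?y"
    using B_right[of y ?y x 1 "-1"] cls_rep[OF assms(2)] assms by simp
  moreover have "B x (\<lambda>A. y A - ?y A) = 0"
    using B_CS[OF assms(1) cls_rep(2)[OF assms(2)]] cls_rep(3)[OF assms(2)] by simp
  ultimately show ?thesis using cls_X[OF assms(2)] by (simp add: Tk_def)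
qed

lemma T_D: "x \<in> V \<Longrightarrow> T x \<in> D"
  by (rule D_I[where C = "nrm x"]) (simp_all add: T_ev B_right B_CS, simp add: Tk_def)

lemma D_eqI:
  assumes "F \<in> extensional X" "G \<in> extensional X" "\<And>x. x \<in> V \<Longrightarrow> F (cls x) = G (cls x)"
  shows "F = G"
  by (rule extensionalityI[OF assms(1,2)]) (use assms(3) in \<open>auto simp: Mq_def\<close>)

lemma D_ext: "F \<in> D \<Longrightarrow> F \<in> extensional X" by (simp add: kdual_def)

lemma T_comb:
  assumes "x \<in> V" "y \<in> V" "(\<lambda>A. a * x A + b * y A) \<in> V"
  shows "T (\<lambda>A. a * x A + b * y A) = R (\<lambda>c. a * T x c + b * T y c)"
  by (rule D_eqI) (use assms in \<open>auto simp: D_ext T_D T_ev B_left cls_X\<close>)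

text \<open>Cauchy-Schwarz bounds the norm from above; evaluating \<open>T x\<close> at
  \<open>x\<close> itself bounds it from below.\<close>

lemma N_T:
  assumes "x \<in> V"
  shows "N (T x) = nrm x"
proof (rule antisym)
  show "N (T x) \<le> nrm x" by (rule N_least) (use assms in \<open>auto simp: T_ev B_CS\<close>)
  have *: "nrm x * nrm x \<le> N (T x) * nrm x"
    using N_bound[OF T_D[OF assms] assms] T_ev[OF assms assms] B_self[OF assms]
    by (simp add: power2_eq_square norm_mult)
  show "nrm x \<le> N (T x)"
  proof (cases "nrm x = 0")
    case True then show ?thesis using N_nonneg[OF T_D[OF assms]] by simp
  next
    case False then show ?thesis using * nrm_nonneg[OF assms] by (simp add: less_le)
  qed
qed

section \<open>Density of the range of T in the dual norm\<close>

lemma N_least0: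
  assumes F: "F \<in> D" and C: "C \<ge> 0" "\<And>x. x \<in> V0 \<Longrightarrow> cmod (F (cls x)) \<le> C * nrm x"
  shows "N F \<le> C"
proof (rule N_least[OF C(1)])
  fix x assume x: "x \<in> V"
  obtain s where s: "\<And>n. s n \<in> V0" "\<And>n. s n \<in> V" "\<And>n. (\<lambda>A. x A - s n A) \<in> V"
    "(\<lambda>n. nrm (\<lambda>A. x A - s n A)) \<longlonglongrightarrow> 0"
    "\<And>z. z \<in> V \<Longrightarrow> (\<lambda>n. B z (s n)) \<longlonglongrightarrow> B z x"
    "\<And>n. nrm (s n) \<le> nrm x + nrm (\<lambda>A. x A - s n A)"
    by (rule approx[OF x], rule that)
  \<comment> \<open>Split \<open>x\<close> into an approximant, where the hypothesis on
    \<open>V0\<close> applies, and an error, where \<open>N_bound\<close> already holds; the error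
    terms vanish in the limit and leave \<open>C * nrm x\<close>.\<close>
  have "cmod (F (cls x)) \<le> C * (nrm x + nrm (\<lambda>A. x A - s n A)) + N F * nrm (\<lambda>A. x A - s n A)" for n
  proof -
    have "F (cls x) = F (cls (s n)) + F (cls (\<lambda>A. x A - s n A))"
      using ev_diff[OF F x s(2) s(3)] by simp
    then have "cmod (F (cls x)) \<le> cmod (F (cls (s n))) + cmod (F (cls (\<lambda>A. x A - s n A)))"
      by (metis norm_triangle_ineq)
    moreover have "cmod (F (cls (s n))) \<le> C * (nrm x + nrm (\<lambda>A. x A - s n A))"
      using C(2)[OF s(1)[of n]] mult_left_mono[OF s(6)[of n] C(1)] by linarith
    ultimately show ?thesis using N_bound[OF F s(3)[of n]] by linarith
  qed
  moreover have "(\<lambda>n. C * (nrm x + nrm (\<lambda>A. x A - s n A)) + N F * nrm (\<lambda>A. x A - s n A))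
      \<longlonglongrightarrow> C * (nrm x + 0) + N F * 0"
    by (intro tendsto_intros s)
  ultimately show "cmod (F (cls x)) \<le> C * nrm x"
    using LIMSEQ_le_const by (metis (no_types, lifting) add_0_right mult_zero_right)
qed

text \<open>This linearises the square root. With \<open>p\<close> the right-hand side, the squared
  norm is at most \<open>2 * p - 1\<close>, hence at most the square of \<open>p\<close>. The same
  estimate shows that \<open>p\<close> is positive, as taking roots requires.\<close>

lemma nrm_sum_le:
  assumes "x \<in> V0" "y \<in> V0" "nrm x \<le> 1" "nrm y \<le> 1" "t > 0"
  shows "nrm (\<lambda>A. 1 * x A + of_real t * y A) \<le> 1 + t * Re (B x y) + t\<^sup>2 / 2"
proof -
  let ?z = "\<lambda>A. 1 * x A + of_real t * y A"
  have z: "?z \<in> V" using V0_V[OF V0_lin[OF assms(1,2)]] .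
  have xy: "x \<in> V" "y \<in> V" using assms V0_V by auto
  have "B ?z ?z = B x ?z + of_real t * B y ?z"
    using B_left[OF xy z z] by simp
  also have "B x ?z = B x x + of_real t * B x y" using B_right[OF xy xy(1) z] by simp
  also have "B y ?z = B y x + of_real t * B y y" using B_right[OF xy xy(2) z] by simp
  finally have "(nrm ?z)\<^sup>2 = (nrm x)\<^sup>2 + 2 * t * Re (B x y) + t\<^sup>2 * (nrm y)\<^sup>2"
    using B_herm[OF xy] B_self[OF z] B_self[OF xy(1)] B_self[OF xy(2)]
    by (simp add: complex_eq_iff power2_eq_square algebra_simps)
  also have "\<dots> \<le> 1 + 2 * t * Re (B x y) + t\<^sup>2 * 1"
    using assms xy by (intro add_mono mult_left_mono power_le_one) auto
  also have "\<dots> = 2 * (1 + t * Re (B x y) + t\<^sup>2 / 2) - 1" by simp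
  also have "\<dots> \<le> (1 + t * Re (B x y) + t\<^sup>2 / 2)\<^sup>2"
    using zero_le_power2[of "(1 + t * Re (B x y) + t\<^sup>2 / 2) - 1"] by (simp add: power2_eq_square algebra_simps)
  finally have sq: "(nrm ?z)\<^sup>2 \<le> (1 + t * Re (B x y) + t\<^sup>2 / 2)\<^sup>2" .
  have "(nrm ?z)\<^sup>2 \<le> 1 + 2 * t * Re (B x y) + t\<^sup>2" using \<open>(nrm ?z)\<^sup>2 = _\<close> \<open>_ \<le> 1 + 2 * t * Re (B x y) + t\<^sup>2 * 1\<close> by simp
  then have "0 \<le> 1 + 2 * t * Re (B x y) + t\<^sup>2" using zero_le_power2[of "nrm ?z"] by linarith
  then have "0 \<le> 1 + t * Re (B x y) + t\<^sup>2 / 2" by simp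
  then show ?thesis using sq power2_le_imp_le by blast
qed

text \<open>A near-maximiser \<open>x\<close> of \<open>F\<close> on the unit ball makes \<open>N F \<cdot> T x\<close> close to \<open>F\<close>: compare
  \<open>F (x + t y) \<le> N F \<cdot> nrm (x + t y)\<close> to first order in \<open>t\<close>.\<close>
lemma T_dense_step:
  assumes F: "F \<in> D" and t: "t > 0"
  shows "\<exists>x\<in>V0. N (R (\<lambda>c. T x c - F c)) \<le> t * (1 + N F / 2)"
proof -
  let ?L = "N F"
  have L: "?L \<ge> 0" using N_nonneg[OF F] .
  \<comment> \<open>The defect is quadratic in \<open>t\<close> because the first-order comparison
    is later divided by \<open>t\<close>. If no such \<open>x\<close> existed, homogeneity would
    bring the norm of \<open>F\<close> down to \<open>?L - t\<^sup>2\<close>.\<close>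
  have "\<exists>x\<in>V0. nrm x \<le> 1 \<and> cmod (F (cls x)) \<ge> ?L - t\<^sup>2"
  proof (rule ccontr)
    assume "\<not> ?thesis"
    then have lt: "\<And>x. x \<in> V0 \<Longrightarrow> nrm x \<le> 1 \<Longrightarrow> cmod (F (cls x)) < ?L - t\<^sup>2" by force
    have pos: "0 < ?L - t\<^sup>2" using lt[OF V0_zero] ev_zero[OF F] nrm_zero by simp
    have "?L \<le> ?L - t\<^sup>2"
    proof (rule N_least0[OF F])
      fix x assume x: "x \<in> V0"
      show "cmod (F (cls x)) \<le> (?L - t\<^sup>2) * nrm x"
      proof (cases "nrm x = 0")
        case True then show ?thesis using N_bound[OF F V0_V[OF x]] by simp
      next
        case False
        then have p: "nrm x > 0" using V0_V[OF x] by (simp add: less_le)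
        have xs: "(\<lambda>A. of_real (1 / nrm x) * x A) \<in> V0" using V0_lin[OF x x, of "of_real (1 / nrm x)" 0] by simp
        have "cmod (F (cls (\<lambda>A. of_real (1 / nrm x) * x A))) \<le> ?L - t\<^sup>2"
          using p by (intro less_imp_le[OF lt] xs) (simp only: nrm_scale[OF V0_V[OF x]], simp add: norm_divide)
        then have "cmod (F (cls x)) / nrm x \<le> ?L - t\<^sup>2"
          unfolding ev_scale[OF F V0_V[OF x]] using p by (simp add: norm_mult norm_divide)
        then show ?thesis using p by (simp add: field_simps)
      qed
    qed (use pos in simp)
    then show False using t by simp
  qed
  then obtain x' where x': "x' \<in> V0" "nrm x' \<le> 1" "cmod (F (cls x')) \<ge> ?L - t\<^sup>2" by blast
  \<comment> \<open>A unimodular rotation makes the value real and nonnegative. As \<open>F\<close>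
    is antilinear, \<open>u\<close> enters conjugated, so the sign itself is taken and not its
    conjugate.\<close>
  define u where "u = (if F (cls x') = 0 then 1 else sgn (F (cls x')))"
  have u: "cmod u = 1" by (simp add: u_def norm_sgn)
  define x where "x = (\<lambda>A. u * x' A)"
  have x0: "x \<in> V0" using V0_lin[OF x'(1) x'(1), of u 0] by (simp add: x_def)
  have xV: "x \<in> V" using V0_V[OF x0] .
  have xn: "nrm x \<le> 1" using nrm_scale[OF V0_V[OF x'(1)], of u] u x'(2) by (simp add: x_def)
  have "F (cls x) = of_real (cmod (F (cls x')))"
    unfolding x_def ev_scale[OF F V0_V[OF x'(1)]] u_def
    by (auto simp: sgn_eq complex_norm_square[symmetric] mult.commute power2_eq_square)
  then have Fx: "Re (F (cls x)) \<ge> ?L - t\<^sup>2" using x'(3) by simp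
  have key: "Re (F (cls y) - of_real ?L * B x y) \<le> t * (1 + ?L / 2)" if y: "y \<in> V0" "nrm y \<le> 1" for y
  proof -
    let ?z = "\<lambda>A. 1 * x A + of_real t * y A"
    have z: "?z \<in> V" using V0_V[OF V0_lin[OF x0 y(1)]] .
    have "F (cls ?z) = F (cls x) + of_real t * F (cls y)"
      using ev_lin[OF F xV V0_V[OF y(1)] z] by simp
    then have "Re (F (cls x)) + t * Re (F (cls y)) = Re (F (cls ?z))" by simp
    also have "\<dots> \<le> cmod (F (cls ?z))" by (rule complex_Re_le_cmod)
    also have "\<dots> \<le> ?L * nrm ?z" by (rule N_bound[OF F z])
    also have "\<dots> \<le> ?L * (1 + t * Re (B x y) + t\<^sup>2 / 2)"
      by (intro mult_left_mono nrm_sum_le x0 y xn t L)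
    finally have "t * Re (F (cls y) - of_real ?L * B x y) \<le> t * (t * (1 + ?L / 2))"
      using Fx by (simp add: algebra_simps power2_eq_square)
    then show ?thesis using t by simp
  qed
  define z where "z = (\<lambda>A. of_real ?L * x A)"
  have z0: "z \<in> V0" using V0_lin[OF x0 x0, of "of_real ?L" 0] by (simp add: z_def)
  have Tz: "T z (cls y) = of_real ?L * B x y" if "y \<in> V" for y
    using T_ev[OF V0_V[OF z0] that] B_left[OF xV xV that, of "of_real ?L" 0] V0_V[OF z0] by (simp add: z_def)
  let ?G = "R (\<lambda>c. T z c - F c)"
  have GD: "?G \<in> D" by (intro D_diff T_D V0_V z0 F)
  have G1: "cmod (?G (cls y)) \<le> t * (1 + ?L / 2)" if y: "y \<in> V0" "nrm y \<le> 1" for y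
  proof -
    have yV: "y \<in> V" using V0_V y by blast
    define w where "w = F (cls y) - of_real ?L * B x y"
    \<comment> \<open>Rotating \<open>y\<close> in the same way upgrades the bound on real parts in
      \<open>key\<close> to a bound on the modulus.\<close>
    define v where "v = (if w = 0 then 1 else sgn w)"
    have v: "cmod v = 1" by (simp add: v_def norm_sgn)
    have vy: "(\<lambda>A. v * y A) \<in> V0" using V0_lin[OF y(1) y(1), of v 0] by simp
    have "F (cls (\<lambda>A. v * y A)) - of_real ?L * B x (\<lambda>A. v * y A) = cnj v * w"
      using ev_scale[OF F yV, of v] B_right[OF yV yV xV, of v 0] V0_V[OF vy] by (simp add: w_def algebra_simps)
    also have "\<dots> = of_real (cmod w)"
      by (auto simp: v_def sgn_eq complex_norm_square[symmetric] mult.commute power2_eq_square)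
    finally have "cmod w \<le> t * (1 + ?L / 2)"
      using key[OF vy] nrm_scale[OF yV, of v] v y by simp
    then show ?thesis using Tz[OF yV] cls_X[OF yV] by (simp add: w_def norm_minus_commute)
  qed
  have "N ?G \<le> t * (1 + ?L / 2)"
  proof (rule N_least0[OF GD])
    show "0 \<le> t * (1 + ?L / 2)" using t L by simp
    fix x assume x: "x \<in> V0"
    show "cmod (?G (cls x)) \<le> t * (1 + ?L / 2) * nrm x"
    proof (cases "nrm x = 0")
      case True then show ?thesis using N_bound[OF GD V0_V[OF x]] by simp
    next
      case False
      then have p: "nrm x > 0" using V0_V[OF x] by (simp add: less_le)
      have xs: "(\<lambda>A. of_real (1 / nrm x) * x A) \<in> V0" using V0_lin[OF x x, of "of_real (1 / nrm x)" 0] by simp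
      have "cmod (?G (cls (\<lambda>A. of_real (1 / nrm x) * x A))) \<le> t * (1 + ?L / 2)"
        using p by (intro G1 xs) (simp only: nrm_scale[OF V0_V[OF x]], simp add: norm_divide)
      then have "cmod (?G (cls x)) / nrm x \<le> t * (1 + ?L / 2)"
        unfolding ev_scale[OF GD V0_V[OF x]] using p by (simp add: norm_mult norm_divide)
      then show ?thesis using p by (simp add: field_simps)
    qed
  qed
  then show ?thesis using z0 by blast
qed

lemma T_dense:
  assumes F: "F \<in> D"
  obtains s :: "nat \<Rightarrow> 'a set \<Rightarrow> complex" where "\<And>n. s n \<in> V0" "\<And>n. s n \<in> V"
    "(\<lambda>n. N (R (\<lambda>c. T (s n) c - F c))) \<longlonglongrightarrow> 0"
proof -
  have "\<exists>x\<in>V0. N (R (\<lambda>c. T x c - F c)) \<le> inverse (real (Suc n)) * (1 + N F / 2)" for n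
    by (rule T_dense_step[OF F]) simp
  then obtain s where s: "\<And>n. s n \<in> V0"
    "\<And>n. N (R (\<lambda>c. T (s n) c - F c)) \<le> inverse (real (Suc n)) * (1 + N F / 2)" by metis
  have "(\<lambda>n. N (R (\<lambda>c. T (s n) c - F c))) \<longlonglongrightarrow> 0"
  proof (rule Lim_null_comparison)
    show "\<forall>\<^sub>F n in sequentially. norm (N (R (\<lambda>c. T (s n) c - F c))) \<le> inverse (real (Suc n)) * (1 + N F / 2)"
      using s(2) N_nonneg[OF D_diff[OF T_D[OF V0_V[OF s(1)]] F]] by simp
    show "(\<lambda>n. inverse (real (Suc n)) * (1 + N F / 2)) \<longlonglongrightarrow> 0"
      using tendsto_mult_right[OF LIMSEQ_inverse_real_of_nat, of "1 + N F / 2"] by simp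
  qed
  then show ?thesis using that s V0_V by blast
qed

text \<open>Reverse triangle inequality; it makes every norm in the polarisation formula continuous,
  and with them the inner product.\<close>

lemma N_lipschitz:
  assumes "F \<in> D" "G \<in> D"
  shows "\<bar>N F - N G\<bar> \<le> N (R (\<lambda>c. F c - G c))"
proof -
  have d: "R (\<lambda>c. F c - G c) \<in> D" using D_diff assms by blast
  have 1: "R (\<lambda>c. 1 * G c + 1 * R (\<lambda>c. F c - G c) c) = F"
    by (rule D_eqI) (use assms in \<open>auto simp: D_ext cls_X\<close>)
  have 2: "R (\<lambda>c. 1 * F c + (-1) * R (\<lambda>c. F c - G c) c) = G"
    by (rule D_eqI) (use assms in \<open>auto simp: D_ext cls_X\<close>)
  show ?thesis using N_comb[OF assms(2) d, of 1 1] N_comb[OF assms(1) d, of 1 "-1"]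
    unfolding 1 2 by simp
qed

lemma tendsto_N_comb:
  fixes f g :: "nat \<Rightarrow> ('a set \<Rightarrow> complex) set \<Rightarrow> complex"
  assumes f: "\<And>n. f n \<in> D" "F \<in> D" "(\<lambda>n. N (R (\<lambda>c. f n c - F c))) \<longlonglongrightarrow> 0"
    and g: "\<And>n. g n \<in> D" "G \<in> D" "(\<lambda>n. N (R (\<lambda>c. g n c - G c))) \<longlonglongrightarrow> 0"
  shows "(\<lambda>n. N (R (\<lambda>c. f n c + a * g n c))) \<longlonglongrightarrow> N (R (\<lambda>c. F c + a * G c))"
proof (rule LIM_zero_cancel, rule Lim_null_comparison)
  show "\<forall>\<^sub>F n in sequentially. norm (N (R (\<lambda>c. f n c + a * g n c)) - N (R (\<lambda>c. F c + a * G c)))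
      \<le> N (R (\<lambda>c. f n c - F c)) + cmod a * N (R (\<lambda>c. g n c - G c))"
  proof (intro always_eventually allI)
    fix n
    have "R (\<lambda>c. R (\<lambda>c. f n c + a * g n c) c - R (\<lambda>c. F c + a * G c) c) =
        R (\<lambda>c. 1 * R (\<lambda>c. f n c - F c) c + a * R (\<lambda>c. g n c - G c) c)"
      by (rule D_eqI) (auto simp: cls_X algebra_simps)
    then have "norm (N (R (\<lambda>c. f n c + a * g n c)) - N (R (\<lambda>c. F c + a * G c)))
      \<le> N (R (\<lambda>c. 1 * R (\<lambda>c. f n c - F c) c + a * R (\<lambda>c. g n c - G c) c))"
      using N_lipschitz[OF D_add[OF f(1)[of n] g(1)[of n], of a] D_add[OF f(2) g(2), of a]] by simp
    also have "\<dots> \<le> cmod 1 * N (R (\<lambda>c. f n c - F c)) + cmod a * N (R (\<lambda>c. g n c - G c))"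
      by (intro N_comb D_diff f g)
    finally show "norm (N (R (\<lambda>c. f n c + a * g n c)) - N (R (\<lambda>c. F c + a * G c)))
      \<le> N (R (\<lambda>c. f n c - F c)) + cmod a * N (R (\<lambda>c. g n c - G c))" by simp
  qed
  show "(\<lambda>n. N (R (\<lambda>c. f n c - F c)) + cmod a * N (R (\<lambda>c. g n c - G c))) \<longlonglongrightarrow> 0"
    using tendsto_add[OF f(3) tendsto_mult_left[OF g(3), of "cmod a"]] by simp
qed

section \<open>The inner product of the dual\<close>

abbreviation "ip \<equiv> kdual_ip M k"

lemma ip_expand:
  "ip F G = (of_real ((N (R (\<lambda>c. F c + G c)))\<^sup>2) + \<i> * of_real ((N (R (\<lambda>c. F c + \<i> * G c)))\<^sup>2)
     - of_real ((N (R (\<lambda>c. F c + (-1) * G c)))\<^sup>2) - \<i> * of_real ((N (R (\<lambda>c. F c + (-\<i>) * G c)))\<^sup>2)) / 4"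
proof -
  have "{..<4::nat} = {0,1,2,3}" by auto
  then show ?thesis by (simp add: kdual_ip_def power3_eq_cube power2_eq_square)
qed

lemma tendsto_ip:
  fixes f g :: "nat \<Rightarrow> ('a set \<Rightarrow> complex) set \<Rightarrow> complex"
  assumes f: "\<And>n. f n \<in> D" "F \<in> D" "(\<lambda>n. N (R (\<lambda>c. f n c - F c))) \<longlonglongrightarrow> 0"
    and g: "\<And>n. g n \<in> D" "G \<in> D" "(\<lambda>n. N (R (\<lambda>c. g n c - G c))) \<longlonglongrightarrow> 0"
  shows "(\<lambda>n. ip (f n) (g n)) \<longlonglongrightarrow> ip F G"
  unfolding kdual_ip_def by (intro tendsto_intros tendsto_N_comb f g) simp

lemma N_zero_diff: "F \<in> D \<Longrightarrow> N (R (\<lambda>c. F c - F c)) = 0"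
  using N_scale[of F 0] by simp

text \<open>On \<open>V0\<close> all combinations are admissible, so the isometry turns each squared
  norm in the polarisation formula into the expanded quadratic form, and the four terms leave
  \<open>B x y\<close>.\<close>

lemma ip_T_T:
  assumes "x \<in> V0" "y \<in> V0"
  shows "ip (T x) (T y) = B x y"
proof -
  have xy: "x \<in> V" "y \<in> V" using assms V0_V by auto
  have *: "of_real ((N (R (\<lambda>c. T x c + a * T y c)))\<^sup>2) = B x x + cnj a * B x y + a * cnj (B x y) + a * cnj a * B y y" for a
  proof -
    let ?z = "\<lambda>A. 1 * x A + a * y A"
    have z: "?z \<in> V" using V0_V[OF V0_lin[OF assms]] .
    have "R (\<lambda>c. T x c + a * T y c) = T ?z" using T_comb[OF xy z] by simp
    then have "of_real ((N (R (\<lambda>c. T x c + a * T y c)))\<^sup>2) = B ?z ?z" using N_T[OF z] B_self[OF z] by simp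
    also have "\<dots> = B x ?z + a * B y ?z" using B_left[OF xy z z] by simp
    also have "B x ?z = B x x + cnj a * B x y" using B_right[OF xy xy(1) z] by simp
    also have "B y ?z = B y x + cnj a * B y y" using B_right[OF xy xy(2) z] by simp
    finally have "of_real ((N (R (\<lambda>c. T x c + a * T y c)))\<^sup>2) = B x x + cnj a * B x y + a * (B y x + cnj a * B y y)" .
    also have "\<dots> = B x x + cnj a * B x y + a * cnj (B x y) + a * cnj a * B y y"
      unfolding B_herm[OF xy] by (simp add: algebra_simps)
    finally show ?thesis .
  qed
  show ?thesis unfolding ip_expand *[of 1, unfolded mult_1] *[of \<i>] *[of "-1"] *[of "-\<i>"]
    by (simp add: algebra_simps)
qed

lemma ev_tendsto:
  fixes f :: "nat \<Rightarrow> ('a set \<Rightarrow> complex) set \<Rightarrow> complex"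
  assumes f: "\<And>n. f n \<in> D" "F \<in> D" "(\<lambda>n. N (R (\<lambda>c. f n c - F c))) \<longlonglongrightarrow> 0" and x: "x \<in> V"
  shows "(\<lambda>n. f n (cls x)) \<longlonglongrightarrow> F (cls x)"
proof (rule LIM_zero_cancel, rule Lim_null_comparison)
  show "\<forall>\<^sub>F n in sequentially. norm (f n (cls x) - F (cls x)) \<le> N (R (\<lambda>c. f n c - F c)) * nrm x"
    using N_bound[OF D_diff[OF f(1) f(2)] x] cls_X[OF x] by simp
  show "(\<lambda>n. N (R (\<lambda>c. f n c - F c)) * nrm x) \<longlonglongrightarrow> 0"
    using tendsto_mult_right[OF f(3), of "nrm x"] by simp
qed

text \<open>Approximate \<open>F\<close> by functionals \<open>T (s n)\<close>, for which the
  identity is already known; both sides are continuous in the dual norm.\<close>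

lemma ip_T0:
  assumes F: "F \<in> D" and x: "x \<in> V0"
  shows "ip F (T x) = F (cls x)"
proof -
  obtain s where s: "\<And>n. s n \<in> V0" "\<And>n. s n \<in> V" "(\<lambda>n. N (R (\<lambda>c. T (s n) c - F c))) \<longlonglongrightarrow> 0"
    by (rule T_dense[OF F], rule that)
  have "(\<lambda>n. ip (T (s n)) (T x)) \<longlonglongrightarrow> ip F (T x)"
    by (rule tendsto_ip) (use T_D s F V0_V[OF x] N_zero_diff in auto)
  moreover have "(\<lambda>n. T (s n) (cls x)) \<longlonglongrightarrow> F (cls x)"
    by (rule ev_tendsto) (use T_D s F V0_V[OF x] in auto)
  moreover have "ip (T (s n)) (T x) = T (s n) (cls x)" for n
    using ip_T_T[OF s(1) x] T_ev[OF s(2) V0_V[OF x]] by simp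
  ultimately show ?thesis using LIMSEQ_unique by force
qed

text \<open>The right argument is approximated from the range of \<open>T\<close>, which expresses
  the polarised form as a limit of evaluations of \<open>F\<close>. This is what makes linearity in
  \<open>F\<close> visible.\<close>

lemma ip_tendsto:
  fixes s :: "nat \<Rightarrow> 'a set \<Rightarrow> complex"
  assumes F: "F \<in> D" and G: "G \<in> D"
    and s: "\<And>n. s n \<in> V0" "(\<lambda>n. N (R (\<lambda>c. T (s n) c - G c))) \<longlonglongrightarrow> 0"
  shows "(\<lambda>n. F (cls (s n))) \<longlonglongrightarrow> ip F G"
proof -
  have "(\<lambda>n. ip F (T (s n))) \<longlonglongrightarrow> ip F G"
    by (rule tendsto_ip) (use T_D V0_V s F G N_zero_diff in auto)
  then show ?thesis using ip_T0[OF F s(1)] by simp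
qed

text \<open>The approximants of \<open>x\<close> satisfy \<open>N (R (\<lambda>c. T (s n) c - T x
  c)) = nrm (\<lambda>A. x A - s n A)\<close>, so they can serve in \<open>ip_tendsto\<close>; their
  evaluations also converge to \<open>F (cls x)\<close> because \<open>F\<close> is bounded.\<close>

lemma ip_T:
  assumes F: "F \<in> D" and x: "x \<in> V"
  shows "ip F (T x) = F (cls x)"
proof -
  obtain s where s: "\<And>n. s n \<in> V0" "\<And>n. s n \<in> V" "\<And>n. (\<lambda>A. x A - s n A) \<in> V"
    "(\<lambda>n. nrm (\<lambda>A. x A - s n A)) \<longlonglongrightarrow> 0"
    "\<And>z. z \<in> V \<Longrightarrow> (\<lambda>n. B z (s n)) \<longlonglongrightarrow> B z x"
    "\<And>n. nrm (s n) \<le> nrm x + nrm (\<lambda>A. x A - s n A)"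
    by (rule approx[OF x], rule that)
  have "N (R (\<lambda>c. T (s n) c - T x c)) = nrm (\<lambda>A. x A - s n A)" for n
  proof -
    have "R (\<lambda>c. T (s n) c - T x c) = R (\<lambda>c. (-1) * T (\<lambda>A. x A - s n A) c)"
      by (rule D_eqI) (use x s in \<open>auto simp: cls_X T_ev B_diff_left\<close>)
    then show ?thesis using N_scale[OF T_D[OF s(3)[of n]], of "-1"] N_T[OF s(3)[of n]] by simp
  qed
  then have "(\<lambda>n. F (cls (s n))) \<longlonglongrightarrow> ip F (T x)"
    using ip_tendsto[OF F T_D[OF x] s(1)] s(4) by simp
  moreover have "(\<lambda>n. F (cls (s n))) \<longlonglongrightarrow> F (cls x)"
  proof (rule LIM_zero_cancel, rule Lim_null_comparison)
    show "\<forall>\<^sub>F n in sequentially. norm (F (cls (s n)) - F (cls x)) \<le> N F * nrm (\<lambda>A. x A - s n A)"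
      using N_bound[OF F s(3)] ev_diff[OF F x s(2) s(3)] by (simp add: norm_minus_commute)
    show "(\<lambda>n. N F * nrm (\<lambda>A. x A - s n A)) \<longlonglongrightarrow> 0"
      using tendsto_mult_left[OF s(4), of "N F"] by simp
  qed
  ultimately show ?thesis by (rule LIMSEQ_unique)
qed

text \<open>Takes the place of a parallelogram-law argument: one sequence computes all three inner
  products, and evaluation at its terms is linear in the functional.\<close>

lemma ip_comb_left:
  assumes F: "F \<in> D" and G: "G \<in> D" and H: "H \<in> D"
  shows "ip (R (\<lambda>c. a * F c + b * G c)) H = a * ip F H + b * ip G H"
proof -
  obtain s where s: "\<And>n. s n \<in> V0" "\<And>n. s n \<in> V" "(\<lambda>n. N (R (\<lambda>c. T (s n) c - H c))) \<longlonglongrightarrow> 0"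
    by (rule T_dense[OF H], rule that)
  have "(\<lambda>n. R (\<lambda>c. a * F c + b * G c) (cls (s n))) \<longlonglongrightarrow> ip (R (\<lambda>c. a * F c + b * G c)) H"
    by (rule ip_tendsto[OF D_comb[OF F G] H s(1) s(3)])
  moreover have "(\<lambda>n. R (\<lambda>c. a * F c + b * G c) (cls (s n))) \<longlonglongrightarrow> a * ip F H + b * ip G H"
    using cls_X[OF s(2)] by (simp, intro tendsto_intros ip_tendsto F G H s)
  ultimately show ?thesis by (rule LIMSEQ_unique)
qed

text \<open>Multiplying by a unimodular scalar preserves the dual norm. Exchanging the arguments of
  \<open>ip\<close> thus only permutes the polarisation terms, swapping those of \<i> and -\<i>,
  which conjugates the sum.\<close>

lemma N_rotate:
  assumes "F \<in> D" "G \<in> D" "cmod a = 1"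
  shows "N (R (\<lambda>c. G c + a * F c)) = N (R (\<lambda>c. F c + cnj a * G c))"
proof -
  have "a * cnj a = 1" using assms(3) by (simp add: complex_norm_square[symmetric])
  then have "R (\<lambda>c. G c + a * F c) = R (\<lambda>c. a * R (\<lambda>c. F c + cnj a * G c) c)"
    by (intro D_eqI) (auto simp: cls_X distrib_left mult.assoc[symmetric])
  then show ?thesis using N_scale[OF D_add[OF assms(1,2), of "cnj a"], of a] assms(3) by simp
qed

lemma ip_herm:
  assumes "F \<in> D" "G \<in> D"
  shows "ip G F = cnj (ip F G)"
  using N_rotate[OF assms, of 1] N_rotate[OF assms, of \<i>] N_rotate[OF assms, of "-1"] N_rotate[OF assms, of "-\<i>"]
  unfolding ip_expand by simp

lemma ip_self:
  assumes "F \<in> D"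
  shows "ip F F = of_real ((N F)\<^sup>2)"
proof -
  have *: "N (R (\<lambda>c. F c + a * F c)) = cmod (1 + a) * N F" for a
    using N_scale[OF assms, of "1 + a"] by (simp add: algebra_simps)
  have "cmod (1 + \<i>) = cmod (1 - \<i>)" by (simp add: cmod_def)
  then show ?thesis unfolding ip_expand using *[of 1] *[of \<i>] *[of "-1"] *[of "-\<i>"]
    by (simp add: power_mult_distrib)
qed

section \<open>Completeness, Hilbert space axioms and reproducing property\<close>

lemma dual_complete:
  fixes u :: "nat \<Rightarrow> ('a set \<Rightarrow> complex) set \<Rightarrow> complex"
  assumes u: "\<And>n. u n \<in> D"
    and cau: "\<And>e. e > 0 \<Longrightarrow> \<exists>n0. \<forall>m\<ge>n0. \<forall>n\<ge>n0. N (R (\<lambda>c. u m c - u n c)) < e"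
  shows "\<exists>g\<in>D. (\<lambda>n. N (R (\<lambda>c. u n c - g c))) \<longlonglongrightarrow> 0"
proof -
  have diff: "cmod (u m (cls x) - u n (cls x)) \<le> N (R (\<lambda>c. u m c - u n c)) * nrm x" if "x \<in> V" for m n x
    using N_bound[OF D_diff[OF u[of m] u[of n]] that] cls_X[OF that] by simp
  have "Cauchy (\<lambda>n. u n (cls x))" if x: "x \<in> V" for x
  proof (rule CauchyI)
    fix e :: real assume e: "e > 0"
    have p: "e / (nrm x + 1) > 0" using e nrm_nonneg[OF x] by simp
    obtain n0 where n0: "\<forall>m\<ge>n0. \<forall>n\<ge>n0. N (R (\<lambda>c. u m c - u n c)) < e / (nrm x + 1)" using cau[OF p] by blast
    have "cmod (u m (cls x) - u n (cls x)) < e" if mn: "m \<ge> n0" "n \<ge> n0" for m n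
    proof -
      have "cmod (u m (cls x) - u n (cls x)) \<le> e / (nrm x + 1) * nrm x"
        using diff[OF x, of m n] n0 mn mult_right_mono[OF less_imp_le nrm_nonneg[OF x]] by (meson order_trans)
      also have "\<dots> < e / (nrm x + 1) * (nrm x + 1)" using p by (intro mult_strict_left_mono) auto
      also have "\<dots> = e" using nrm_nonneg[OF x] by (simp add: field_simps)
      finally show ?thesis .
    qed
    then show "\<exists>M. \<forall>m\<ge>M. \<forall>n\<ge>M. cmod (u m (cls x) - u n (cls x)) < e" by blast
  qed
  then have conv: "convergent (\<lambda>n. u n (cls x))" if "x \<in> V" for x
    using that Cauchy_convergent by blast
  \<comment> \<open>The candidate is the pointwise limit on classes. Restricting to \<open>X\<close>
    keeps it extensional, and the Cauchy estimates, being uniform up to the factor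
    \<open>nrm x\<close>, make it bounded and a limit in norm.\<close>
  define g where "g = R (\<lambda>c. lim (\<lambda>n. u n c))"
  have lim: "(\<lambda>n. u n (cls x)) \<longlonglongrightarrow> g (cls x)" if "x \<in> V" for x
    using conv[OF that] cls_X[OF that] by (simp add: g_def convergent_LIMSEQ_iff)
  have close: "cmod (u m (cls x) - g (cls x)) \<le> e * nrm x"
    if x: "x \<in> V" and m: "\<forall>n\<ge>m. N (R (\<lambda>c. u m c - u n c)) < e" for m x e
  proof (rule LIMSEQ_le_const2)
    show "(\<lambda>n. cmod (u m (cls x) - u n (cls x))) \<longlonglongrightarrow> cmod (u m (cls x) - g (cls x))"
      by (intro tendsto_intros lim x)
    show "\<exists>N. \<forall>n\<ge>N. cmod (u m (cls x) - u n (cls x)) \<le> e * nrm x"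
    proof (intro exI[of _ m] allI impI)
      fix n assume "m \<le> n"
      then show "cmod (u m (cls x) - u n (cls x)) \<le> e * nrm x"
        using diff[OF x, of m n] m mult_right_mono[OF less_imp_le nrm_nonneg[OF x]] by (meson order_trans)
    qed
  qed
  obtain m where m: "\<forall>n\<ge>m. N (R (\<lambda>c. u m c - u n c)) < 1" using cau[of 1] by auto
  have gD: "g \<in> D"
  proof (rule D_I[where C = "N (u m) + 1"])
    show "g \<in> extensional X" by (simp add: g_def)
    show "0 \<le> N (u m) + 1" using N_nonneg[OF u] by (simp add: add_nonneg_nonneg)
    show "g (cls (\<lambda>A. a * x A + b * y A)) = cnj a * g (cls x) + cnj b * g (cls y)"
      if xy: "x \<in> V" "y \<in> V" "(\<lambda>A. a * x A + b * y A) \<in> V" for x y a b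
    proof (rule LIMSEQ_unique[OF lim[OF xy(3)]])
      show "(\<lambda>n. u n (cls (\<lambda>A. a * x A + b * y A))) \<longlonglongrightarrow> cnj a * g (cls x) + cnj b * g (cls y)"
        unfolding ev_lin[OF u xy] by (intro tendsto_intros lim xy)
    qed
    show "cmod (g (cls x)) \<le> (N (u m) + 1) * nrm x" if x: "x \<in> V" for x
    proof -
      have "cmod (g (cls x)) \<le> cmod (u m (cls x)) + cmod (u m (cls x) - g (cls x))"
        by (metis add_diff_cancel_left' diff_add_cancel norm_minus_commute norm_triangle_sub add.commute)
      also have "\<dots> \<le> N (u m) * nrm x + 1 * nrm x"
        by (intro add_mono N_bound u x close m)
      finally show ?thesis by (simp add: algebra_simps)
    qed
  qed
  moreover have "(\<lambda>n. N (R (\<lambda>c. u n c - g c))) \<longlonglongrightarrow> 0"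
  proof (rule LIMSEQ_I)
    fix e :: real assume e: "e > 0"
    obtain n0 where n0: "\<forall>m\<ge>n0. \<forall>n\<ge>n0. N (R (\<lambda>c. u m c - u n c)) < e / 2" using cau[of "e/2"] e by auto
    have "norm (N (R (\<lambda>c. u n c - g c)) - 0) < e" if n: "n \<ge> n0" for n
    proof -
      have "N (R (\<lambda>c. u n c - g c)) \<le> e / 2"
        by (rule N_least) (use e close[of _ n "e/2"] n0 n cls_X in auto)
      then show ?thesis using e N_nonneg[OF D_diff[OF u[of n] gD]] by simp
    qed
    then show "\<exists>no. \<forall>n\<ge>no. norm (N (R (\<lambda>c. u n c - g c)) - 0) < e" by blast
  qed
  ultimately show ?thesis by blast
qed

lemma N_eq_0:
  assumes "F \<in> D" "N F = 0"
  shows "F = R (\<lambda>_. 0)"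
  by (rule D_eqI) (use N_bound[OF assms(1)] assms in \<open>auto simp: D_ext cls_X\<close>)

lemma N_ip: "F \<in> D \<Longrightarrow> N F = sqrt (Re (ip F F))"
  using ip_self N_nonneg by simp

lemma dual_hilbert: "hilbert_fun_space X D ip"
  unfolding hilbert_fun_space_def
proof (intro conjI ballI allI impI)
  show "D \<subseteq> extensional X" using D_ext by blast
  show "R (\<lambda>_. 0) \<in> D" by (rule D_I[where C = 0]) (auto simp: cls_X)
  show "R (\<lambda>x. f x + g x) \<in> D" if "f \<in> D" "g \<in> D" for f g using D_add[OF that, of 1] by simp
  show "R (\<lambda>x. c * f x) \<in> D" if "f \<in> D" for f c using D_scale[OF that] .
  show "ip (R (\<lambda>x. f x + g x)) h = ip f h + ip g h" if "f \<in> D" "g \<in> D" "h \<in> D" for f g h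
    using ip_comb_left[OF that, of 1 1] by simp
  show "ip (R (\<lambda>x. c * f x)) g = c * ip f g" if "f \<in> D" "g \<in> D" for c f g
    using ip_comb_left[OF that(1) that(1) that(2), of c 0] by simp
  show "ip g f = cnj (ip f g)" if "f \<in> D" "g \<in> D" for f g using ip_herm[OF that] .
  show "Re (ip f f) \<ge> 0" if "f \<in> D" for f using ip_self[OF that] by simp
  show "f = R (\<lambda>_. 0)" if "f \<in> D" "ip f f = 0" for f using N_eq_0 ip_self[OF that(1)] that by simp
  fix u :: "nat \<Rightarrow> ('a set \<Rightarrow> complex) set \<Rightarrow> complex"
  assume u: "\<forall>n. u n \<in> D" and cau: "\<forall>e>0. \<exists>N. \<forall>m\<ge>N. \<forall>n\<ge>N.
    sqrt (Re (ip (R (\<lambda>x. u m x - u n x)) (R (\<lambda>x. u m x - u n x)))) < e"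
  have *: "sqrt (Re (ip (R (\<lambda>x. u m x - g x)) (R (\<lambda>x. u m x - g x)))) = N (R (\<lambda>x. u m x - g x))"
    if "g \<in> D" for g m using N_ip[OF D_diff[OF _ that]] u by simp
  obtain g where g: "g \<in> D" "(\<lambda>n. N (R (\<lambda>c. u n c - g c))) \<longlonglongrightarrow> 0"
    using dual_complete[of u] u cau * by auto
  then show "\<exists>g\<in>D. (\<lambda>n. sqrt (Re (ip (R (\<lambda>x. u n x - g x)) (R (\<lambda>x. u n x - g x))))) \<longlonglongrightarrow> 0"
    using * by auto
qed

lemma dual_reproducing: "reproducing_kernel X D ip (kK M k)"
  unfolding reproducing_kernel_def
proof
  fix y assume "y \<in> X"
  then obtain x where x: "x \<in> V" "y = cls x" by (auto simp: Mq_def)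
  let ?x = "SOME \<mu>. \<mu> \<in> cls x"
  note xr = cls_rep[OF x(1)]
  \<comment> \<open>The kernel picks representatives in both variables. Evaluating \<open>T\<close>
    through representatives identifies its section with a single functional, whatever the choice in
    the second variable.\<close>
  have eq: "R (kK M k y) = T ?x"
  proof (rule D_eqI)
    fix z assume z: "z \<in> V"
    let ?z = "SOME \<mu>. \<mu> \<in> cls z"
    note zr = cls_rep[OF z]
    have "kK M k y (cls z) = ip (T ?x) (T ?z)" by (simp add: kK_def x)
    also have "\<dots> = T ?x (cls ?z)" by (rule ip_T[OF T_D[OF xr(1)] zr(1)])
    also have "\<dots> = T ?x (cls z)" using T_ev[OF xr(1) zr(1)] cls_X[OF z] by (simp add: Tk_def)
    finally show "R (kK M k y) (cls z) = T ?x (cls z)" using cls_X[OF z] by simp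
  qed (use D_ext T_D xr in auto)
  have "f y = ip f (T ?x)" if f: "f \<in> D" for f
  proof -
    have "cmod (f (cls x) - f (cls ?x)) \<le> N f * 0"
      using N_bound[OF f xr(2)] ev_diff[OF f x(1) xr(1) xr(2)] xr(3) by simp
    then show ?thesis using ip_T[OF f xr(1)] x by simp
  qed
  then show "R (kK M k y) \<in> D \<and> (\<forall>f\<in>D. f y = ip f (R (kK M k y)))"
    unfolding eq using T_D[OF xr(1)] by blast
qed

lemma dual_space_properties: "hilbert_fun_space X D ip
    \<and> (\<forall>F\<in>D. N F = sqrt (Re (ip F F)))
    \<and> (\<forall>x\<in>V. T x \<in> D)
    \<and> reproducing_kernel X D ip (kK M k)
    \<and> (\<forall>F\<in>D. \<forall>x\<in>V. F (cls x) = ip F (T x))"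
  using dual_hilbert N_ip T_D dual_reproducing ip_T by simp

end

section \<open>Measurable positive definite kernels\<close>

text \<open>The numbers are the entries of a 2 by 2 matrix whose quadratic form is real and
  nonnegative. The vectors (1,0), (0,1), (1,1) and (\<i>,1) give symmetry; choosing \<open>b\<close>
  as \<open>- q\<close> and \<open>a\<close> real reduces Cauchy-Schwarz to one real quadratic
  polynomial.\<close>

lemma hermitian_of_real_quadratic:
  fixes p q r s :: complex
  assumes nonneg: "\<And>a b. cnj a * a * p + cnj b * a * q + cnj a * b * r + cnj b * b * s \<in> \<real> \<and>
      Re (cnj a * a * p + cnj b * a * q + cnj a * b * r + cnj b * b * s) \<ge> 0"
  shows "r = cnj q" and "(cmod q)\<^sup>2 \<le> Re p * Re s"
proof -
  have p: "Im p = 0" "Re p \<ge> 0" using nonneg[of 1 0] by (auto simp: complex_is_Real_iff)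
  have s: "Im s = 0" "Re s \<ge> 0" using nonneg[of 0 1] by (auto simp: complex_is_Real_iff)
  have 1: "Im q + Im r = 0" using nonneg[of 1 1] p s by (auto simp: complex_is_Real_iff)
  have 2: "Re q - Re r = 0" using nonneg[of \<i> 1] p s by (auto simp: complex_is_Real_iff)
  show r: "r = cnj q" using 1 2 by (auto simp: complex_eq_iff)
  have key: "0 \<le> Re p * x\<^sup>2 - 2 * x * (cmod q)\<^sup>2 + Re s * (cmod q)\<^sup>2" for x :: real
  proof -
    have "cnj (of_real x) * of_real x * p + cnj (- q) * of_real x * q + cnj (of_real x) * (- q) * r
        + cnj (- q) * (- q) * s = of_real (x\<^sup>2) * p - 2 * of_real x * (q * cnj q) + (q * cnj q) * s"
      by (simp add: r algebra_simps power2_eq_square)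
    also have "\<dots> = of_real (x\<^sup>2) * p - of_real (2 * x * (cmod q)\<^sup>2) + of_real ((cmod q)\<^sup>2) * s"
      by (simp add: complex_norm_square[symmetric] flip: of_real_power)
    finally have eq: "cnj (of_real x) * of_real x * p + cnj (- q) * of_real x * q + cnj (of_real x) * (- q) * r
        + cnj (- q) * (- q) * s = of_real (x\<^sup>2) * p - of_real (2 * x * (cmod q)\<^sup>2) + of_real ((cmod q)\<^sup>2) * s" .
    have "0 \<le> Re (of_real (x\<^sup>2) * p - of_real (2 * x * (cmod q)\<^sup>2) + of_real ((cmod q)\<^sup>2) * s)"
      using nonneg[of "of_real x" "- q"] unfolding eq by blast
    then show ?thesis by (simp add: algebra_simps)
  qed
  show "(cmod q)\<^sup>2 \<le> Re p * Re s"
  proof (cases "Re p = 0")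
    case True
    \<comment> \<open>With \<open>Re p\<close> equal to 0 the polynomial is affine in its variable;
      at \<open>Re s + 1\<close> it can be nonnegative only if \<open>q\<close> vanishes.\<close>
    have "2 * (Re s + 1) * (cmod q)\<^sup>2 \<le> Re s * (cmod q)\<^sup>2"
      using key[of "Re s + 1"] True by simp
    then have "(Re s + 2) * (cmod q)\<^sup>2 \<le> 0" by (simp add: algebra_simps)
    then have "(cmod q)\<^sup>2 \<le> 0" using s(2) by (simp add: mult_le_0_iff)
    then show ?thesis using True by simp
  next
    case False
    then have pp: "Re p > 0" using p by simp
    \<comment> \<open>This is the point where the quadratic polynomial in \<open>key\<close> attains
      its minimum.\<close>
    define x where "x = (cmod q)\<^sup>2 / Re p"
    have "Re p * x\<^sup>2 = x * (cmod q)\<^sup>2" using pp by (simp add: x_def power2_eq_square)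
    then have "x * (cmod q)\<^sup>2 \<le> Re s * (cmod q)\<^sup>2" using key[of x] by simp
    then have "x \<le> Re s \<or> q = 0" using mult_right_le_imp_le[of x "(cmod q)\<^sup>2" "Re s"] by fastforce
    then show ?thesis using pp p s by (auto simp: x_def field_simps)
  qed
qed

lemma ennreal_le_sqrt_mult:
  assumes "x = ennreal c" "c\<^sup>2 \<le> a * b" "a \<ge> 0" "b \<ge> 0"
  shows "x \<le> ennreal (sqrt a * sqrt b)"
  unfolding assms(1) using assms(2) by (intro ennreal_leI) (simp add: real_le_rsqrt flip: real_sqrt_mult)

locale measurable_pd_kernel =
  fixes M :: "'a measure" and k :: "'a \<Rightarrow> 'a \<Rightarrow> complex"
  assumes meas: "(\<lambda>(t, s). k t s) \<in> borel_measurable (M \<Otimes>\<^sub>M M)"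
    and pd: "kernel_pd M k"
begin

section \<open>Absolute energies and potentials\<close>

abbreviation v :: "('a set \<Rightarrow> complex) \<Rightarrow> 'a measure" where "v \<equiv> cm_variation M"

definition row_mass :: "('a set \<Rightarrow> complex) \<Rightarrow> 'a \<Rightarrow> ennreal" where
  "row_mass \<xi> t = (\<integral>\<^sup>+s. ennreal (cmod (k t s)) \<partial>v \<xi>)"

text \<open>The absolute counterpart of \<open>kip\<close>, with values in \<open>ennreal\<close> so
  that it makes sense before any convergence is known. By Tonelli its finiteness on the diagonal is
  exactly \<open>kfinite\<close>.\<close>

definition energy :: "('a set \<Rightarrow> complex) \<Rightarrow> ('a set \<Rightarrow> complex) \<Rightarrow> ennreal" where
  "energy \<xi> \<eta> = (\<integral>\<^sup>+t. row_mass \<eta> t \<partial>v \<xi>)"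

definition pot :: "('a set \<Rightarrow> complex) \<Rightarrow> 'a \<Rightarrow> complex" where
  "pot \<xi> t = cm_integral M \<xi> (k t)"

lemma kip_pot: "kip M k \<xi> \<eta> = cm_integral M (\<lambda>A. cnj (\<eta> A)) (pot \<xi>)"
  by (simp add: kip_def pot_def[abs_def])

lemma k_pair: "sets P = sets M \<Longrightarrow> sets N = sets M \<Longrightarrow> (\<lambda>(t, s). k t s) \<in> borel_measurable (P \<Otimes>\<^sub>M N)"
  using meas measurable_cong_sets[OF sets_pair_measure_cong refl] by blast

lemma k_row: "t \<in> space M \<Longrightarrow> k t \<in> borel_measurable M"
  using measurable_Pair2[OF meas, of t] by simp

lemma k_row_norm: "t \<in> space M \<Longrightarrow> (\<lambda>s. ennreal (cmod (k t s))) \<in> borel_measurable M"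
  by (rule measurable_compose[OF measurable_compose[OF k_row borel_measurable_norm] measurable_ennreal])

lemma k_pair_norm: "sets P = sets M \<Longrightarrow> sets N = sets M \<Longrightarrow>
    (\<lambda>(t, s). ennreal (cmod (k t s))) \<in> borel_measurable (P \<Otimes>\<^sub>M N)"
  using measurable_compose[OF measurable_compose[OF k_pair borel_measurable_norm] measurable_ennreal]
  by (simp add: case_prod_beta')

lemma row_measurable:
  assumes "complex_measure M \<xi>" shows "row_mass \<xi> \<in> borel_measurable M"
proof -
  interpret finite_measure "v \<xi>" by (rule finite_measure_cm_variation[OF assms])
  show ?thesis unfolding row_mass_def[abs_def] by (rule borel_measurable_nn_integral[OF k_pair_norm]) auto
qed

lemma pot_measurable:
  assumes "complex_measure M \<xi>" shows "pot \<xi> \<in> borel_measurable M"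
proof -
  have part: "(\<lambda>t. \<integral>s. k t s \<partial>N) \<in> borel_measurable M" if "finite_measure N" "sets N = sets M" for N
  proof -
    interpret finite_measure N by fact
    show ?thesis by (rule borel_measurable_lebesgue_integral[OF k_pair]) (use that in auto)
  qed
  note r = complex_measure_Re[OF assms] and i = complex_measure_Im[OF assms]
  have [measurable]: "(\<lambda>t. \<integral>s. k t s \<partial>sm_pos M (\<lambda>A. Re (\<xi> A))) \<in> borel_measurable M"
    "(\<lambda>t. \<integral>s. k t s \<partial>sm_neg M (\<lambda>A. Re (\<xi> A))) \<in> borel_measurable M"
    "(\<lambda>t. \<integral>s. k t s \<partial>sm_pos M (\<lambda>A. Im (\<xi> A))) \<in> borel_measurable M"
    "(\<lambda>t. \<integral>s. k t s \<partial>sm_neg M (\<lambda>A. Im (\<xi> A))) \<in> borel_measurable M"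
    by (intro part finite_measure_sm_pos finite_measure_sm_neg r i; simp)+
  show ?thesis unfolding pot_def[abs_def] cm_integral_def sm_integral_def by measurable
qed

lemma kfinite_iff:
  assumes "complex_measure M \<xi>" shows "kfinite M k \<xi> \<longleftrightarrow> energy \<xi> \<xi> < \<infinity>"
proof -
  interpret finite_measure "v \<xi>" by (rule finite_measure_cm_variation[OF assms])
  have "energy \<xi> \<xi> = (\<integral>\<^sup>+z. (case z of (t, s) \<Rightarrow> ennreal (cmod (k t s))) \<partial>(v \<xi> \<Otimes>\<^sub>M v \<xi>))"
    unfolding energy_def row_mass_def using nn_integral_fst[OF k_pair_norm, of "v \<xi>"] by simp
  also have "\<dots> = (\<integral>\<^sup>+z. ennreal (norm (case z of (t, s) \<Rightarrow> k t s)) \<partial>(v \<xi> \<Otimes>\<^sub>M v \<xi>))"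
    by (intro nn_integral_cong) auto
  finally show ?thesis
    unfolding kfinite_def integrable_iff_bounded using k_pair[of "v \<xi>" "v \<xi>"] by simp
qed

lemma M1_iff: "\<xi> \<in> M1 M k \<longleftrightarrow> complex_measure M \<xi> \<and> energy \<xi> \<xi> < \<infinity>"
  using kfinite_iff by (auto simp: M1_def kq_def split: if_splits)

text \<open>Rows are required to be integrable at every point, not almost everywhere: the potential
  of a linear combination must agree pointwise with the combination of potentials for
  \<open>cm_integral_cong\<close> to apply.\<close>

definition good :: "('a set \<Rightarrow> complex) \<Rightarrow> bool" where
  "good \<xi> \<longleftrightarrow> complex_measure M \<xi> \<and> (\<forall>t\<in>space M. row_mass \<xi> t < \<infinity>)"

lemma good_integrable: "good \<xi> \<Longrightarrow> t \<in> space M \<Longrightarrow> integrable (v \<xi>) (k t)"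
  using k_row by (simp add: good_def row_mass_def integrable_iff_bounded borel_measurable_cm_variation)

lemma pot_bound:
  assumes "good \<xi>" "t \<in> space M" shows "ennreal (cmod (pot \<xi> t)) \<le> 4 * row_mass \<xi> t"
  unfolding pot_def row_mass_def
  by (rule cm_integral_bound[OF _ good_integrable[OF assms]]) (use assms in \<open>simp add: good_def\<close>)

lemma pot_nn_integral:
  assumes \<xi>: "good \<xi>" and \<mu>: "complex_measure M \<mu>"
  shows "(\<integral>\<^sup>+t. ennreal (cmod (pot \<xi> t)) \<partial>v \<mu>) \<le> 4 * energy \<mu> \<xi>"
proof -
  have "row_mass \<xi> \<in> borel_measurable (v \<mu>)"
    using row_measurable \<xi> borel_measurable_cm_variation by (auto simp: good_def)
  then have "4 * energy \<mu> \<xi> = (\<integral>\<^sup>+t. 4 * row_mass \<xi> t \<partial>v \<mu>)"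
    unfolding energy_def by (rule nn_integral_cmult[symmetric])
  moreover have "(\<integral>\<^sup>+t. ennreal (cmod (pot \<xi> t)) \<partial>v \<mu>) \<le> (\<integral>\<^sup>+t. 4 * row_mass \<xi> t \<partial>v \<mu>)"
    by (rule nn_integral_mono) (use pot_bound[OF \<xi>] in simp)
  ultimately show ?thesis by simp
qed

lemma pot_integrable:
  assumes \<xi>: "good \<xi>" and \<mu>: "complex_measure M \<mu>" and fin: "energy \<mu> \<xi> < \<infinity>"
  shows "integrable (v \<mu>) (pot \<xi>)"
proof (rule integrableI_bounded)
  show "pot \<xi> \<in> borel_measurable (v \<mu>)"
    using pot_measurable \<xi> borel_measurable_cm_variation by (auto simp: good_def)
  show "(\<integral>\<^sup>+t. ennreal (cmod (pot \<xi> t)) \<partial>v \<mu>) < \<infinity>"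
    using pot_nn_integral[OF \<xi> \<mu>] fin by (auto intro: order_le_less_trans simp: ennreal_mult_less_top)
qed

text \<open>Each of the two successive integrations contributes a factor 4.\<close>

lemma kip_bound:
  assumes \<xi>: "good \<xi>" and \<mu>: "complex_measure M \<mu>" and fin: "energy \<mu> \<xi> < \<infinity>"
  shows "ennreal (cmod (kip M k \<xi> \<mu>)) \<le> 16 * energy \<mu> \<xi>"
proof -
  have "ennreal (cmod (kip M k \<xi> \<mu>)) \<le> 4 * (\<integral>\<^sup>+t. ennreal (cmod (pot \<xi> t)) \<partial>v \<mu>)"
    unfolding kip_pot
    using cm_integral_bound[OF complex_measure_cnj[OF \<mu>], of "pot \<xi>"] pot_integrable[OF assms] by simp
  also have "\<dots> \<le> 4 * (4 * energy \<mu> \<xi>)" by (intro mult_left_mono pot_nn_integral \<xi> \<mu>) simp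
  also have "\<dots> = 16 * energy \<mu> \<xi>" by (simp flip: mult.assoc)
  finally show ?thesis .
qed

lemma pot_lin:
  assumes "good \<xi>" "good \<eta>" "t \<in> space M"
  shows "pot (\<lambda>A. a * \<xi> A + b * \<eta> A) t = a * pot \<xi> t + b * pot \<eta> t"
  unfolding pot_def
  by (rule cm_integral_lin_measure) (use assms good_integrable in \<open>auto simp: good_def\<close>)

lemma kip_lin_left:
  assumes \<xi>: "good \<xi>" and \<eta>: "good \<eta>" and \<mu>: "complex_measure M \<mu>"
    and i: "integrable (v \<mu>) (pot \<xi>)" "integrable (v \<mu>) (pot \<eta>)"
  shows "kip M k (\<lambda>A. a * \<xi> A + b * \<eta> A) \<mu> = a * kip M k \<xi> \<mu> + b * kip M k \<eta> \<mu>"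
proof -
  have "kip M k (\<lambda>A. a * \<xi> A + b * \<eta> A) \<mu> = cm_integral M (\<lambda>A. cnj (\<mu> A)) (\<lambda>t. a * pot \<xi> t + b * pot \<eta> t)"
    unfolding kip_pot by (rule cm_integral_cong) (rule pot_lin[OF \<xi> \<eta>])
  then show ?thesis
    unfolding kip_pot using cm_integral_lin_fun[OF complex_measure_cnj[OF \<mu>], of "pot \<xi>" "pot \<eta>" a b] i by simp
qed

lemma kip_lin_right:
  assumes \<mu>: "complex_measure M \<mu>" and \<nu>: "complex_measure M \<nu>"
    and i: "integrable (v \<mu>) (pot \<xi>)" "integrable (v \<nu>) (pot \<xi>)"
  shows "kip M k \<xi> (\<lambda>A. a * \<mu> A + b * \<nu> A) = cnj a * kip M k \<xi> \<mu> + cnj b * kip M k \<xi> \<nu>"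
  unfolding kip_pot
  using cm_integral_lin_measure[OF complex_measure_cnj[OF \<mu>] complex_measure_cnj[OF \<nu>], of "pot \<xi>" "cnj a" "cnj b"] i
  by simp

lemma row_lin:
  assumes "complex_measure M \<xi>" "complex_measure M \<eta>" "t \<in> space M"
  shows "row_mass (\<lambda>A. a * \<xi> A + b * \<eta> A) t \<le> ennreal (cmod a) * row_mass \<xi> t + ennreal (cmod b) * row_mass \<eta> t"
  unfolding row_mass_def by (rule nn_integral_variation_lin) (use assms k_row_norm in auto)

lemma energy_lin_left:
  assumes "complex_measure M \<xi>" "complex_measure M \<eta>" "complex_measure M \<mu>"
  shows "energy (\<lambda>A. a * \<xi> A + b * \<eta> A) \<mu> \<le> ennreal (cmod a) * energy \<xi> \<mu> + ennreal (cmod b) * energy \<eta> \<mu>"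
  unfolding energy_def by (rule nn_integral_variation_lin) (use assms row_measurable in auto)

lemma energy_lin_right:
  assumes \<xi>: "complex_measure M \<xi>" and \<eta>: "complex_measure M \<eta>" and \<mu>: "complex_measure M \<mu>"
  shows "energy \<mu> (\<lambda>A. a * \<xi> A + b * \<eta> A) \<le> ennreal (cmod a) * energy \<mu> \<xi> + ennreal (cmod b) * energy \<mu> \<eta>"
proof -
  have m: "row_mass \<xi> \<in> borel_measurable (v \<mu>)" "row_mass \<eta> \<in> borel_measurable (v \<mu>)"
    using row_measurable \<xi> \<eta> borel_measurable_cm_variation by auto
  have "energy \<mu> (\<lambda>A. a * \<xi> A + b * \<eta> A) \<le> (\<integral>\<^sup>+t. ennreal (cmod a) * row_mass \<xi> t + ennreal (cmod b) * row_mass \<eta> t \<partial>v \<mu>)"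
    unfolding energy_def by (rule nn_integral_mono) (use row_lin[OF \<xi> \<eta>] in simp)
  also have "\<dots> = ennreal (cmod a) * energy \<mu> \<xi> + ennreal (cmod b) * energy \<mu> \<eta>"
    unfolding energy_def using m by (simp add: nn_integral_add nn_integral_cmult)
  finally show ?thesis .
qed

section \<open>Symmetry and Cauchy-Schwarz for a pair with finite mixed energies\<close>

lemma energy_lin_finite:
  assumes \<xi>: "complex_measure M \<xi>" and \<eta>: "complex_measure M \<eta>"
    and fin: "energy \<xi> \<xi> < \<infinity>" "energy \<xi> \<eta> < \<infinity>" "energy \<eta> \<xi> < \<infinity>" "energy \<eta> \<eta> < \<infinity>"
  shows "energy (\<lambda>A. a * \<xi> A + b * \<eta> A) (\<lambda>A. a * \<xi> A + b * \<eta> A) < \<infinity>"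
proof -
  have r: "energy \<mu> (\<lambda>A. a * \<xi> A + b * \<eta> A) < \<infinity>"
    if "complex_measure M \<mu>" "energy \<mu> \<xi> < \<infinity>" "energy \<mu> \<eta> < \<infinity>" for \<mu>
    using energy_lin_right[OF \<xi> \<eta> that(1), of a b] that(2,3)
    by (auto intro: order_le_less_trans simp: ennreal_mult_less_top)
  show ?thesis
    using energy_lin_left[OF \<xi> \<eta> complex_measure_lin[OF \<xi> \<eta>], of a b a b] r[OF \<xi>] r[OF \<eta>] fin
    by (auto intro: order_le_less_trans simp: ennreal_mult_less_top)
qed

text \<open>Finite mixed energies keep every combination of the two measures \<open>kfinite\<close>,
  so positive definiteness applies to all of them; expanding in the coefficients gives the quadratic
  form of a 2 by 2 matrix.\<close>

lemma kip_pair: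
  assumes \<xi>: "good \<xi>" and \<eta>: "good \<eta>"
    and fin: "energy \<xi> \<xi> < \<infinity>" "energy \<xi> \<eta> < \<infinity>" "energy \<eta> \<xi> < \<infinity>" "energy \<eta> \<eta> < \<infinity>"
  shows "kip M k \<eta> \<xi> = cnj (kip M k \<xi> \<eta>)"
    and "(cmod (kip M k \<xi> \<eta>))\<^sup>2 \<le> Re (kip M k \<xi> \<xi>) * Re (kip M k \<eta> \<eta>)"
proof -
  have c: "complex_measure M \<xi>" "complex_measure M \<eta>" using \<xi> \<eta> by (auto simp: good_def)
  note i = pot_integrable[OF \<xi> c(1) fin(1)] pot_integrable[OF \<eta> c(1) fin(2)]
    pot_integrable[OF \<xi> c(2) fin(3)] pot_integrable[OF \<eta> c(2) fin(4)]
  have "cnj a * a * kip M k \<xi> \<xi> + cnj b * a * kip M k \<xi> \<eta> + cnj a * b * kip M k \<eta> \<xi> + cnj b * b * kip M k \<eta> \<eta> \<in> \<real>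
      \<and> Re (cnj a * a * kip M k \<xi> \<xi> + cnj b * a * kip M k \<xi> \<eta> + cnj a * b * kip M k \<eta> \<xi> + cnj b * b * kip M k \<eta> \<eta>) \<ge> 0" for a b
  proof -
    let ?z = "\<lambda>A. a * \<xi> A + b * \<eta> A"
    have z: "complex_measure M ?z" using complex_measure_lin[OF c] .
    have "kip M k ?z ?z \<in> \<real> \<and> Re (kip M k ?z ?z) \<ge> 0"
      using pd kfinite_iff[OF z] energy_lin_finite[OF c fin] z by (simp add: kernel_pd_def)
    moreover have zx: "kip M k ?z \<xi> = a * kip M k \<xi> \<xi> + b * kip M k \<eta> \<xi>" by (rule kip_lin_left[OF \<xi> \<eta> c(1) i(1,2)])
    moreover have ze: "kip M k ?z \<eta> = a * kip M k \<xi> \<eta> + b * kip M k \<eta> \<eta>" by (rule kip_lin_left[OF \<xi> \<eta> c(2) i(3,4)])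
    moreover have "kip M k ?z ?z = cnj a * kip M k ?z \<xi> + cnj b * kip M k ?z \<eta>"
    proof (rule kip_lin_right[OF c])
      have "integrable N (pot ?z)" if "integrable N (pot \<xi>)" "integrable N (pot \<eta>)" "space N = space M" for N
        using that pot_lin[OF \<xi> \<eta>] by (subst Bochner_Integration.integrable_cong[OF refl, where g = "\<lambda>t. a * pot \<xi> t + b * pot \<eta> t"]) auto
      then show "integrable (v \<xi>) (pot ?z)" "integrable (v \<eta>) (pot ?z)" using i by auto
    qed
    ultimately show ?thesis by (simp add: algebra_simps)
  qed
  from hermitian_of_real_quadratic[OF this]
  show "kip M k \<eta> \<xi> = cnj (kip M k \<xi> \<eta>)"
    "(cmod (kip M k \<xi> \<eta>))\<^sup>2 \<le> Re (kip M k \<xi> \<xi>) * Re (kip M k \<eta> \<eta>)" by blast+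
qed

section \<open>Pointwise properties of the kernel from Dirac measures\<close>

lemma row_dirac: "s \<in> space M \<Longrightarrow> t \<in> space M \<Longrightarrow> row_mass (dirac M s) t \<le> ennreal (cmod (k t s))"
  unfolding row_mass_def by (rule nn_integral_dirac[OF _ k_row_norm])

lemma good_dirac:
  assumes s: "s \<in> space M" shows "good (dirac M s)"
  unfolding good_def
proof (intro conjI ballI)
  show "complex_measure M (dirac M s)" by (rule complex_measure_dirac[OF s])
  show "row_mass (dirac M s) t < \<infinity>" if "t \<in> space M" for t
    using row_dirac[OF s that] by (rule order_le_less_trans) simp
qed

lemma energy_dirac: "s \<in> space M \<Longrightarrow> t \<in> space M \<Longrightarrow> energy (dirac M t) (dirac M s) < \<infinity>"
  unfolding energy_def
  using nn_integral_dirac[OF _ row_measurable[OF complex_measure_dirac], of t s] row_dirac[of s t]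
  by (metis ennreal_less_top infinity_ennreal_def order_le_less_trans)

lemma kip_dirac_right:
  assumes \<xi>: "good \<xi>" and t: "t \<in> space M" shows "kip M k \<xi> (dirac M t) = pot \<xi> t"
proof -
  have "(\<lambda>A. cnj (dirac M t A)) = dirac M t" by (auto simp: dirac_def)
  moreover have "pot \<xi> \<in> borel_measurable M" using \<xi> pot_measurable by (simp add: good_def)
  ultimately show ?thesis unfolding kip_pot using cm_integral_dirac[OF t] by simp
qed

lemma kip_dirac: "s \<in> space M \<Longrightarrow> t \<in> space M \<Longrightarrow> kip M k (dirac M s) (dirac M t) = k t s"
  using kip_dirac_right[OF good_dirac] cm_integral_dirac[OF _ k_row] by (simp add: pot_def)

lemma kernel_hermitian: "s \<in> space M \<Longrightarrow> t \<in> space M \<Longrightarrow> k s t = cnj (k t s)"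
  using kip_pair(1)[OF good_dirac good_dirac energy_dirac energy_dirac energy_dirac energy_dirac, of s t]
  by (simp add: kip_dirac)

lemma kernel_diag: "t \<in> space M \<Longrightarrow> Re (k t t) \<ge> 0"
  using pd kfinite_iff[OF complex_measure_dirac] energy_dirac[of t t] kip_dirac[of t t] complex_measure_dirac[of t M]
  by (force simp: kernel_pd_def)

lemma kernel_CS: "s \<in> space M \<Longrightarrow> t \<in> space M \<Longrightarrow> cmod (k t s) \<le> sqrt (Re (k s s)) * sqrt (Re (k t t))"
  using kip_pair(2)[OF good_dirac good_dirac energy_dirac energy_dirac energy_dirac energy_dirac, of s t]
  by (simp add: kip_dirac real_le_rsqrt flip: real_sqrt_mult)

text \<open>Tonelli exchanges the integrations, and Hermitian symmetry of the kernel makes its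
  modulus symmetric.\<close>

lemma energy_swap:
  assumes "complex_measure M \<xi>" "complex_measure M \<eta>" shows "energy \<xi> \<eta> = energy \<eta> \<xi>"
proof -
  interpret x: finite_measure "v \<xi>" by (rule finite_measure_cm_variation[OF assms(1)])
  interpret e: finite_measure "v \<eta>" by (rule finite_measure_cm_variation[OF assms(2)])
  interpret pair_sigma_finite "v \<xi>" "v \<eta>" ..
  have "energy \<xi> \<eta> = (\<integral>\<^sup>+s. \<integral>\<^sup>+t. ennreal (cmod (k t s)) \<partial>v \<xi> \<partial>v \<eta>)"
    unfolding energy_def row_mass_def by (rule Fubini'[symmetric]) (rule k_pair_norm; simp)
  also have "\<dots> = energy \<eta> \<xi>"
    unfolding energy_def row_mass_def
  proof (intro nn_integral_cong)
    fix s t assume "s \<in> space (v \<eta>)" "t \<in> space (v \<xi>)"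
    then show "ennreal (cmod (k t s)) = ennreal (cmod (k s t))" using kernel_hermitian[of s t] by simp
  qed
  finally show ?thesis .
qed

section \<open>Level sets of the diagonal and measures concentrated on them\<close>

definition lev :: "nat \<Rightarrow> 'a set" where
  "lev n = {t\<in>space M. Re (k t t) \<le> real n}"

lemma lev_sets [measurable]: "lev n \<in> sets M"
proof -
  have "(\<lambda>t. k t t) \<in> borel_measurable M"
    using measurable_compose[OF measurable_Pair[OF measurable_ident measurable_ident] meas] by simp
  then show ?thesis unfolding lev_def by measurable
qed

lemma lev_mono: "m \<le> n \<Longrightarrow> lev m \<subseteq> lev n"
  by (auto simp: lev_def)

lemma lev_exhaust:
  assumes "t \<in> space M" obtains n0 where "\<And>n. n \<ge> n0 \<Longrightarrow> t \<in> lev n"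
proof -
  obtain n0 where "Re (k t t) \<le> real n0" using real_arch_simple by blast
  then show ?thesis using that[of n0] assms by (force simp: lev_def)
qed

text \<open>Monotone convergence along the exhausting level sets: a bound uniform in
  \<open>n\<close> yields the bound for the full integral, and in particular its finiteness.\<close>

lemma nn_integral_lev_le:
  assumes N: "sets N = sets M" and f: "f \<in> borel_measurable M"
    and le: "\<And>n. (\<integral>\<^sup>+t. f t * indicator (lev n) t \<partial>N) \<le> c"
  shows "(\<integral>\<^sup>+t. f t \<partial>N) \<le> c"
proof -
  have sp: "space N = space M" using N by (rule sets_eq_imp_space_eq)
  have [measurable]: "f \<in> borel_measurable N" "\<And>n. lev n \<in> sets N"
    using f N measurable_cong_sets[OF N refl] by auto
  have "(\<integral>\<^sup>+t. f t \<partial>N) \<le> (\<integral>\<^sup>+t. (SUP n. f t * indicator (lev n) t) \<partial>N)"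
  proof (rule nn_integral_mono)
    fix t assume "t \<in> space N"
    then obtain n where "t \<in> lev n" using lev_exhaust[of t] sp by blast
    then show "f t \<le> (SUP n. f t * indicator (lev n) t)" by (intro SUP_upper2[of n]) auto
  qed
  also have "\<dots> = (SUP n. \<integral>\<^sup>+t. f t * indicator (lev n) t \<partial>N)"
  proof (rule nn_integral_monotone_convergence_SUP)
    show "incseq (\<lambda>n t. f t * indicator (lev n) t)"
      using lev_mono by (auto simp: incseq_def le_fun_def split: split_indicator)
  qed measurable
  also have "\<dots> \<le> c" using le by (intro SUP_least)
  finally show ?thesis .
qed

text \<open>Concentration is expressed by values on sets, which makes closure under linear
  combinations and conjugation immediate; the almost everywhere form is recovered in
  \<open>V0_AE\<close>.\<close>

definition V0 :: "('a set \<Rightarrow> complex) set" where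
  "V0 = {\<xi>. complex_measure M \<xi> \<and> (\<exists>n. \<forall>B\<in>sets M. \<xi> B = \<xi> (B \<inter> lev n))}"

lemma V0_complex_measure: "\<xi> \<in> V0 \<Longrightarrow> complex_measure M \<xi>"
  by (simp add: V0_def)

text \<open>Every member of a partition of the complement of \<open>lev n\<close> misses
  \<open>lev n\<close>, so \<open>\<xi>\<close> vanishes on it and the variation of the complement
  is 0.\<close>

lemma V0_AE:
  assumes "\<xi> \<in> V0" obtains n where "AE t in v \<xi>. t \<in> lev n"
proof -
  obtain n where \<xi>: "complex_measure M \<xi>" and n: "\<And>B. B \<in> sets M \<Longrightarrow> \<xi> B = \<xi> (B \<inter> lev n)"
    using assms by (auto simp: V0_def)
  have D: "space M - lev n \<in> sets M" by simp
  have "emeasure (v \<xi>) (space M - lev n) = 0"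
  proof -
    have "(\<Sum>i. ennreal (cmod (\<xi> (P i)))) = 0" if P: "P \<in> countable_partitions M (space M - lev n)" for P
    proof -
      have "\<xi> (P i) = 0" for i
      proof -
        have "P i \<in> sets M" "P i \<inter> lev n = {}" using P by (auto simp: countable_partitions_def)
        then show ?thesis using n[of "P i"] signed_additive_empty[OF complex_measure_additive[OF \<xi>]] by simp
      qed
      then show ?thesis by simp
    qed
    then show ?thesis
      unfolding emeasure_cm_variation[OF \<xi> D] partition_sup_def by (intro antisym SUP_least) (simp_all del: suminf_ennreal)
  qed
  then have "AE t in v \<xi>. t \<in> lev n"
    by (intro AE_I[of _ _ "space M - lev n"]) auto
  then show ?thesis using that by blast
qed

lemma V0_lin:
  assumes "\<xi> \<in> V0" "\<eta> \<in> V0" shows "(\<lambda>A. a * \<xi> A + b * \<eta> A) \<in> V0"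
proof -
  have up: "\<zeta> B = \<zeta> (B \<inter> lev n)" if "\<forall>B\<in>sets M. \<zeta> B = \<zeta> (B \<inter> lev m)" "m \<le> n" "B \<in> sets M" for \<zeta> :: "'a set \<Rightarrow> complex" and m n B
  proof -
    have "B \<inter> lev n \<inter> lev m = B \<inter> lev m" using lev_mono[OF that(2)] by auto
    then show ?thesis using that(1) that(3) by (metis lev_sets sets.Int)
  qed
  obtain m n where "\<forall>B\<in>sets M. \<xi> B = \<xi> (B \<inter> lev m)" "\<forall>B\<in>sets M. \<eta> B = \<eta> (B \<inter> lev n)"
    using assms by (auto simp: V0_def)
  then have "\<xi> B = \<xi> (B \<inter> lev (max m n))" "\<eta> B = \<eta> (B \<inter> lev (max m n))" if "B \<in> sets M" for B
    using up[of \<xi> m "max m n" B] up[of \<eta> n "max m n" B] that by (metis max.cobounded1 max.cobounded2)+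
  then have "\<forall>B\<in>sets M. a * \<xi> B + b * \<eta> B = a * \<xi> (B \<inter> lev (max m n)) + b * \<eta> (B \<inter> lev (max m n))"
    by metis
  then show ?thesis
    unfolding V0_def
    using complex_measure_lin[OF V0_complex_measure[OF assms(1)] V0_complex_measure[OF assms(2)]]
    by (intro CollectI conjI exI[of _ "max m n"])
qed

lemma V0_cnj: "\<xi> \<in> V0 \<Longrightarrow> (\<lambda>A. cnj (\<xi> A)) \<in> V0"
  by (auto simp: V0_def complex_measure_cnj)

lemma V0_dirac:
  assumes t: "t \<in> space M" shows "dirac M t \<in> V0"
proof -
  obtain n where "t \<in> lev n" using lev_exhaust[OF t] by blast
  then have "\<forall>B\<in>sets M. dirac M t B = dirac M t (B \<inter> lev n)" by (auto simp: dirac_def)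
  then show ?thesis
    unfolding V0_def using complex_measure_dirac[OF t] by (intro CollectI conjI exI[of _ n])
qed

text \<open>The bound imitates the estimate of a potential at \<open>t\<close> by the norm of the
  measure times the root of \<open>k t t\<close>. On a level set that root is bounded, so energies
  against members of \<open>V0\<close> are finite. The class contains \<open>V0\<close> by kernel
  Cauchy-Schwarz and \<open>M1 M k\<close> by testing.\<close>

definition W :: "('a set \<Rightarrow> complex) set" where
  "W = {\<xi>. complex_measure M \<xi> \<and> energy \<xi> \<xi> < \<infinity> \<and>
     (\<exists>C\<ge>0. \<forall>t\<in>space M. row_mass \<xi> t \<le> ennreal (C * sqrt (Re (k t t))))}"

lemma W_good: "\<xi> \<in> W \<Longrightarrow> good \<xi>"
  by (force simp: W_def good_def intro: order_le_less_trans)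

lemma energy_V0_finite:
  assumes \<mu>: "\<mu> \<in> V0" and C: "C \<ge> 0" "\<And>t. t \<in> space M \<Longrightarrow> row_mass \<xi> t \<le> ennreal (C * sqrt (Re (k t t)))"
  shows "energy \<mu> \<xi> < \<infinity>"
proof -
  interpret finite_measure "v \<mu>" by (rule finite_measure_cm_variation[OF V0_complex_measure[OF \<mu>]])
  obtain n where n: "AE t in v \<mu>. t \<in> lev n" using V0_AE[OF \<mu>] .
  have "energy \<mu> \<xi> \<le> (\<integral>\<^sup>+t. ennreal (C * sqrt (real n)) \<partial>v \<mu>)"
    unfolding energy_def
  proof (rule nn_integral_mono_AE, use n in eventually_elim)
    fix t assume "t \<in> lev n"
    then have t: "t \<in> space M" "Re (k t t) \<le> real n" by (auto simp: lev_def)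
    have "row_mass \<xi> t \<le> ennreal (C * sqrt (Re (k t t)))" by (rule C(2)[OF t(1)])
    also have "\<dots> \<le> ennreal (C * sqrt (real n))" using t C(1) by (intro ennreal_leI mult_left_mono) auto
    finally show "row_mass \<xi> t \<le> ennreal (C * sqrt (real n))" .
  qed
  also have "\<dots> < \<infinity>" by (simp add: emeasure_eq_measure ennreal_mult_less_top)
  finally show ?thesis .
qed

lemma V0_W: assumes "\<xi> \<in> V0" shows "\<xi> \<in> W"
proof -
  interpret finite_measure "v \<xi>" by (rule finite_measure_cm_variation[OF V0_complex_measure[OF assms]])
  obtain n where n: "AE t in v \<xi>. t \<in> lev n" using V0_AE[OF assms] .
  define C where "C = sqrt (real n) * measure (v \<xi>) (space M)"
  have C: "C \<ge> 0" by (simp add: C_def)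
  have row_mass: "row_mass \<xi> t \<le> ennreal (C * sqrt (Re (k t t)))" if t: "t \<in> space M" for t
  proof -
    have "row_mass \<xi> t \<le> (\<integral>\<^sup>+s. ennreal (sqrt (real n) * sqrt (Re (k t t))) \<partial>v \<xi>)"
      unfolding row_mass_def
    proof (rule nn_integral_mono_AE, use n in eventually_elim)
      fix s assume "s \<in> lev n"
      then have s: "s \<in> space M" "Re (k s s) \<le> real n" by (auto simp: lev_def)
      have "cmod (k t s) \<le> sqrt (Re (k s s)) * sqrt (Re (k t t))" by (rule kernel_CS[OF s(1) t])
      also have "\<dots> \<le> sqrt (real n) * sqrt (Re (k t t))"
        using s kernel_diag[OF t] by (intro mult_right_mono) auto
      finally show "ennreal (cmod (k t s)) \<le> ennreal (sqrt (real n) * sqrt (Re (k t t)))" by (rule ennreal_leI)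
    qed
    also have "\<dots> = ennreal (C * sqrt (Re (k t t)))"
      using kernel_diag[OF t] by (simp add: C_def emeasure_eq_measure ennreal_mult[symmetric] mult_ac)
    finally show ?thesis .
  qed
  show ?thesis using V0_complex_measure[OF assms] energy_V0_finite[OF assms C row_mass] C row_mass by (auto simp: W_def)
qed

lemma kip_W_V0:
  assumes \<xi>: "\<xi> \<in> W" and \<mu>: "\<mu> \<in> V0"
  shows "kip M k \<mu> \<xi> = cnj (kip M k \<xi> \<mu>)"
    and "(cmod (kip M k \<xi> \<mu>))\<^sup>2 \<le> Re (kip M k \<xi> \<xi>) * Re (kip M k \<mu> \<mu>)"
    and "energy \<mu> \<xi> < \<infinity>"
proof -
  note \<mu>W = V0_W[OF \<mu>]
  have c: "complex_measure M \<xi>" "complex_measure M \<mu>" using \<xi> \<mu>W by (auto simp: W_def)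
  have e: "energy \<xi> \<xi> < \<infinity>" "energy \<mu> \<mu> < \<infinity>" using \<xi> \<mu>W by (auto simp: W_def)
  show e1: "energy \<mu> \<xi> < \<infinity>" using \<xi> energy_V0_finite[OF \<mu>] by (auto simp: W_def)
  then have e2: "energy \<xi> \<mu> < \<infinity>" using energy_swap[OF c] by simp
  show "kip M k \<mu> \<xi> = cnj (kip M k \<xi> \<mu>)" "(cmod (kip M k \<xi> \<mu>))\<^sup>2 \<le> Re (kip M k \<xi> \<xi>) * Re (kip M k \<mu> \<mu>)"
    using kip_pair[OF W_good[OF \<xi>] W_good[OF \<mu>W] e(1) e2 e1 e(2)] by auto
qed

text \<open>Duality: a density of modulus at most 1 that cancels the phase of \<open>f\<close> turns
  a signed integral into an absolute one on \<open>lev n\<close>. Its variation lies below that of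
  \<open>\<xi>\<close>, with constant 1, so the energy does not grow. The last claim assumes
  integrability because a divergent integral would count as 0.\<close>

lemma test_measure:
  assumes \<xi>: "complex_measure M \<xi>" and f: "f \<in> borel_measurable M"
  obtains \<tau> where "\<tau> \<in> V0" "energy \<tau> \<tau> \<le> energy \<xi> \<xi>"
    "integrable (v \<tau>) f \<Longrightarrow> ennreal (cmod (cm_integral M \<tau> f)) = (\<integral>\<^sup>+s. ennreal (cmod (f s)) * indicator (lev n) s \<partial>v \<xi>)"
proof -
  interpret finite_measure "v \<xi>" by (rule finite_measure_cm_variation[OF \<xi>])
  \<comment> \<open>At zeros of \<open>f\<close> the quotient is 0, so \<open>u\<close> stays
    bounded by 1 and no case distinction is needed.\<close>
  define u where "u s = indicator (lev n) s *\<^sub>R (cnj (f s) / complex_of_real (cmod (f s)))" for s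
  have [measurable]: "f \<in> borel_measurable M" by fact
  have [measurable]: "(\<lambda>s. cnj (f s)) \<in> borel_measurable M"
    by (rule measurable_compose[OF f borel_measurable_continuous_onI]) (intro continuous_intros)
  have um: "u \<in> borel_measurable M" unfolding u_def[abs_def] by measurable
  have u1: "cmod (u s) \<le> 1" for s by (auto simp: u_def norm_divide split: split_indicator)
  have ui: "integrable (v \<xi>) u"
    by (rule integrable_const_bound[of _ 1]) (use u1 um borel_measurable_cm_variation in auto)
  define \<tau> where "\<tau> = density_measure (v \<xi>) u"
  have d: "has_density M \<tau> (v \<xi>) u" unfolding \<tau>_def by (rule has_density_density_measure[OF _ ui]) simp
  have c: "complex_measure M \<tau>" unfolding \<tau>_def by (rule complex_measure_density_measure[OF _ ui]) simp
  have "\<tau> B = \<tau> (B \<inter> lev n)" if B: "B \<in> sets M" for B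
  proof -
    have "B \<inter> lev n \<in> sets M" using B by simp
    then show ?thesis
      unfolding has_densityD(6)[OF d B] has_densityD(6)[OF d \<open>B \<inter> lev n \<in> sets M\<close>]
      by (intro Bochner_Integration.integral_cong) (auto simp: u_def split: split_indicator)
  qed
  then have V: "\<tau> \<in> V0" unfolding V0_def using c by (intro CollectI conjI exI[of _ n] ballI)
  have le: "(\<integral>\<^sup>+s. g s \<partial>v \<tau>) \<le> (\<integral>\<^sup>+s. g s \<partial>v \<xi>)" if "g \<in> borel_measurable M" for g
  proof -
    have "(\<integral>\<^sup>+s. g s \<partial>v \<tau>) \<le> (\<integral>\<^sup>+s. ennreal (cmod (u s)) * g s \<partial>v \<xi>)"
      by (rule nn_integral_cm_variation_le(1)[OF c d that])
    also have "\<dots> \<le> (\<integral>\<^sup>+s. 1 * g s \<partial>v \<xi>)"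
      using u1 by (intro nn_integral_mono mult_right_mono) auto
    finally show ?thesis by simp
  qed
  have "energy \<tau> \<tau> \<le> (\<integral>\<^sup>+t. row_mass \<xi> t \<partial>v \<tau>)"
    unfolding energy_def row_mass_def by (intro nn_integral_mono le k_row_norm) simp
  also have "\<dots> \<le> energy \<xi> \<xi>"
    unfolding energy_def by (rule le[OF row_measurable[OF \<xi>]])
  finally have E: "energy \<tau> \<tau> \<le> energy \<xi> \<xi>" .
  have "ennreal (cmod (cm_integral M \<tau> f)) = (\<integral>\<^sup>+s. ennreal (cmod (f s)) * indicator (lev n) s \<partial>v \<xi>)"
    if i: "integrable (v \<tau>) f"
  proof -
    have uf: "u s * f s = complex_of_real (cmod (f s) * indicator (lev n) s)" for s
      by (auto simp: u_def mult.commute complex_norm_square[symmetric] power2_eq_square split: split_indicator)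
    have "integrable (v \<xi>) (\<lambda>s. cmod (u s * f s))" by (intro integrable_norm integrable_density_mult[OF c d i])
    moreover have "cmod (u s * f s) = cmod (f s) * indicator (lev n) s" for s
      unfolding uf norm_of_real by (auto split: split_indicator)
    ultimately have i2: "integrable (v \<xi>) (\<lambda>s. cmod (f s) * indicator (lev n) s)" by (simp only:)
    have "cm_integral M \<tau> f = complex_of_real (\<integral>s. cmod (f s) * indicator (lev n) s \<partial>v \<xi>)"
      unfolding cm_integral_eq[OF c d i] uf by (rule integral_complex_of_real)
    then have "ennreal (cmod (cm_integral M \<tau> f)) = ennreal (\<integral>s. cmod (f s) * indicator (lev n) s \<partial>v \<xi>)"
      by (simp add: integral_nonneg_AE)
    also have "\<dots> = (\<integral>\<^sup>+s. ennreal (cmod (f s) * indicator (lev n) s) \<partial>v \<xi>)"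
      by (rule nn_integral_eq_integral[symmetric, OF i2]) auto
    also have "\<dots> = (\<integral>\<^sup>+s. ennreal (cmod (f s)) * indicator (lev n) s \<partial>v \<xi>)"
      by (intro nn_integral_cong) (auto split: split_indicator)
    finally show ?thesis .
  qed
  then show ?thesis using that V E by blast
qed

text \<open>Bounds the squared norm of a test measure by a quantity that does not mention the level
  \<open>n\<close>, so the estimate survives the passage to the limit.\<close>

lemma kip_V0_self:
  assumes "\<tau> \<in> V0" "energy \<tau> \<tau> \<le> e" "e < \<infinity>"
  shows "0 \<le> Re (kip M k \<tau> \<tau>)" "Re (kip M k \<tau> \<tau>) \<le> 16 * enn2real e"
proof -
  have W: "\<tau> \<in> W" using V0_W[OF assms(1)] .
  then have c: "complex_measure M \<tau>" and fin: "energy \<tau> \<tau> < \<infinity>" by (auto simp: W_def)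
  show "0 \<le> Re (kip M k \<tau> \<tau>)" using pd c kfinite_iff[OF c] fin by (simp add: kernel_pd_def)
  have "ennreal (cmod (kip M k \<tau> \<tau>)) \<le> 16 * energy \<tau> \<tau>" by (rule kip_bound[OF W_good[OF W] c fin])
  also have "\<dots> \<le> 16 * e" using assms by (intro mult_left_mono) auto
  also have "\<dots> = ennreal (16 * enn2real e)" using assms by (simp add: ennreal_mult less_top)
  finally have "cmod (kip M k \<tau> \<tau>) \<le> 16 * enn2real e" by (simp add: ennreal_le_iff)
  then show "Re (kip M k \<tau> \<tau>) \<le> 16 * enn2real e" using complex_Re_le_cmod order_trans by blast
qed

text \<open>Testing against the measure with density \<open>cnj (sgn (k t s))\<close> with respect to the total variation
  turns the Cauchy-Schwarz inequality into absolute integrability of each row_mass of the kernel.\<close>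
lemma M1_W:
  assumes "\<xi> \<in> M1 M k" shows "\<xi> \<in> W"
proof -
  have \<xi>: "complex_measure M \<xi>" and fin: "energy \<xi> \<xi> < \<infinity>" using assms M1_iff by auto
  \<comment> \<open>The root comes from Cauchy-Schwarz against the Dirac measure at
    \<open>t\<close>, the 16 from the squared norm of the test measure.\<close>
  define C where "C = sqrt (16 * enn2real (energy \<xi> \<xi>))"
  have "row_mass \<xi> t \<le> ennreal (C * sqrt (Re (k t t)))" if t: "t \<in> space M" for t
    unfolding row_mass_def
  proof (rule nn_integral_lev_le[OF _ k_row_norm[OF t]])
    fix n
    obtain \<tau> where \<tau>: "\<tau> \<in> V0" "energy \<tau> \<tau> \<le> energy \<xi> \<xi>"
      "integrable (v \<tau>) (k t) \<Longrightarrow> ennreal (cmod (cm_integral M \<tau> (k t))) = (\<integral>\<^sup>+s. ennreal (cmod (k t s)) * indicator (lev n) s \<partial>v \<xi>)"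
      by (rule test_measure[OF \<xi> k_row[OF t], of n], rule that)
    note W = V0_W[OF \<tau>(1)]
    have eq: "(\<integral>\<^sup>+s. ennreal (cmod (k t s)) * indicator (lev n) s \<partial>v \<xi>) = ennreal (cmod (kip M k \<tau> (dirac M t)))"
      using \<tau>(3)[OF good_integrable[OF W_good[OF W] t]] kip_dirac_right[OF W_good[OF W] t] by (simp add: pot_def)
    have "(cmod (kip M k \<tau> (dirac M t)))\<^sup>2 \<le> Re (kip M k \<tau> \<tau>) * Re (k t t)"
      using kip_W_V0(2)[OF W V0_dirac[OF t]] kip_dirac[OF t t] by simp
    also have "\<dots> \<le> 16 * enn2real (energy \<xi> \<xi>) * Re (k t t)"
      by (intro mult_right_mono kip_V0_self(2)[OF \<tau>(1,2) fin] kernel_diag t)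
    finally show "(\<integral>\<^sup>+s. ennreal (cmod (k t s)) * indicator (lev n) s \<partial>v \<xi>) \<le> ennreal (C * sqrt (Re (k t t)))"
      unfolding C_def by (rule ennreal_le_sqrt_mult[OF eq]) (use kernel_diag[OF t] in auto)
  qed simp
  moreover have "C \<ge> 0" by (simp add: C_def)
  ultimately show ?thesis using \<xi> fin by (auto simp: W_def)
qed

text \<open>Second run of the testing argument, now in the outer variable with the potential of
  \<open>\<xi>\<close> in place of a kernel row. Membership of \<open>\<xi>\<close> in
  \<open>W\<close> makes Cauchy-Schwarz against members of \<open>V0\<close> available and yields a
  bound uniform in the level.\<close>

lemma M1_pot_integrable:
  assumes "\<xi> \<in> M1 M k" "\<mu> \<in> M1 M k" shows "integrable (v \<mu>) (pot \<xi>)"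
proof -
  have \<xi>: "complex_measure M \<xi>" and \<xi>fin: "energy \<xi> \<xi> < \<infinity>" using assms M1_iff by auto
  have \<mu>: "complex_measure M \<mu>" and fin: "energy \<mu> \<mu> < \<infinity>" using assms M1_iff by auto
  note W = M1_W[OF assms(1)]
  have m: "pot \<xi> \<in> borel_measurable M" by (rule pot_measurable[OF \<xi>])
  have pos: "0 \<le> Re (kip M k \<xi> \<xi>)" using pd \<xi> kfinite_iff[OF \<xi>] \<xi>fin by (simp add: kernel_pd_def)
  have "(\<integral>\<^sup>+t. ennreal (cmod (pot \<xi> t)) \<partial>v \<mu>) \<le> ennreal (sqrt (Re (kip M k \<xi> \<xi>)) * sqrt (16 * enn2real (energy \<mu> \<mu>)))"
  proof (rule nn_integral_lev_le)
    show "(\<lambda>t. ennreal (cmod (pot \<xi> t))) \<in> borel_measurable M" using m by measurable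
    fix n
    obtain \<tau> where \<tau>: "\<tau> \<in> V0" "energy \<tau> \<tau> \<le> energy \<mu> \<mu>"
      "integrable (v \<tau>) (pot \<xi>) \<Longrightarrow> ennreal (cmod (cm_integral M \<tau> (pot \<xi>))) = (\<integral>\<^sup>+s. ennreal (cmod (pot \<xi> s)) * indicator (lev n) s \<partial>v \<mu>)"
      by (rule test_measure[OF \<mu> m, of n], rule that)
    \<comment> \<open>\<open>kip\<close> conjugates its second measure, so the test measure is
      conjugated beforehand; variation and energy are unchanged.\<close>
    define \<sigma> where "\<sigma> = (\<lambda>A. cnj (\<tau> A))"
    have \<sigma>: "\<sigma> \<in> V0" using V0_cnj[OF \<tau>(1)] by (simp add: \<sigma>_def)
    have row_mass: "row_mass \<sigma> = row_mass \<tau>" by (simp add: row_mass_def[abs_def] \<sigma>_def)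
    have e\<sigma>: "energy \<sigma> \<sigma> \<le> energy \<mu> \<mu>" using \<tau>(2) by (simp add: energy_def row_mass) (simp add: \<sigma>_def)
    have i: "integrable (v \<sigma>) (pot \<xi>)"
      by (rule pot_integrable[OF W_good[OF W] V0_complex_measure[OF \<sigma>] kip_W_V0(3)[OF W \<sigma>]])
    then have eq: "(\<integral>\<^sup>+s. ennreal (cmod (pot \<xi> s)) * indicator (lev n) s \<partial>v \<mu>) = ennreal (cmod (kip M k \<xi> \<sigma>))"
      using \<tau>(3) by (simp add: \<sigma>_def kip_pot)
    have "(cmod (kip M k \<xi> \<sigma>))\<^sup>2 \<le> Re (kip M k \<xi> \<xi>) * Re (kip M k \<sigma> \<sigma>)" by (rule kip_W_V0(2)[OF W \<sigma>])
    also have "\<dots> \<le> Re (kip M k \<xi> \<xi>) * (16 * enn2real (energy \<mu> \<mu>))"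
      by (intro mult_left_mono kip_V0_self(2)[OF \<sigma> e\<sigma> fin] pos)
    finally show "(\<integral>\<^sup>+s. ennreal (cmod (pot \<xi> s)) * indicator (lev n) s \<partial>v \<mu>)
        \<le> ennreal (sqrt (Re (kip M k \<xi> \<xi>)) * sqrt (16 * enn2real (energy \<mu> \<mu>)))"
      by (rule ennreal_le_sqrt_mult[OF eq]) (use pos in auto)
  qed simp
  then show ?thesis
    using m borel_measurable_cm_variation by (auto simp: integrable_iff_bounded intro: order_le_less_trans)
qed

lemma M1_lin_left:
  assumes "\<xi> \<in> M1 M k" "\<eta> \<in> M1 M k" "\<mu> \<in> M1 M k"
  shows "kip M k (\<lambda>A. a * \<xi> A + b * \<eta> A) \<mu> = a * kip M k \<xi> \<mu> + b * kip M k \<eta> \<mu>"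
  using kip_lin_left[OF W_good[OF M1_W] W_good[OF M1_W]] M1_pot_integrable assms M1_iff by auto

section \<open>Truncation to level sets\<close>

lemma restrict_lev_V0:
  assumes "complex_measure M \<xi>" shows "restrict_cm M (lev n) \<xi> \<in> V0"
proof -
  have "\<forall>B\<in>sets M. restrict_cm M (lev n) \<xi> B = restrict_cm M (lev n) \<xi> (B \<inter> lev n)"
    by (auto simp: restrict_cm_def Int_assoc)
  then show ?thesis
    unfolding V0_def using complex_measure_restrict_cm[OF lev_sets assms] by (intro CollectI conjI exI[of _ n])
qed

text \<open>The error of a truncation is itself a truncation, so the same energy estimate controls
  it.\<close>

lemma restrict_complement:
  assumes \<xi>: "complex_measure M \<xi>" and E: "E \<in> sets M"
  shows "(\<lambda>A. \<xi> A - restrict_cm M E \<xi> A) = restrict_cm M (space M - E) \<xi>"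
proof
  fix A
  show "\<xi> A - restrict_cm M E \<xi> A = restrict_cm M (space M - E) \<xi> A"
  proof (cases "A \<in> sets M")
    case True
    then have "A - A \<inter> E = A \<inter> (space M - E)" using sets.sets_into_space by blast
    then show ?thesis
      using True signed_additive_Diff[OF complex_measure_additive[OF \<xi>] True, of "A \<inter> E"] E by (simp add: restrict_cm_def)
  next
    case False
    then show ?thesis using \<xi> by (simp add: restrict_cm_def complex_measure_def)
  qed
qed

text \<open>Restriction costs a factor 4 in each variable. Only the outer indicator is kept, which
  is enough for the tails to vanish by dominated convergence.\<close>

lemma energy_restrict:
  assumes \<xi>: "complex_measure M \<xi>" and E: "E \<in> sets M"
  shows "energy (restrict_cm M E \<xi>) (restrict_cm M E \<xi>) \<le> 16 * (\<integral>\<^sup>+t. row_mass \<xi> t * indicator E t \<partial>v \<xi>)"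
proof -
  let ?r = "restrict_cm M E \<xi>"
  have [measurable]: "E \<in> sets M" "row_mass \<xi> \<in> borel_measurable M" using E row_measurable[OF \<xi>] by auto
  have row_mass: "row_mass ?r t \<le> 4 * row_mass \<xi> t" if t: "t \<in> space M" for t
  proof -
    have "row_mass ?r t \<le> 4 * (\<integral>\<^sup>+s. ennreal (cmod (k t s)) * indicator E s \<partial>v \<xi>)"
      unfolding row_mass_def by (rule nn_integral_restrict_cm[OF E \<xi> k_row_norm[OF t]])
    also have "\<dots> \<le> 4 * row_mass \<xi> t"
      unfolding row_mass_def by (intro mult_left_mono nn_integral_mono) (auto split: split_indicator)
    finally show ?thesis .
  qed
  have "energy ?r ?r \<le> 4 * (\<integral>\<^sup>+t. row_mass ?r t * indicator E t \<partial>v \<xi>)"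
    unfolding energy_def by (rule nn_integral_restrict_cm[OF E \<xi> row_measurable[OF complex_measure_restrict_cm[OF E \<xi>]]])
  also have "\<dots> \<le> 4 * (\<integral>\<^sup>+t. 4 * (row_mass \<xi> t * indicator E t) \<partial>v \<xi>)"
    using row_mass by (intro mult_left_mono nn_integral_mono) (auto split: split_indicator)
  also have "(\<integral>\<^sup>+t. 4 * (row_mass \<xi> t * indicator E t) \<partial>v \<xi>) = 4 * (\<integral>\<^sup>+t. row_mass \<xi> t * indicator E t \<partial>v \<xi>)"
    by (rule nn_integral_cmult) (simp add: borel_measurable_cm_variation)
  finally show ?thesis by (simp flip: mult.assoc)
qed

lemma restrict_M1:
  assumes "\<xi> \<in> M1 M k" and E: "E \<in> sets M" shows "restrict_cm M E \<xi> \<in> M1 M k"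
proof -
  have \<xi>: "complex_measure M \<xi>" and fin: "energy \<xi> \<xi> < \<infinity>" using assms M1_iff by auto
  have "(\<integral>\<^sup>+t. row_mass \<xi> t * indicator E t \<partial>v \<xi>) \<le> energy \<xi> \<xi>"
    unfolding energy_def by (intro nn_integral_mono) (auto split: split_indicator)
  then have "16 * (\<integral>\<^sup>+t. row_mass \<xi> t * indicator E t \<partial>v \<xi>) < \<infinity>"
    using fin by (auto intro: order_le_less_trans simp: ennreal_mult_less_top)
  then have "energy (restrict_cm M E \<xi>) (restrict_cm M E \<xi>) < \<infinity>"
    using energy_restrict[OF \<xi> E] by (rule order_le_less_trans[rotated])
  then show ?thesis using M1_iff complex_measure_restrict_cm[OF E \<xi>] by auto
qed

text \<open>The row mass of \<open>\<xi>\<close> is integrable against the variation of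
  \<open>\<xi>\<close> and dominates its restriction to the complement of \<open>lev n\<close>,
  which tends to 0 pointwise. The 256 is the product of the 16 of \<open>kip_bound\<close> and the
  16 of \<open>energy_restrict\<close>.\<close>

lemma kip_tail_tendsto:
  assumes "\<xi> \<in> M1 M k"
  shows "(\<lambda>n. kip M k (restrict_cm M (space M - lev n) \<xi>) (restrict_cm M (space M - lev n) \<xi>)) \<longlonglongrightarrow> 0"
proof -
  have \<xi>: "complex_measure M \<xi>" and fin: "energy \<xi> \<xi> < \<infinity>" using assms M1_iff by auto
  let ?r = "\<lambda>n. restrict_cm M (space M - lev n) \<xi>"
  have [measurable]: "row_mass \<xi> \<in> borel_measurable (v \<xi>)" "\<And>n. space M - lev n \<in> sets (v \<xi>)"
    using row_measurable[OF \<xi>] by (auto simp: borel_measurable_cm_variation)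
  have "(\<lambda>n. \<integral>\<^sup>+t. row_mass \<xi> t * indicator (space M - lev n) t \<partial>v \<xi>) \<longlonglongrightarrow> (\<integral>\<^sup>+t. 0 \<partial>v \<xi>)"
  proof (rule nn_integral_dominated_convergence[where w = "row_mass \<xi>"])
    show "AE t in v \<xi>. (\<lambda>n. row_mass \<xi> t * indicator (space M - lev n) t) \<longlonglongrightarrow> 0"
    proof (rule AE_I2)
      fix t assume "t \<in> space (v \<xi>)"
      then obtain n0 where "\<And>n. n \<ge> n0 \<Longrightarrow> t \<in> lev n" using lev_exhaust[of t] by auto
      then show "(\<lambda>n. row_mass \<xi> t * indicator (space M - lev n) t) \<longlonglongrightarrow> 0"
        by (intro tendsto_eventually eventually_sequentiallyI[of n0]) simp
    qed
    show "(\<integral>\<^sup>+t. row_mass \<xi> t \<partial>v \<xi>) < \<infinity>" using fin by (simp add: energy_def)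
    show "AE t in v \<xi>. row_mass \<xi> t * indicator (space M - lev n) t \<le> row_mass \<xi> t" for n
      by (auto split: split_indicator)
  qed measurable
  then have "(\<lambda>n. 256 * (\<integral>\<^sup>+t. row_mass \<xi> t * indicator (space M - lev n) t \<partial>v \<xi>)) \<longlonglongrightarrow> 256 * 0"
    by (intro ennreal_tendsto_cmult) auto
  then have lim: "(\<lambda>n. 256 * (\<integral>\<^sup>+t. row_mass \<xi> t * indicator (space M - lev n) t \<partial>v \<xi>)) \<longlonglongrightarrow> 0" by simp
  have bd: "ennreal (cmod (kip M k (?r n) (?r n))) \<le> 256 * (\<integral>\<^sup>+t. row_mass \<xi> t * indicator (space M - lev n) t \<partial>v \<xi>)" for n
  proof -
    have D: "space M - lev n \<in> sets M" by simp
    note r = restrict_M1[OF assms D]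
    have "ennreal (cmod (kip M k (?r n) (?r n))) \<le> 16 * energy (?r n) (?r n)"
      using r M1_iff by (intro kip_bound W_good[OF M1_W]) auto
    also have "\<dots> \<le> 16 * (16 * (\<integral>\<^sup>+t. row_mass \<xi> t * indicator (space M - lev n) t \<partial>v \<xi>))"
      by (intro mult_left_mono energy_restrict[OF \<xi> D]) simp
    finally show ?thesis by (simp flip: mult.assoc)
  qed
  have "(\<lambda>n. ennreal (cmod (kip M k (?r n) (?r n)))) \<longlonglongrightarrow> 0"
    by (rule tendsto_sandwich[OF _ _ tendsto_const lim]) (use bd in auto)
  then show ?thesis by (simp add: ennreal_tendsto_0_iff tendsto_norm_zero_iff)
qed

text \<open>Truncating the second measure inserts an indicator into the outer integral only.
  Integrability of the potential, from \<open>M1_pot_integrable\<close>, supplies the dominating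
  function.\<close>

lemma kip_truncate_tendsto:
  assumes "\<xi> \<in> M1 M k" "\<mu> \<in> M1 M k"
  shows "(\<lambda>n. kip M k \<xi> (restrict_cm M (lev n) \<mu>)) \<longlonglongrightarrow> kip M k \<xi> \<mu>"
proof -
  have \<mu>: "complex_measure M \<mu>" and \<xi>: "complex_measure M \<xi>" using assms M1_iff by auto
  have c: "complex_measure M (\<lambda>A. cnj (\<mu> A))" by (rule complex_measure_cnj[OF \<mu>])
  have i: "integrable (v \<mu>) (pot \<xi>)" by (rule M1_pot_integrable[OF assms])
  have i': "integrable (v (\<lambda>A. cnj (\<mu> A))) (pot \<xi>)" using i by simp
  have in': "integrable (v (\<lambda>A. cnj (\<mu> A))) (\<lambda>x. indicator (lev n) x *\<^sub>R pot \<xi> x)" for n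
    using i' by (intro integrable_mult_indicator) auto
  obtain h where "has_density M (\<lambda>A. cnj (\<mu> A)) (v (\<lambda>A. cnj (\<mu> A))) h" using has_density_cm_variation[OF c] .
  then have h: "has_density M (\<lambda>A. cnj (\<mu> A)) (v \<mu>) h" by simp
  have hi: "integrable (v \<mu>) (\<lambda>x. h x * pot \<xi> x)" by (rule integrable_density_mult[OF c h i'])
  have "kip M k \<xi> (restrict_cm M (lev n) \<mu>) = (\<integral>x. h x * (indicator (lev n) x *\<^sub>R pot \<xi> x) \<partial>v \<mu>)" for n
  proof -
    have "(\<lambda>A. cnj (restrict_cm M (lev n) \<mu> A)) = restrict_cm M (lev n) (\<lambda>A. cnj (\<mu> A))" by (auto simp: restrict_cm_def)
    then have "kip M k \<xi> (restrict_cm M (lev n) \<mu>) = cm_integral M (restrict_cm M (lev n) (\<lambda>A. cnj (\<mu> A))) (pot \<xi>)"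
      by (simp add: kip_pot)
    also have "\<dots> = cm_integral M (\<lambda>A. cnj (\<mu> A)) (\<lambda>x. indicator (lev n) x *\<^sub>R pot \<xi> x)"
      by (rule cm_integral_restrict_cm[OF lev_sets c pot_measurable[OF \<xi>] in'])
    also have "\<dots> = (\<integral>x. h x * (indicator (lev n) x *\<^sub>R pot \<xi> x) \<partial>v \<mu>)"
      by (rule cm_integral_eq[OF c h in'])
    finally show ?thesis .
  qed
  moreover have "kip M k \<xi> \<mu> = (\<integral>x. h x * pot \<xi> x \<partial>v \<mu>)"
    unfolding kip_pot by (rule cm_integral_eq[OF c h i'])
  moreover have "(\<lambda>n. \<integral>x. h x * (indicator (lev n) x *\<^sub>R pot \<xi> x) \<partial>v \<mu>) \<longlonglongrightarrow> (\<integral>x. h x * pot \<xi> x \<partial>v \<mu>)"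
  proof (rule integral_dominated_convergence[where w = "\<lambda>x. cmod (h x * pot \<xi> x)"])
    show "integrable (v \<mu>) (\<lambda>x. cmod (h x * pot \<xi> x))" using hi by (rule integrable_norm)
    show "(\<lambda>x. h x * pot \<xi> x) \<in> borel_measurable (v \<mu>)" using hi by simp
    show "(\<lambda>x. h x * (indicator (lev n) x *\<^sub>R pot \<xi> x)) \<in> borel_measurable (v \<mu>)" for n
      by (rule borel_measurable_integrable) (rule integrable_density_mult[OF c h in'])
    show "AE x in v \<mu>. cmod (h x * (indicator (lev n) x *\<^sub>R pot \<xi> x)) \<le> cmod (h x * pot \<xi> x)" for n
      by (auto split: split_indicator)
    show "AE x in v \<mu>. (\<lambda>n. h x * (indicator (lev n) x *\<^sub>R pot \<xi> x)) \<longlonglongrightarrow> h x * pot \<xi> x"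
    proof (rule AE_I2)
      fix x assume "x \<in> space (v \<mu>)"
      then obtain n0 where "\<And>n. n \<ge> n0 \<Longrightarrow> x \<in> lev n" using lev_exhaust[of x] by auto
      then show "(\<lambda>n. h x * (indicator (lev n) x *\<^sub>R pot \<xi> x)) \<longlonglongrightarrow> h x * pot \<xi> x"
        by (intro tendsto_eventually eventually_sequentiallyI[of n0]) simp
    qed
  qed
  ultimately show ?thesis by simp
qed

sublocale dense_subspace_kernel M k V0
proof
  fix x y z :: "'a set \<Rightarrow> complex" and a b c :: complex
  show "(\<lambda>A. c * x A) \<in> M1 M k" if "x \<in> M1 M k"
    using that complex_measure_lin[of M x x c 0] energy_lin_finite[of x x c 0] by (simp add: M1_iff)
  show "(\<lambda>A. x A - y A) \<in> M1 M k" if "x \<in> M1 M k" "y \<in> M1 M k" "kq M k (\<lambda>A. x A - y A) < \<infinity>"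
    using that complex_measure_lin[of M x y 1 "-1"] by (simp add: M1_def)
  show V: "x \<in> M1 M k" if "x \<in> V0" for x
    using V0_W[OF that] by (simp add: W_def M1_iff)
  show "(\<lambda>A. 0) \<in> V0" by (simp add: V0_def complex_measure_def)
  show "(\<lambda>A. a * x A + b * y A) \<in> V0" if "x \<in> V0" "y \<in> V0" using V0_lin[OF that] .
  show "kip M k (\<lambda>A. a * x A + b * y A) z = a * kip M k x z + b * kip M k y z"
    if "x \<in> M1 M k" "y \<in> M1 M k" "z \<in> M1 M k" using M1_lin_left[OF that] .
  show "kip M k y x = cnj (kip M k x y)" if "x \<in> M1 M k" "y \<in> V0" using kip_W_V0(1)[OF M1_W[OF that(1)] that(2)] .
  show "cmod (kip M k x y) \<le> sqrt (Re (kip M k x x)) * sqrt (Re (kip M k y y))" if "x \<in> M1 M k" "y \<in> V0"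
    using kip_W_V0(2)[OF M1_W[OF that(1)] that(2)] by (simp add: real_le_rsqrt flip: real_sqrt_mult)
  show "kip M k x x \<in> \<real> \<and> Re (kip M k x x) \<ge> 0" if "x \<in> M1 M k"
    using that pd kfinite_iff by (simp add: M1_iff kernel_pd_def)
  show "\<exists>s::nat \<Rightarrow> _. (\<forall>n. s n \<in> V0 \<and> (\<lambda>A. x A - s n A) \<in> M1 M k)
        \<and> (\<lambda>n. sqrt (Re (kip M k (\<lambda>A. x A - s n A) (\<lambda>A. x A - s n A)))) \<longlonglongrightarrow> 0
        \<and> (\<forall>y\<in>M1 M k. (\<lambda>n. kip M k y (s n)) \<longlonglongrightarrow> kip M k y x)" if x: "x \<in> M1 M k"
  \<comment> \<open>Truncation to the level sets is the approximating sequence: its errors are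
    tails, and the form converges along it in the second slot.\<close>
  proof (intro exI[of _ "\<lambda>n. restrict_cm M (lev n) x"] conjI allI ballI)
    have xc: "complex_measure M x" using x M1_iff by simp
    note rc = restrict_complement[OF xc lev_sets]
    show "restrict_cm M (lev n) x \<in> V0" for n by (rule restrict_lev_V0[OF xc])
    show "(\<lambda>A. x A - restrict_cm M (lev n) x A) \<in> M1 M k" for n
      unfolding rc by (rule restrict_M1[OF x]) simp
    show "(\<lambda>n. sqrt (Re (kip M k (\<lambda>A. x A - restrict_cm M (lev n) x A) (\<lambda>A. x A - restrict_cm M (lev n) x A)))) \<longlonglongrightarrow> 0"
      unfolding rc using tendsto_real_sqrt[OF tendsto_Re[OF kip_tail_tendsto[OF x]]] by simp
    show "(\<lambda>n. kip M k y (restrict_cm M (lev n) x)) \<longlonglongrightarrow> kip M k y x" if "y \<in> M1 M k" for y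
      by (rule kip_truncate_tendsto[OF that x])
  qed
qed

end

theorem theorem8p2:
  fixes M :: "'a measure" and k :: "'a \<Rightarrow> 'a \<Rightarrow> complex"
  assumes meas: "(\<lambda>(t, s). k t s) \<in> borel_measurable (M \<Otimes>\<^sub>M M)"
    and pd: "kernel_pd M k"
  shows "hilbert_fun_space (Mq M k) (kdual M k) (kdual_ip M k)
    \<and> (\<forall>F\<in>kdual M k. kdual_norm M k F = sqrt (Re (kdual_ip M k F F)))
    \<and> (\<forall>\<xi>\<in>M1 M k. Tk M k \<xi> \<in> kdual M k)
    \<and> reproducing_kernel (Mq M k) (kdual M k) (kdual_ip M k) (kK M k)
    \<and> (\<forall>F\<in>kdual M k. \<forall>\<xi>\<in>M1 M k. F (kcls M k \<xi>) = kdual_ip M k F (Tk M k \<xi>))"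
proof -
  interpret measurable_pd_kernel M k using assms by unfold_locales
  show ?thesis by (rule dual_space_properties)
qed

end
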